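(* Let $a=(a_n)_{n\in\mathbb{Z}}$ be periodic with $a_n>0$ for every $n$. There is a dense subset of $\mathrm{LP}$ such that for every $b$ in it, $\sigma(J_{a,b})$ is a Cantor set of zero lower box-counting dimension, and the spectral type of $J_{a,b}$ is purely singular continuous.
   Context: $\mathrm{LP}\subset\ell^\infty(\mathbb{Z})$ denotes the set of real limit-periodic sequences, i.e. the closure in $\ell^\infty(\mathbb{Z})$ of the set of periodic real sequences. For $a_n>0$ and $b_n\in\mathbb{R}$ bounded, $J_{a,b}$ acts on $\ell^2(\mathbb{Z})$ by $[J_{a,b}u]_n = a_{n-1}u_{n-1} + b_n u_n + a_n u_{n+1}$. A Cantor set is a compact subset of $\mathbb{R}$ with empty interior and no isolated points. The spectral type is purely singular continuous if every spectral measure $\mu_\psi$, $\psi\in\ell^2(\mathbb{Z})$, is supported on a Lebesgue-null set and has no atoms. *)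

theory Defs
  imports "HOL-Analysis.Analysis"
begin

definition periodic_seq :: "(int \<Rightarrow> 'a) \<Rightarrow> bool" where
  "periodic_seq f \<longleftrightarrow> (\<exists>p::int. p > 0 \<and> (\<forall>n. f (n + p) = f n))"

text \<open>Bounded real sequences on Z with the sup-norm, i.e. l-infinity(Z), are
  modelled by the type of bounded continuous functions int to real
  (every function on the discrete space int is continuous).
  LP is the closure of the periodic sequences in this space.\<close>

definition LP :: "(int \<Rightarrow>\<^sub>C real) set" where
  "LP = closure {b. periodic_seq (apply_bcontfun b)}"

definition l2Z :: "(int \<Rightarrow> complex) set" where
  "l2Z = {u. (\<lambda>n. (cmod (u n))\<^sup>2) summable_on UNIV}"

definition jacobi :: "(int \<Rightarrow> real) \<Rightarrow> (int \<Rightarrow> real) \<Rightarrow> (int \<Rightarrow> complex) \<Rightarrow> (int \<Rightarrow> complex)" where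
  "jacobi a b u = (\<lambda>n. complex_of_real (a (n - 1)) * u (n - 1)
                      + complex_of_real (b n) * u n
                      + complex_of_real (a n) * u (n + 1))"

text \<open>Spectrum: the set of z such that J - z is not a bijection of l2(Z)
  (for a bounded operator this is equivalent to failure of bounded invertibility).\<close>

definition jacobi_spectrum :: "(int \<Rightarrow> real) \<Rightarrow> (int \<Rightarrow> real) \<Rightarrow> complex set" where
  "jacobi_spectrum a b =
     {z. \<not> bij_betw (\<lambda>u n. jacobi a b u n - z * u n) l2Z l2Z}"

definition l2_inner :: "(int \<Rightarrow> complex) \<Rightarrow> (int \<Rightarrow> complex) \<Rightarrow> complex" where
  "l2_inner u v = (\<Sum>\<^sub>\<infinity>n. cnj (u n) * v n)"

text \<open>The spectral measure of psi: the finite Borel measure mu on R with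
  <psi, J^k psi> = integral of x^k d mu(x) for all k (functional calculus on
  polynomials; this determines mu uniquely since the spectrum is compact).\<close>

definition is_spectral_measure ::
  "(int \<Rightarrow> real) \<Rightarrow> (int \<Rightarrow> real) \<Rightarrow> (int \<Rightarrow> complex) \<Rightarrow> real measure \<Rightarrow> bool" where
  "is_spectral_measure a b \<psi> \<mu> \<longleftrightarrow>
     sets \<mu> = sets borel \<and> finite_measure \<mu> \<and>
     (\<forall>k::nat. integrable \<mu> (\<lambda>x. x ^ k) \<and>
        complex_of_real (\<integral>x. x ^ k \<partial>\<mu>) = l2_inner \<psi> ((jacobi a b ^^ k) \<psi>))"

definition purely_singular_continuous ::
  "(int \<Rightarrow> real) \<Rightarrow> (int \<Rightarrow> real) \<Rightarrow> bool" where
  "purely_singular_continuous a b \<longleftrightarrow>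
     (\<forall>\<psi>\<in>l2Z. \<forall>\<mu>. is_spectral_measure a b \<psi> \<mu> \<longrightarrow>
        (\<exists>N \<in> sets lborel. emeasure lborel N = 0 \<and> emeasure \<mu> (UNIV - N) = 0) \<and>
        (\<forall>x. emeasure \<mu> {x} = 0))"

definition cantor_set :: "real set \<Rightarrow> bool" where
  "cantor_set S \<longleftrightarrow> compact S \<and> interior S = {} \<and> (\<forall>x\<in>S. x islimpt S)"

definition covering_number :: "real set \<Rightarrow> real \<Rightarrow> nat" where
  "covering_number S \<epsilon> =
     Inf {n. \<exists>C. finite C \<and> card C = n \<and> S \<subseteq> (\<Union>c\<in>C. cball c \<epsilon>)}"

definition lower_box_dim :: "real set \<Rightarrow> ereal" where
  "lower_box_dim S =
     Liminf (at_right 0) (\<lambda>\<epsilon>. ereal (ln (real (covering_number S \<epsilon>)) / ln (1 / \<epsilon>)))"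

end

(*
  Let b be periodic. For every real energy E some periodic
  potential arbitrarily close to b has a gap at E, because a small change of one site in many
  periods makes an elliptic transfer matrix hyperbolic. By compactness finitely many potentials
  V_1, ..., V_m near b have no common point in their spectra. Concatenate long blocks of them
  periodically, to a total period P: at an energy in the gap of V_j every approximate eigenvector
  is exponentially small in the middle of the V_j-blocks, so cutting the bonds there moves the
  spectrum by an exponentially small amount, and the cut operator has at most P eigenvalues.
  So the spectrum near the new potential is covered by O(P) intervals of length exp(-cP), which
  yields lower box dimension zero, and thereby zero measure and empty interior. Very good
  periodic approximation excludes eigenvalues by Gordon's argument; since isolated points of the
  spectrum of a self-adjoint operator and atoms of spectral measures are eigenvalues, neither exists.
  At each scale these are open dense conditions on limit-periodic b, and the Baire category theorem applies.
*)
theory Submission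
  imports Defs "HOL-Computational_Algebra.Polynomial" "HOL-Real_Asymp.Real_Asymp"
begin

section \<open>The Hilbert space of square-summable sequences\<close>

text \<open>The proof needs no spectral theorem; it handles the real approximate point spectrum
  \<open>asp\<close> and polynomials in the operator. For self-adjoint A the best lower bound d of A
  - E is attained as the distance from E to \<open>asp A\<close>, because (A - E)^2 - d^2 is not
  bounded below and factors into A - (E + d) and A - (E - d). Perturbation bounds for the spectrum
  rest on this, and so, after a further factorisation, do eigenvectors at isolated points. Spectral
  measures, given by moments, are tested against powers of 1 - ((A - E) / C)^2. The finite family of
  potentials, its common period q and the decay rate are fixed before the number of periods q per
  block is chosen. The number M of covering intervals is linear in that number and their radius r
  exponentially small in it, so ln M / ln (1 / r) can be made as small as desired. Gordon's
  condition asks for no rate of approximation: the ball around a periodic potential may be as small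
  as one multiple of the period and the energies |E| <= k require.\<close>

lemma l2Z_boundedI:
  assumes "\<And>F. finite F \<Longrightarrow> (\<Sum>n\<in>F. (cmod (u n))\<^sup>2) \<le> B"
  shows "u \<in> l2Z"
  unfolding l2Z_def mem_Collect_eq
  by (rule nonneg_bdd_above_summable_on) (auto intro!: bdd_aboveI2 assms)

lemma l2Z_dominated:
  assumes "v \<in> l2Z" and "\<And>n. cmod (u n) \<le> C * cmod (v n)"
  shows "u \<in> l2Z"
  unfolding l2Z_def mem_Collect_eq
proof (rule summable_on_comparison_test)
  show "(\<lambda>n. C\<^sup>2 * (cmod (v n))\<^sup>2) summable_on UNIV"
    using assms(1) by (auto simp: l2Z_def intro: summable_on_cmult_right)
  show "(cmod (u n))\<^sup>2 \<le> C\<^sup>2 * (cmod (v n))\<^sup>2" for n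
    using power_mono[OF assms(2)[of n], of 2] by (simp add: power_mult_distrib)
qed simp

lemma l2Z_add:
  assumes "u \<in> l2Z" "v \<in> l2Z"
  shows "(\<lambda>n. u n + v n) \<in> l2Z"
  unfolding l2Z_def mem_Collect_eq
proof (rule summable_on_comparison_test)
  show "(\<lambda>n. 2 * (cmod (u n))\<^sup>2 + 2 * (cmod (v n))\<^sup>2) summable_on UNIV"
    using assms by (auto simp: l2Z_def intro!: summable_on_cmult_right summable_on_add)
  show "(cmod (u n + v n))\<^sup>2 \<le> 2 * (cmod (u n))\<^sup>2 + 2 * (cmod (v n))\<^sup>2" for n
  proof -
    have "(cmod (u n + v n))\<^sup>2 \<le> (cmod (u n) + cmod (v n))\<^sup>2"
      by (intro power_mono norm_triangle_ineq norm_ge_zero)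
    then show ?thesis
      using sum_squares_bound[of "cmod (u n)" "cmod (v n)"] by (simp add: power2_sum)
  qed
qed simp

lemma l2Z_shift: "u \<in> l2Z \<Longrightarrow> (\<lambda>n. u (n + k)) \<in> l2Z" for k :: int
  unfolding l2Z_def mem_Collect_eq
  by (subst summable_on_reindex_bij_betw[of "\<lambda>n. n + k" UNIV UNIV "\<lambda>n. (cmod (u n))\<^sup>2"])
     (auto intro: bij_plus_right)

typedef ell2 = l2Z
  morphisms coord Abs_ell2
  by (auto simp: l2Z_def intro: exI[of _ "\<lambda>_. 0"])

setup_lifting type_definition_ell2

lemma coord_l2Z [simp, intro]: "coord u \<in> l2Z"
  by (rule coord)

lemma ell2_eqI: "(\<And>n. coord u n = coord v n) \<Longrightarrow> u = v"
  by (simp add: coord_inject[symmetric] fun_eq_iff)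

lemma coord_Abs [simp]: "u \<in> l2Z \<Longrightarrow> coord (Abs_ell2 u) = u"
  by (rule Abs_ell2_inverse)

lemma summable_inner_l2Z:
  assumes "u \<in> l2Z" "v \<in> l2Z"
  shows "(\<lambda>n. cmod (u n) * cmod (v n)) summable_on UNIV"
proof (rule summable_on_comparison_test)
  show "(\<lambda>n. (cmod (u n))\<^sup>2 + (cmod (v n))\<^sup>2) summable_on UNIV"
    using assms by (auto simp: l2Z_def intro!: summable_on_add)
  show "cmod (u n) * cmod (v n) \<le> (cmod (u n))\<^sup>2 + (cmod (v n))\<^sup>2" for n
    using sum_squares_bound[of "cmod (u n)" "cmod (v n)"]
      mult_nonneg_nonneg[OF norm_ge_zero norm_ge_zero, of "u n" "v n"] by linarith
qed simp

lemma summable_cinner_ell2: "(\<lambda>n. cnj (coord u n) * coord v n) summable_on UNIV"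
  by (rule abs_summable_summable) (simp add: norm_mult summable_inner_l2Z)

lemma summable_inner_ell2: "(\<lambda>n. coord u n \<bullet> coord v n) summable_on UNIV"
  using summable_on_Re[OF summable_cinner_ell2[of u v]] by (simp add: inner_complex_def)

text \<open>Only the real inner product Re <u, v> is used: J has real coefficients, so it is
  symmetric for it, and the operator theory below concerns real energies. Complex scalars act
  coordinatewise through \<open>mulop\<close>.\<close>

instantiation ell2 :: real_inner
begin

lift_definition zero_ell2 :: ell2 is "\<lambda>_. 0"
  by (simp add: l2Z_def)
lift_definition plus_ell2 :: "ell2 \<Rightarrow> ell2 \<Rightarrow> ell2" is "\<lambda>u v n. u n + v n"
  by (rule l2Z_add)
lift_definition uminus_ell2 :: "ell2 \<Rightarrow> ell2" is "\<lambda>u n. - u n"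
  by (simp add: l2Z_def)
lift_definition minus_ell2 :: "ell2 \<Rightarrow> ell2 \<Rightarrow> ell2" is "\<lambda>u v n. u n - v n"
  subgoal for u v using l2Z_add[of u "\<lambda>n. - v n"] by (simp add: l2Z_def) done
lift_definition scaleR_ell2 :: "real \<Rightarrow> ell2 \<Rightarrow> ell2" is "\<lambda>c u n. c *\<^sub>R u n"
  subgoal for c u by (rule l2Z_dominated[of u _ "\<bar>c\<bar>"]) auto done
definition inner_ell2 :: "ell2 \<Rightarrow> ell2 \<Rightarrow> real" where
  "inner_ell2 u v = (\<Sum>\<^sub>\<infinity>n. coord u n \<bullet> coord v n)"
definition norm_ell2 :: "ell2 \<Rightarrow> real" where
  "norm_ell2 u = sqrt (u \<bullet> u)"
definition sgn_ell2 :: "ell2 \<Rightarrow> ell2" where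
  "sgn_ell2 u = inverse (norm u) *\<^sub>R u"
definition dist_ell2 :: "ell2 \<Rightarrow> ell2 \<Rightarrow> real" where
  "dist_ell2 u v = norm (u - v)"
definition uniformity_ell2 :: "(ell2 \<times> ell2) filter" where
  "uniformity_ell2 = (INF e\<in>{0 <..}. principal {(x, y). dist x y < e})"
definition open_ell2 :: "ell2 set \<Rightarrow> bool" where
  "open_ell2 U = (\<forall>x\<in>U. \<forall>\<^sub>F (x', y) in uniformity. x' = x \<longrightarrow> y \<in> U)"

instance
proof
  fix u v w :: ell2 and r s :: real and U :: "ell2 set"
  show "u + v + w = u + (v + w)" "u + v = v + u" "0 + u = u" "- u + u = 0" "u - v = u + - v"
    "r *\<^sub>R (u + v) = r *\<^sub>R u + r *\<^sub>R v" "(r + s) *\<^sub>R u = r *\<^sub>R u + s *\<^sub>R u"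
    "r *\<^sub>R s *\<^sub>R u = (r * s) *\<^sub>R u" "1 *\<^sub>R u = u"
    by (transfer; simp add: algebra_simps fun_eq_iff)+
  show "dist u v = norm (u - v)" by (rule dist_ell2_def)
  show "sgn u = inverse (norm u) *\<^sub>R u" by (rule sgn_ell2_def)
  show "uniformity = (INF e\<in>{0 <..}. principal {(x::ell2, y). dist x y < e})"
    by (rule uniformity_ell2_def)
  show "open U = (\<forall>x\<in>U. \<forall>\<^sub>F (x', y) in uniformity. x' = x \<longrightarrow> y \<in> U)"
    by (rule open_ell2_def)
  show "u \<bullet> v = v \<bullet> u" by (simp add: inner_ell2_def inner_commute)
  show "(u + v) \<bullet> w = u \<bullet> w + v \<bullet> w"
    unfolding inner_ell2_def
    by (subst infsum_add[symmetric]) (auto simp: summable_inner_ell2 plus_ell2.rep_eq inner_add_left)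
  show "(r *\<^sub>R u) \<bullet> v = r * (u \<bullet> v)"
    unfolding inner_ell2_def by (simp add: scaleR_ell2.rep_eq infsum_cmult_right')
  show "0 \<le> u \<bullet> u" unfolding inner_ell2_def by (rule infsum_nonneg) simp
  show "u \<bullet> u = 0 \<longleftrightarrow> u = 0"
  proof
    assume *: "u \<bullet> u = 0"
    have "coord u n = 0" for n
      using nonneg_infsum_le_0D[of "\<lambda>n. coord u n \<bullet> coord u n" UNIV n] * summable_inner_ell2
      by (simp add: inner_ell2_def)
    then show "u = 0" by transfer auto
  qed (simp add: inner_ell2_def zero_ell2.rep_eq)
  show "norm u = sqrt (u \<bullet> u)" by (rule norm_ell2_def)
qed

end

lemmas coord_simps [simp] = zero_ell2.rep_eq plus_ell2.rep_eq uminus_ell2.rep_eq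
  minus_ell2.rep_eq scaleR_ell2.rep_eq

lemma ell2_eq_0_iff: "u = 0 \<longleftrightarrow> (\<forall>n. coord u n = 0)"
  by (auto intro: ell2_eqI)

lemma norm_ell2_sq: "(norm u)\<^sup>2 = (\<Sum>\<^sub>\<infinity>n. (cmod (coord u n))\<^sup>2)" for u :: ell2
  by (simp add: power2_norm_eq_inner inner_ell2_def)

lemma sum_sq_le_norm_ell2: "finite F \<Longrightarrow> (\<Sum>n\<in>F. (cmod (coord u n))\<^sup>2) \<le> (norm u)\<^sup>2" for u :: ell2
  unfolding norm_ell2_sq using coord[of u]
  by (intro finite_sum_le_infsum) (auto simp: l2Z_def)

lemma coord_le_norm: "cmod (coord u n) \<le> norm u"
  using sum_sq_le_norm_ell2[of "{n}" u] by (intro power2_le_imp_le[OF _ norm_ge_zero]) simp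

lemma norm_ell2_leI:
  assumes "\<And>F. finite F \<Longrightarrow> (\<Sum>n\<in>F. (cmod (coord u n))\<^sup>2) \<le> B\<^sup>2" "0 \<le> B"
  shows "norm u \<le> B"
proof -
  have "(norm u)\<^sup>2 \<le> B\<^sup>2"
    unfolding norm_ell2_sq using coord[of u]
    by (intro infsum_le_finite_sums assms(1)) (auto simp: l2Z_def)
  then show ?thesis using assms(2) by (rule power2_le_imp_le)
qed

lemma norm_ell2_dominated:
  assumes "\<And>n. cmod (coord u n) \<le> C * cmod (coord v n)" "0 \<le> C"
  shows "norm u \<le> C * norm v"
proof (rule norm_ell2_leI)
  fix F :: "int set" assume F: "finite F"
  have "(\<Sum>n\<in>F. (cmod (coord u n))\<^sup>2) \<le> (\<Sum>n\<in>F. C\<^sup>2 * (cmod (coord v n))\<^sup>2)"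
    unfolding power_mult_distrib[symmetric] by (intro sum_mono power_mono assms(1) norm_ge_zero)
  also have "\<dots> \<le> C\<^sup>2 * (norm v)\<^sup>2"
    unfolding sum_distrib_left[symmetric]
    by (intro mult_left_mono sum_sq_le_norm_ell2 F) simp
  finally show "(\<Sum>n\<in>F. (cmod (coord u n))\<^sup>2) \<le> (C * norm v)\<^sup>2"
    unfolding power_mult_distrib .
qed (intro mult_nonneg_nonneg assms(2) norm_ge_zero)

instance ell2 :: complete_space
proof
  fix X :: "nat \<Rightarrow> ell2" assume X: "Cauchy X"
  have "Cauchy (\<lambda>k. coord (X k) n)" for n
  proof (rule CauchyI)
    fix e :: real assume "e > 0"
    then obtain M where M: "\<forall>m\<ge>M. \<forall>k\<ge>M. norm (X m - X k) < e"
      using CauchyD[OF X] by blast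
    have "norm (coord (X m) n - coord (X k) n) \<le> norm (X m - X k)" for m k
      using coord_le_norm[of "X m - X k" n] by simp
    then show "\<exists>M. \<forall>m\<ge>M. \<forall>k\<ge>M. norm (coord (X m) n - coord (X k) n) < e"
      using M by (meson order_le_less_trans)
  qed
  then have "\<forall>n. \<exists>l. (\<lambda>k. coord (X k) n) \<longlonglongrightarrow> l"
    by (simp add: Cauchy_convergent_iff convergent_def)
  then obtain l where l: "\<And>n. (\<lambda>k. coord (X k) n) \<longlonglongrightarrow> l n"
    by metis
  \<comment> \<open>Fatou's lemma on finite sets: a bound on all late differences passes to the
    coordinatewise limit. It is applied with B = 1 to place l in \<open>l2Z\<close> and with B = e /
    2 to get convergence in norm.\<close>
  have fin: "(\<Sum>n\<in>F. (cmod (coord (X m) n - l n))\<^sup>2) \<le> B\<^sup>2"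
    if "finite F" and near: "\<And>k. k \<ge> M \<Longrightarrow> norm (X m - X k) \<le> B" and "B \<ge> 0" for F m M B
  proof (rule tendsto_upperbound)
    show "(\<lambda>k. \<Sum>n\<in>F. (cmod (coord (X m) n - coord (X k) n))\<^sup>2)
            \<longlonglongrightarrow> (\<Sum>n\<in>F. (cmod (coord (X m) n - l n))\<^sup>2)"
      by (intro tendsto_intros l)
    have "(\<Sum>n\<in>F. (cmod (coord (X m) n - coord (X k) n))\<^sup>2) \<le> B\<^sup>2" if k: "k \<ge> M" for k
    proof -
      have "(norm (X m - X k))\<^sup>2 \<le> B\<^sup>2"
        by (intro power_mono near[OF k] norm_ge_zero)
      then show ?thesis
        using sum_sq_le_norm_ell2[OF \<open>finite F\<close>, of "X m - X k"] by simp
    qed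
    then show "\<forall>\<^sub>F k in sequentially. (\<Sum>n\<in>F. (cmod (coord (X m) n - coord (X k) n))\<^sup>2) \<le> B\<^sup>2"
      by (auto simp: eventually_sequentially)
  qed simp
  obtain M where M: "\<And>m k. m \<ge> M \<Longrightarrow> k \<ge> M \<Longrightarrow> norm (X m - X k) < 1"
    using CauchyD[OF X zero_less_one] by blast
  have "(\<lambda>n. coord (X M) n - l n) \<in> l2Z"
    by (rule l2Z_boundedI, rule fin[where M = M and B = 1]) (use M in \<open>auto intro: less_imp_le\<close>)
  then have "(\<lambda>n. - (coord (X M) n - l n)) \<in> l2Z"
    by (rule l2Z_dominated[where C = 1]) (simp add: norm_minus_commute)
  then have "(\<lambda>n. coord (X M) n + - (coord (X M) n - l n)) \<in> l2Z"
    by (rule l2Z_add[OF coord_l2Z])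
  then have lin: "l \<in> l2Z" by simp
  have "X \<longlonglongrightarrow> Abs_ell2 l"
  proof (rule LIMSEQ_I)
    fix e :: real assume e: "e > 0"
    then obtain M where M: "\<And>m k. m \<ge> M \<Longrightarrow> k \<ge> M \<Longrightarrow> norm (X m - X k) < e / 2"
      using CauchyD[OF X, of "e / 2"] by auto
    have "norm (X m - Abs_ell2 l) \<le> e / 2" if "m \<ge> M" for m
    proof (rule norm_ell2_leI)
      fix F :: "int set" assume "finite F"
      then show "(\<Sum>n\<in>F. (cmod (coord (X m - Abs_ell2 l) n))\<^sup>2) \<le> (e / 2)\<^sup>2"
        using fin[of F M m "e / 2"] M[OF that] lin e by (simp add: less_imp_le)
    qed (use e in simp)
    moreover have "e / 2 < e" using e by simp
    ultimately show "\<exists>no. \<forall>m\<ge>no. norm (X m - Abs_ell2 l) < e"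
      by (meson order_le_less_trans)
  qed
  then show "convergent X" by (auto simp: convergent_def)
qed

instance ell2 :: banach ..

text \<open>For unbounded f the product may leave \<open>l2Z\<close>; the value 0 in that case makes
  the map total and linear for every f.\<close>

lift_definition mulop :: "(int \<Rightarrow> complex) \<Rightarrow> ell2 \<Rightarrow> ell2" is
  "\<lambda>f u. if bounded (range f) then (\<lambda>n. f n * u n) else (\<lambda>_. 0)"
proof -
  fix f :: "int \<Rightarrow> complex" and u assume u: "u \<in> l2Z"
  show "(if bounded (range f) then (\<lambda>n. f n * u n) else (\<lambda>_. 0)) \<in> l2Z"
  proof (cases "bounded (range f)")
    case True
    then obtain C where "\<And>n. cmod (f n) \<le> C" by (auto simp: bounded_iff)
    then show ?thesis using True
      by (auto intro!: l2Z_dominated[OF u, of _ C] simp: norm_mult mult_right_mono)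
  qed (simp add: l2Z_def)
qed

lift_definition shiftop :: "int \<Rightarrow> ell2 \<Rightarrow> ell2" is "\<lambda>k u n. u (n + k)"
  by (rule l2Z_shift)

lemma coord_mulop [simp]: "bounded (range f) \<Longrightarrow> coord (mulop f u) n = f n * coord u n"
  by (simp add: mulop.rep_eq)

lemmas coord_shiftop [simp] = shiftop.rep_eq

lemma norm_mulop_le:
  assumes "\<And>n. cmod (f n) \<le> C" shows "norm (mulop f u) \<le> C * norm u"
proof (rule norm_ell2_dominated)
  have "bounded (range f)" unfolding bounded_iff by (intro exI[of _ C]) (simp add: assms)
  then show "cmod (coord (mulop f u) n) \<le> C * cmod (coord u n)" for n
    by (simp add: norm_mult mult_right_mono assms)
  show "0 \<le> C" by (rule order_trans[OF norm_ge_zero assms[of 0]])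
qed

lemma inner_shiftop: "shiftop k u \<bullet> v = u \<bullet> shiftop (- k) v"
  unfolding inner_ell2_def coord_shiftop
  using infsum_reindex_bij_betw[of "\<lambda>n. n + k" UNIV UNIV "\<lambda>n. coord u n \<bullet> coord v (n - k)"]
    bij_plus_right[of k] by simp

lemma norm_shiftop [simp]: "norm (shiftop k u) = norm u"
proof -
  have "shiftop (- k) (shiftop k u) = u" by (rule ell2_eqI) simp
  then show ?thesis by (simp add: norm_eq_sqrt_inner inner_shiftop)
qed

lemma bounded_range_cnj: "bounded (range f) \<Longrightarrow> bounded (range (\<lambda>n::int. cnj (f n)))"
  by (simp add: bounded_iff)

lemma inner_mulop:
  assumes "bounded (range f)"
  shows "mulop f u \<bullet> v = u \<bullet> mulop (\<lambda>n. cnj (f n)) v"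
  unfolding inner_ell2_def using assms bounded_range_cnj[OF assms]
  by (auto intro!: infsum_cong simp: inner_complex_def algebra_simps)

lemma linear_mulop: "linear (mulop f)"
  by (rule linearI; rule ell2_eqI) (auto simp: mulop.rep_eq algebra_simps)

lemma linear_shiftop: "linear (shiftop k)"
  by (rule linearI; rule ell2_eqI) auto

text \<open>Transfer matrices bound v at a site by g within distance P. This turns such estimates
  into operator bounds: |v| is dominated by C times a sum of 2 P + 1 shifts of |g|, each with the
  norm of g.\<close>

lemma norm_sum_shifts_bound:
  assumes C: "0 \<le> C" and le: "\<And>n. cmod (coord v n) \<le> C * (\<Sum>i\<in>{-P..P}. cmod (coord g (n + i)))"
    and P: "P \<ge> (0::int)"
  shows "norm v \<le> C * (2 * of_int P + 1) * norm g"
proof -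
  define h where "h = Abs_ell2 (\<lambda>n. complex_of_real (cmod (coord g n)))"
  have "(\<lambda>n. complex_of_real (cmod (coord g n))) \<in> l2Z"
    by (rule l2Z_dominated[of "coord g" _ 1]) auto
  then have h: "coord h n = cmod (coord g n)" for n by (simp add: h_def)
  have nh: "norm h \<le> norm g"
    using norm_ell2_dominated[of h 1 g] by (simp add: h)
  have co: "coord (\<Sum>i\<in>A. shiftop i h) n = (\<Sum>i\<in>A. coord h (n + i))" if "finite A" for A n
    using that by induction auto
  have "norm v \<le> C * norm (\<Sum>i\<in>{-P..P}. shiftop i h)"
  proof (rule norm_ell2_dominated[OF _ C])
    fix n
    have "cmod (\<Sum>i\<in>{-P..P}. coord h (n + i)) = (\<Sum>i\<in>{-P..P}. cmod (coord g (n + i)))"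
      unfolding h of_real_sum[symmetric] by (simp only: norm_of_real) (simp add: sum_nonneg)
    then show "cmod (coord v n) \<le> C * cmod (coord (\<Sum>i\<in>{-P..P}. shiftop i h) n)"
      using le[of n] by (simp add: co)
  qed
  also have "\<dots> \<le> C * (\<Sum>i\<in>{-P..P}. norm h)"
    using norm_sum[of "\<lambda>i. shiftop i h" "{-P..P}"] by (intro mult_left_mono C) simp
  also have "\<dots> = C * (2 * of_int P + 1) * norm h" using P by simp
  also have "\<dots> \<le> C * (2 * of_int P + 1) * norm g"
    using C P by (intro mult_left_mono nh) auto
  finally show ?thesis .
qed

section \<open>Bounded self-adjoint operators\<close>

definition bdd_below_op :: "('a::real_normed_vector \<Rightarrow> 'a) \<Rightarrow> bool" where
  "bdd_below_op T \<longleftrightarrow> (\<exists>c>0. \<forall>u. c * norm u \<le> norm (T u))"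

text \<open>The real approximate point spectrum, which is the whole spectrum of a self-adjoint operator.\<close>
definition asp :: "('a::real_normed_vector \<Rightarrow> 'a) \<Rightarrow> real set" where
  "asp A = {E. \<not> bdd_below_op (\<lambda>u. A u - E *\<^sub>R u)}"

lemma bdd_below_opI: "c > 0 \<Longrightarrow> (\<And>u. c * norm u \<le> norm (T u)) \<Longrightarrow> bdd_below_op T"
  by (auto simp: bdd_below_op_def)

text \<open>Stands in for the spectral mapping theorem: if (A - s)(A - t) is not bounded below, then
  s or t lies in \<open>asp A\<close>.\<close>

lemma bdd_below_op_comp:
  assumes "bdd_below_op S" "bdd_below_op T"
  shows "bdd_below_op (\<lambda>u. S (T u))"
proof -
  obtain c d where cd: "c > 0" "\<And>u. c * norm u \<le> norm (S u)" "d > 0" "\<And>u. d * norm u \<le> norm (T u)"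
    using assms by (auto simp: bdd_below_op_def)
  have "c * d * norm u \<le> norm (S (T u))" for u
    using mult_left_mono[OF cd(4)[of u], of c] cd(1) cd(2)[of "T u"] unfolding mult.assoc by linarith
  then show ?thesis using cd(1,3) by (intro bdd_below_opI[of "c * d"]) auto
qed

lemma norm_diff_scaleR_sq:
  fixes u w :: "'a::real_inner"
  shows "(norm (u - c *\<^sub>R w))\<^sup>2 = (norm u)\<^sup>2 - 2 * c * (u \<bullet> w) + c\<^sup>2 * (norm w)\<^sup>2"
  by (simp add: power2_norm_eq_inner inner_diff inner_commute algebra_simps power2_eq_square[of c])

locale selfadjoint = bounded_linear A
  for A :: "'a::{real_inner,banach} \<Rightarrow> 'a" +
  assumes adj: "A u \<bullet> v = u \<bullet> A v"
begin

lemma selfadjoint_diff: "selfadjoint (\<lambda>u. A u - E *\<^sub>R u)"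
proof -
  have "bounded_linear (\<lambda>u. A u - E *\<^sub>R u)"
    by (intro bounded_linear_sub bounded_linear_axioms bounded_linear_scaleR_right)
  then show ?thesis
    by (intro selfadjoint.intro selfadjoint_axioms.intro) (auto simp: adj inner_diff)
qed

lemma selfadjoint_sq: "selfadjoint (\<lambda>u. A (A u))"
proof -
  have "bounded_linear (\<lambda>u. A (A u))"
    by (intro bounded_linear_compose[OF bounded_linear_axioms] bounded_linear_axioms)
  then show ?thesis
    by (intro selfadjoint.intro selfadjoint_axioms.intro) (auto simp: adj)
qed

text \<open>With d the best lower bound of A, the operator A^2 - d^2 is nonnegative with infimum 0;
  the Cauchy-Schwarz inequality for its quadratic form does the rest.\<close>
lemma sq_diff_not_bdd_below:
  assumes nontriv: "\<exists>u::'a. u \<noteq> 0"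
  shows "\<exists>d\<ge>0. (\<forall>u. d * norm u \<le> norm (A u)) \<and>
    \<not> bdd_below_op (\<lambda>u. A (A u) - d\<^sup>2 *\<^sub>R u)"
proof -
  define d where "d = (INF u\<in>{u. norm u = 1}. norm (A u))"
  obtain u0 :: 'a where "norm u0 = 1"
    using nontriv norm_sgn by metis
  then have ne: "(\<lambda>u. norm (A u)) ` {u. norm u = 1} \<noteq> {}" by blast
  have bdd: "bdd_below ((\<lambda>u. norm (A u)) ` {u. norm u = 1})"
    by (rule bdd_belowI2[of _ 0]) simp
  have d0: "d \<ge> 0" unfolding d_def by (intro cINF_greatest) (use ne in auto)
  have d: "d * norm u \<le> norm (A u)" for u
  proof (cases "u = 0")
    case False
    have "d \<le> norm (A (sgn u))"
      unfolding d_def by (rule cINF_lower[OF bdd]) (simp add: norm_sgn False)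
    also have "\<dots> = norm (A u) / norm u" by (simp add: sgn_div_norm scaleR divide_inverse)
    finally show ?thesis using False by (simp add: field_simps)
  qed simp
  define C where "C u = A (A u) - d\<^sup>2 *\<^sub>R u" for u
  interpret C: selfadjoint C
    unfolding C_def by (rule selfadjoint.selfadjoint_diff[OF selfadjoint_sq])
  have q: "C u \<bullet> u = (norm (A u))\<^sup>2 - d\<^sup>2 * (norm u)\<^sup>2" for u
    by (simp add: C_def inner_diff adj power2_norm_eq_inner)
  have q0: "C u \<bullet> u \<ge> 0" for u
    using power_mono[OF d[of u], of 2] d0 by (simp add: q power_mult_distrib)
  obtain K where K: "K > 0" "\<And>u. norm (C u) \<le> norm u * K"
    using C.pos_bounded by blast
  have CS: "(norm (C u))\<^sup>2 \<le> K * (C u \<bullet> u)" for u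
  proof -
    \<comment> \<open>This choice minimises - 2 t + K t^2; nonnegativity of the form at u - t C u
      then yields |C u|^2 <= K <C u, u>.\<close>
    define t where "t = 1 / K"
    have "0 \<le> C (u - t *\<^sub>R C u) \<bullet> (u - t *\<^sub>R C u)" by (rule q0)
    also have "\<dots> = C u \<bullet> u - 2 * t * (norm (C u))\<^sup>2 + t\<^sup>2 * (C (C u) \<bullet> C u)"
      using C.adj[of "C u" u]
      by (simp add: C.diff C.scaleR inner_diff power2_norm_eq_inner power2_eq_square[of t] algebra_simps)
    also have "C (C u) \<bullet> C u \<le> norm (C u) * K * norm (C u)"
      using norm_cauchy_schwarz[of "C (C u)" "C u"] K(2)[of "C u"]
      by (meson mult_right_mono norm_ge_zero order_trans)
    finally have "0 \<le> C u \<bullet> u - 2 * t * (norm (C u))\<^sup>2 + t\<^sup>2 * (norm (C u) * K * norm (C u))"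
      using K(1) by (simp add: mult_left_mono)
    then show ?thesis using K(1) unfolding t_def by (simp add: field_simps power2_eq_square)
  qed
  have "\<not> bdd_below_op C"
  proof
    assume "bdd_below_op C"
    then obtain c where c: "c > 0" "\<And>u. c * norm u \<le> norm (C u)" by (auto simp: bdd_below_op_def)
    \<comment> \<open>A lower bound c for C would improve the optimal lower bound d of A to this
      larger constant.\<close>
    have "sqrt (d\<^sup>2 + c\<^sup>2 / K) \<le> norm (A u)" if "norm u = 1" for u
    proof (rule real_le_lsqrt)
      show "d\<^sup>2 + c\<^sup>2 / K \<le> (norm (A u))\<^sup>2"
      proof -
        have "c\<^sup>2 \<le> (norm (C u))\<^sup>2"
          using power_mono[OF c(2)[of u], of 2] c(1) that by simp
        also have "\<dots> \<le> K * ((norm (A u))\<^sup>2 - d\<^sup>2)"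
          using CS[of u] q[of u] that by simp
        finally show ?thesis using K(1) by (simp add: field_simps)
      qed
    qed auto
    then have "sqrt (d\<^sup>2 + c\<^sup>2 / K) \<le> d"
      unfolding d_def by (intro cINF_greatest) (use ne in auto)
    moreover have "sqrt (d\<^sup>2 + c\<^sup>2 / K) > sqrt (d\<^sup>2)"
      using c(1) K(1) by (intro real_sqrt_less_mono) simp
    ultimately show False using d0 by simp
  qed
  then show ?thesis using d0 d unfolding C_def by blast
qed

text \<open>The best lower bound d of A - E is at most \<kappa>, and (A - E)^2 - d^2 = (A - (E +
  d))(A - (E - d)) is not bounded below, so E + d or E - d is the point wanted.\<close>

lemma asp_near:
  assumes "u \<noteq> 0" "norm (A u - E *\<^sub>R u) \<le> \<kappa> * norm u"
  obtains l where "l \<in> asp A" "\<bar>l - E\<bar> \<le> \<kappa>"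
proof -
  interpret B: selfadjoint "\<lambda>u. A u - E *\<^sub>R u" by (rule selfadjoint_diff)
  obtain d where d: "d \<ge> 0" "\<And>u. d * norm u \<le> norm (A u - E *\<^sub>R u)"
    "\<not> bdd_below_op (\<lambda>u. A (A u - E *\<^sub>R u) - E *\<^sub>R (A u - E *\<^sub>R u) - d\<^sup>2 *\<^sub>R u)"
    using B.sq_diff_not_bdd_below assms(1) by blast
  have eq: "A (A u - E *\<^sub>R u) - E *\<^sub>R (A u - E *\<^sub>R u) - d\<^sup>2 *\<^sub>R u =
     A (A u - (E - d) *\<^sub>R u) - (E + d) *\<^sub>R (A u - (E - d) *\<^sub>R u)" for u
    by (simp add: diff add scaleR algebra_simps power2_eq_square)
  have "d * norm u \<le> \<kappa> * norm u" using d(2)[of u] assms(2) by linarith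
  then have "d \<le> \<kappa>" using assms(1) by simp
  moreover have "E + d \<in> asp A \<or> E - d \<in> asp A"
    using d(3) bdd_below_op_comp[of "\<lambda>u. A u - (E + d) *\<^sub>R u" "\<lambda>u. A u - (E - d) *\<^sub>R u"]
    unfolding asp_def eq by auto
  ultimately show ?thesis using that[of "E + d"] that[of "E - d"] d(1) by auto
qed

lemma asp_diff: "x \<in> asp (\<lambda>u. A u - E *\<^sub>R u) \<longleftrightarrow> x + E \<in> asp A"
  by (simp add: asp_def scaleR_left_distrib algebra_simps)

text \<open>A^2 has no spectrum strictly between 0 and r^2. Hence the midpoint h = r^2 / 2 has
  distance at least h from the spectrum of A^2, that is h |u| <= |(A^2 - h) u|; on squaring, the
  terms h^2 |u|^2 cancel and the claim remains.\<close>

lemma range_expanding: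
  assumes nontriv: "\<exists>u::'a. u \<noteq> 0" and r: "r > 0"
    and gap: "\<And>l. 0 < \<bar>l\<bar> \<Longrightarrow> \<bar>l\<bar> < r \<Longrightarrow> l \<notin> asp A"
  shows "r * norm (A u) \<le> norm (A (A u))"
proof -
  define h where "h = r\<^sup>2 / 2"
  interpret Q: selfadjoint "\<lambda>u. A (A u) - h *\<^sub>R u"
    by (rule selfadjoint.selfadjoint_diff[OF selfadjoint_sq])
  obtain d where d: "d \<ge> 0" "\<And>u. d * norm u \<le> norm (A (A u) - h *\<^sub>R u)"
    "\<not> bdd_below_op (\<lambda>u. A (A (A (A u) - h *\<^sub>R u)) - h *\<^sub>R (A (A u) - h *\<^sub>R u) - d\<^sup>2 *\<^sub>R u)"
    using Q.sq_diff_not_bdd_below[OF nontriv] by blast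
  have bb: "bdd_below_op (\<lambda>u. A (A u) - s *\<^sub>R u)" if s: "0 < s" "s < r\<^sup>2" for s
  proof -
    have sq: "0 < sqrt s" "sqrt s < r" using s r by (auto intro: real_less_lsqrt)
    have "A (A u) - s *\<^sub>R u = A (A u - (- sqrt s) *\<^sub>R u) - sqrt s *\<^sub>R (A u - (- sqrt s) *\<^sub>R u)" for u
      using s by (simp add: diff scaleR add algebra_simps)
    then show ?thesis
      using gap[of "sqrt s"] gap[of "- sqrt s"] sq
        bdd_below_op_comp[of "\<lambda>u. A u - sqrt s *\<^sub>R u" "\<lambda>u. A u - (- sqrt s) *\<^sub>R u"]
      by (auto simp: asp_def)
  qed
  have "h \<le> d"
  proof (rule ccontr)
    assume "\<not> h \<le> d"
    then have "bdd_below_op (\<lambda>u. A (A u) - (h + d) *\<^sub>R u)" "bdd_below_op (\<lambda>u. A (A u) - (h - d) *\<^sub>R u)"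
      using d(1) r by (auto intro!: bb simp: h_def)
    from bdd_below_op_comp[OF this]
    show False using d(3)
      by (simp add: diff add scaleR algebra_simps power2_eq_square)
  qed
  then have "h * norm u \<le> norm (A (A u) - h *\<^sub>R u)"
    using d(2)[of u] mult_right_mono[of h d "norm u"] by simp
  then have "(h * norm u)\<^sup>2 \<le> (norm (A (A u) - h *\<^sub>R u))\<^sup>2"
    using r by (intro power_mono) (auto simp: h_def)
  also have "\<dots> = (norm (A (A u)))\<^sup>2 - r\<^sup>2 * (norm (A u))\<^sup>2 + (h * norm u)\<^sup>2"
  proof -
    have "(norm (A (A u) - h *\<^sub>R u))\<^sup>2 = (norm (A (A u)))\<^sup>2 - 2 * h * (A (A u) \<bullet> u) + h\<^sup>2 * (norm u)\<^sup>2"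
      by (rule norm_diff_scaleR_sq)
    also have "A (A u) \<bullet> u = (norm (A u))\<^sup>2"
      by (simp add: adj[of "A u" u] power2_norm_eq_inner)
    also have "2 * h = r\<^sup>2" by (simp add: h_def)
    finally show ?thesis by (simp add: power_mult_distrib)
  qed
  finally have "(r * norm (A u))\<^sup>2 \<le> (norm (A (A u)))\<^sup>2" by (simp add: power_mult_distrib)
  then show ?thesis by (rule power2_le_imp_le) simp
qed

text \<open>With v = A u, the cross term - 2 |A v|^2 / R^2 outweighs |A^2 v|^2 / R^4 <= |A v|^2 /
  R^2, and the remainder - |A v|^2 / R^2 is at most - r^2 |v|^2 / R^2.\<close>

lemma contraction_on_range:
  assumes R: "R > 0" "\<And>u. norm (A u) \<le> R * norm u"
    and r: "r > 0" "r * norm (A u) \<le> norm (A (A u))"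
  shows "(norm (A u - (1 / R\<^sup>2) *\<^sub>R A (A (A u))))\<^sup>2 \<le> (1 - r\<^sup>2 / R\<^sup>2) * (norm (A u))\<^sup>2"
proof -
  define v where "v = A u"
  have "(norm (v - (1 / R\<^sup>2) *\<^sub>R A (A v)))\<^sup>2 =
     (norm v)\<^sup>2 - 2 / R\<^sup>2 * (norm (A v))\<^sup>2 + (norm (A (A v)))\<^sup>2 / (R\<^sup>2 * R\<^sup>2)"
    by (simp add: power2_norm_eq_inner inner_diff adj[of "A v" v] adj[of v "A v", symmetric] inner_commute algebra_simps)
  also have "(norm (A (A v)))\<^sup>2 \<le> (R * norm (A v))\<^sup>2"
    by (intro power_mono R) simp
  then have "(norm (A (A v)))\<^sup>2 / (R\<^sup>2 * R\<^sup>2) \<le> (norm (A v))\<^sup>2 / R\<^sup>2"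
    using R(1) by (simp add: field_simps power2_eq_square)
  also have "(norm v)\<^sup>2 - 2 / R\<^sup>2 * (norm (A v))\<^sup>2 + (norm (A v))\<^sup>2 / R\<^sup>2
      = (norm v)\<^sup>2 - (norm (A v))\<^sup>2 / R\<^sup>2" by (simp add: field_simps)
  also have "(r * norm v)\<^sup>2 \<le> (norm (A v))\<^sup>2"
    using r unfolding v_def by (intro power_mono) auto
  then have "(norm v)\<^sup>2 - (norm (A v))\<^sup>2 / R\<^sup>2 \<le> (1 - r\<^sup>2 / R\<^sup>2) * (norm v)\<^sup>2"
    using R(1) by (simp add: field_simps power_mult_distrib)
  finally show ?thesis by (simp add: v_def)
qed

text \<open>On the range of A the powers of T = 1 - (A/R)^2 contract geometrically, so starting from an
  approximate null vector they converge to a nearby, hence nonzero, null vector.\<close>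
lemma isolated_zero_eigenvector:
  assumes "0 \<in> asp A" and r: "r > 0"
    and gap: "\<And>l. 0 < \<bar>l\<bar> \<Longrightarrow> \<bar>l\<bar> < r \<Longrightarrow> l \<notin> asp A"
  shows "\<exists>v. v \<noteq> 0 \<and> A v = 0"
proof -
  have nb: "\<exists>u. norm (A u) < c * norm u" if "c > 0" for c
    using assms(1) that by (auto simp: asp_def bdd_below_op_def not_le)
  then have nontriv: "\<exists>u::'a. u \<noteq> 0"
    by (metis norm_zero zero_less_one mult_1 norm_ge_zero not_le)
  obtain K where K: "K > 0" "\<And>u. norm (A u) \<le> norm u * K" using pos_bounded by blast
  \<comment> \<open>The maximum ensures r <= R, so that \<kappa> is the root of a nonnegative
    number.\<close>
  define R where "R = max K r"
  have R: "R > 0" "\<And>u. norm (A u) \<le> R * norm u" "r \<le> R"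
  proof -
    show "norm (A u) \<le> R * norm u" for u
      using K(2)[of u] mult_right_mono[of K R "norm u"] by (simp add: R_def mult.commute)
  qed (use K(1) in \<open>auto simp: R_def\<close>)
  define \<kappa> where "\<kappa> = sqrt (1 - r\<^sup>2 / R\<^sup>2)"
  have "r\<^sup>2 / R\<^sup>2 \<le> 1" using R r by (simp add: power_mono)
  moreover have "r\<^sup>2 / R\<^sup>2 > 0" using r R(1) by simp
  ultimately have \<kappa>: "0 \<le> \<kappa>" "\<kappa> < 1" "\<kappa>\<^sup>2 = 1 - r\<^sup>2 / R\<^sup>2"
    by (simp_all add: \<kappa>_def)
  define T where "T u = u - (1 / R\<^sup>2) *\<^sub>R A (A u)" for u
  have TA: "norm (T (A u)) \<le> \<kappa> * norm (A u)" for u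
  proof (rule power2_le_imp_le)
    have "r * norm (A u) \<le> norm (A (A u))"
      by (rule range_expanding[OF nontriv r]) (rule gap)
    then show "(norm (T (A u)))\<^sup>2 \<le> (\<kappa> * norm (A u))\<^sup>2"
      using contraction_on_range[OF R(1,2) r, of u] by (simp add: T_def power_mult_distrib \<kappa>(3))
    show "0 \<le> \<kappa> * norm (A u)" using \<kappa>(1) by simp
  qed
  \<comment> \<open>The increments of the iteration add up to at most |A w| / (R (1 - \<kappa>));
    this choice keeps the sum below |w|, so the limit is not 0.\<close>
  obtain w where w: "norm (A w) < (R * (1 - \<kappa>)) * norm w"
    using nb[of "R * (1 - \<kappa>)"] R(1) \<kappa>(2) by auto
  define W where "W n = (T ^^ n) w" for n
  have AW: "norm (A (W n)) \<le> \<kappa> ^ n * norm (A w)" for n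
  proof (induction n)
    case (Suc n)
    have "A (W (Suc n)) = T (A (W n))" by (simp add: W_def T_def diff scaleR)
    then show ?case using TA[of "W n"] mult_left_mono[OF Suc \<kappa>(1)] by simp
  qed (simp add: W_def)
  have dW: "norm (W (Suc n) - W n) \<le> norm (A w) / R * \<kappa> ^ n" for n
  proof -
    have "norm (W (Suc n) - W n) = norm (A (A (W n))) / R\<^sup>2"
      by (simp add: W_def T_def)
    also have "\<dots> \<le> R * norm (A (W n)) / R\<^sup>2"
      using R(1) R(2)[of "A (W n)"] by (intro divide_right_mono) auto
    also have "\<dots> = norm (A (W n)) / R" using R(1) by (simp add: power2_eq_square)
    also have "\<dots> \<le> \<kappa> ^ n * norm (A w) / R" using AW R(1) by (intro divide_right_mono) auto
    finally show ?thesis by (simp add: mult.commute)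
  qed
  have gs: "(\<lambda>n. norm (A w) / R * \<kappa> ^ n) sums (norm (A w) / R * (1 / (1 - \<kappa>)))"
    using geometric_sums[of \<kappa>] \<kappa> by (intro sums_mult) auto
  have sn: "summable (\<lambda>n. norm (W (Suc n) - W n))"
    using dW gs by (intro summable_comparison_test'[OF sums_summable[OF gs]]) auto
  then have "summable (\<lambda>n. W (Suc n) - W n)"
    by (rule summable_norm_cancel)
  then have s: "(\<lambda>n. \<Sum>k<n. W (Suc k) - W k) \<longlonglongrightarrow> (\<Sum>n. W (Suc n) - W n)"
    by (rule summable_LIMSEQ)
  define v where "v = w + (\<Sum>n. W (Suc n) - W n)"
  have "W 0 = w" by (simp add: W_def)
  then have telescope: "w + (\<Sum>k<n. W (Suc k) - W k) = W n" for n
    using sum_lessThan_telescope[of W n] by simp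
  have lim: "W \<longlonglongrightarrow> v"
    using tendsto_add[OF tendsto_const[of w] s] by (simp only: telescope v_def[symmetric])
  have "norm (v - w) \<le> (\<Sum>n. norm (W (Suc n) - W n))"
    unfolding v_def using summable_norm[OF sn] by simp
  also have "\<dots> \<le> norm (A w) / R * (1 / (1 - \<kappa>))"
    using suminf_le[OF dW sn sums_summable[OF gs]] sums_unique[OF gs] by simp
  also have "\<dots> < norm w" using w R(1) \<kappa>(2) by (simp add: field_simps)
  finally have "v \<noteq> 0" by auto
  moreover have "(\<lambda>n. A (W n)) \<longlonglongrightarrow> 0"
  proof (rule Lim_null_comparison)
    show "(\<lambda>n. \<kappa> ^ n * norm (A w)) \<longlonglongrightarrow> 0"
      using \<kappa> by (intro tendsto_mult_left_zero LIMSEQ_realpow_zero) auto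
  qed (use AW in auto)
  moreover have "(\<lambda>n. A (W n)) \<longlonglongrightarrow> A v" by (rule tendsto[OF lim])
  ultimately show ?thesis using LIMSEQ_unique by blast
qed

lemma isolated_eigenvector:
  assumes "E \<in> asp A" "\<not> E islimpt asp A"
  shows "\<exists>v. v \<noteq> 0 \<and> A v = E *\<^sub>R v"
proof -
  interpret B: selfadjoint "\<lambda>u. A u - E *\<^sub>R u" by (rule selfadjoint_diff)
  obtain r where r: "r > 0" "\<And>l. l \<in> asp A \<Longrightarrow> l \<noteq> E \<Longrightarrow> \<not> dist l E < r"
    using assms(2) by (auto simp: islimpt_approachable)
  have "\<exists>v. v \<noteq> 0 \<and> A v - E *\<^sub>R v = 0"
  proof (rule B.isolated_zero_eigenvector[OF _ r(1)])
    show "0 \<in> asp (\<lambda>u. A u - E *\<^sub>R u)" using assms(1) by (simp add: asp_diff)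
    show "l \<notin> asp (\<lambda>u. A u - E *\<^sub>R u)" if "0 < \<bar>l\<bar>" "\<bar>l\<bar> < r" for l
      using r(2)[of "l + E"] that by (auto simp: asp_diff dist_real_def)
  qed
  then show ?thesis by auto
qed

end

text \<open>Lax-Milgram by a contraction: B u = f says that u is a fixed point of u - t (B u - f).
  The step t = c / M^2 minimises 1 - 2 t c + t^2 M^2, and M >= c makes the resulting factor the root
  of a nonnegative number.\<close>

lemma coercive_surj:
  fixes B :: "'a::{real_inner,banach} \<Rightarrow> 'a"
  assumes B: "bounded_linear B" and c: "c > 0" "\<And>u. c * (norm u)\<^sup>2 \<le> B u \<bullet> u"
  shows "surj B"
proof -
  interpret bounded_linear B by (rule B)
  obtain K where K: "K > 0" "\<And>u. norm (B u) \<le> norm u * K" using pos_bounded by blast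
  define M where "M = max K c"
  have M: "M > 0" "norm (B u) \<le> M * norm u" "c \<le> M" for u
    using K(1) K(2)[of u] mult_right_mono[of K M "norm u"] by (auto simp: M_def mult.commute)
  define t where "t = c / M\<^sup>2"
  define q where "q = sqrt (1 - c\<^sup>2 / M\<^sup>2)"
  have "c\<^sup>2 / M\<^sup>2 \<le> 1" "c\<^sup>2 / M\<^sup>2 > 0" using M(1,3) c(1) by (auto simp: power_mono)
  then have q: "0 \<le> q" "q < 1" "q\<^sup>2 = 1 - c\<^sup>2 / M\<^sup>2" by (auto simp: q_def)
  have contr: "norm (u - t *\<^sub>R B u) \<le> q * norm u" for u
  proof (rule power2_le_imp_le)
    have "(norm (u - t *\<^sub>R B u))\<^sup>2 = (norm u)\<^sup>2 - 2 * t * (B u \<bullet> u) + t\<^sup>2 * (norm (B u))\<^sup>2"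
      by (simp add: norm_diff_scaleR_sq inner_commute)
    also have "\<dots> \<le> (norm u)\<^sup>2 - 2 * t * (c * (norm u)\<^sup>2) + t\<^sup>2 * (M * norm u)\<^sup>2"
    proof -
      have "t\<^sup>2 * (norm (B u))\<^sup>2 \<le> t\<^sup>2 * (M * norm u)\<^sup>2"
        by (intro mult_left_mono power_mono M) auto
      moreover have "2 * t * (c * (norm u)\<^sup>2) \<le> 2 * t * (B u \<bullet> u)"
        using c M(1) by (intro mult_left_mono) (auto simp: t_def)
      ultimately show ?thesis by linarith
    qed
    also have "\<dots> = (q * norm u)\<^sup>2"
      using M(1) unfolding power_mult_distrib q(3) t_def by (simp add: field_simps power2_eq_square)
    finally show "(norm (u - t *\<^sub>R B u))\<^sup>2 \<le> (q * norm u)\<^sup>2" .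
  qed (use q in simp)
  have "\<exists>u. B u = f" for f
  proof -
    define F where "F u = u - t *\<^sub>R (B u - f)" for u
    have "F x - F y = (x - y) - t *\<^sub>R B (x - y)" for x y
      by (simp add: F_def diff algebra_simps)
    then have "\<forall>x y. dist (F x) (F y) \<le> q * dist x y"
      using contr by (simp add: dist_norm)
    then obtain u where "F u = u" using banach_fix_type[OF q(1,2)] by blast
    then show ?thesis using c(1) M(1) by (auto simp: F_def t_def)
  qed
  then show ?thesis by (metis surjI)
qed

text \<open>The vectors w with norm (B w) \<le> 1 are pointwise bounded as functionals, hence uniformly
  bounded by the Baire category theorem.\<close>
lemma surj_selfadjoint_bdd_below:
  fixes B :: "'a::{real_inner,banach} \<Rightarrow> 'a"
  assumes "selfadjoint B" "surj B"
  shows "bdd_below_op B"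
proof -
  interpret selfadjoint B by (rule assms(1))
  define W where "W = {w. norm (B w) \<le> 1}"
  \<comment> \<open>If f = B v, then |<f, w>| = |<v, B w>| <= |v| for all w in \<open>W\<close>, so
    by surjectivity these closed sets cover the space.\<close>
  define F where "F N = {f::'a. \<forall>w\<in>W. \<bar>f \<bullet> w\<bar> \<le> real N}" for N :: nat
  have cl: "closed (F N)" for N
  proof -
    have "F N = (\<Inter>w\<in>W. {f. \<bar>f \<bullet> w\<bar> \<le> real N})" by (auto simp: F_def)
    then show ?thesis by (auto intro!: closed_INT closed_Collect_le continuous_intros)
  qed
  have cov: "(\<Union>N. F N) = UNIV"
  proof -
    have "\<exists>N. f \<in> F N" for f
    proof -
      obtain v where v: "f = B v" using assms(2) by (metis surjD)
      obtain N where N: "norm v \<le> real N" using real_arch_simple by blast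
      have "\<bar>f \<bullet> w\<bar> \<le> real N" if "w \<in> W" for w
      proof -
        have "\<bar>f \<bullet> w\<bar> \<le> norm v * norm (B w)"
          using Cauchy_Schwarz_ineq2[of v "B w"] by (simp add: v adj)
        also have "\<dots> \<le> norm v * 1" using that by (intro mult_left_mono) (auto simp: W_def)
        finally show ?thesis using N by simp
      qed
      then show ?thesis by (auto simp: F_def)
    qed
    then show ?thesis by auto
  qed
  have "\<exists>N. interior (F N) \<noteq> {}"
  proof (rule ccontr)
    assume "\<not> ?thesis"
    then have "interior (\<Union>(range F)) = {}"
      using Baire_category_alt[of "euclidean :: 'a topology" "range F"] cl
      by (auto simp: completely_metrizable_space_euclidean)
    then show False using cov by simp
  qed
  then obtain N x where "x \<in> interior (F N)" by auto
  then obtain r where r: "r > 0" "cball x r \<subseteq> F N" by (meson mem_interior_cball)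
  have "r / (2 * real N + 1) * norm u \<le> norm (B u)" for u
  proof -
    \<comment> \<open>Two points of the ball that differ by r w / |w| bound r |w| by 2 N; the added
      1 keeps the later denominator positive when N = 0.\<close>
    have W: "r * norm w \<le> 2 * real N + 1" if "w \<in> W" for w
    proof (cases "w = 0")
      case False
      let ?y = "x + (r / norm w) *\<^sub>R w"
      have "?y \<in> F N" "x \<in> F N" using r False by (auto simp: subset_iff dist_norm)
      then have "\<bar>?y \<bullet> w\<bar> \<le> real N" "\<bar>x \<bullet> w\<bar> \<le> real N" using that by (auto simp: F_def)
      moreover have "?y \<bullet> w = x \<bullet> w + r * norm w"
        using False by (simp add: inner_add_left dot_square_norm power2_eq_square)
      ultimately show ?thesis by linarith
    qed simp
    show ?thesis
    proof (cases "B u = 0")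
      case True
      \<comment> \<open>A kernel vector can be scaled at will inside \<open>W\<close>, so the bound
        on \<open>W\<close> forces it to be 0.\<close>
      have "c *\<^sub>R u \<in> W" for c using True by (simp add: W_def scaleR)
      then have le: "r * (\<bar>c\<bar> * norm u) \<le> 2 * real N + 1" for c using W[of "c *\<^sub>R u"] by simp
      have "norm u = 0"
      proof (rule ccontr)
        assume "norm u \<noteq> 0"
        then show False using le[of "(2 * real N + 2) / (r * norm u)"] r(1) by simp
      qed
      then show ?thesis by simp
    next
      case False
      then have "inverse (norm (B u)) *\<^sub>R u \<in> W" by (simp add: W_def scaleR)
      from W[OF this] show ?thesis using False r(1) by (simp add: field_simps)
    qed
  qed
  then show ?thesis using r(1) by (intro bdd_below_opI[of "r / (2 * real N + 1)"]) auto
qed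

section \<open>Spectral measures\<close>

text \<open>Only moments link \<mu> to A, so the functional calculus is confined to polynomials.
  That \<mu> is carried by \<open>asp A\<close> is not assumed but derived.\<close>

locale spectral_moments = selfadjoint A for A :: "'a::{real_inner,banach} \<Rightarrow> 'a" +
  fixes \<psi> :: 'a and \<mu> :: "real measure"
  assumes sets: "sets \<mu> = sets borel" and fin: "finite_measure \<mu>"
    and int: "\<And>k. integrable \<mu> (\<lambda>x. x ^ k)"
    and moment: "\<And>k. (\<integral>x. x ^ k \<partial>\<mu>) = \<psi> \<bullet> (A ^^ k) \<psi>"
begin

text \<open>\<^term>\<open>polyrep f w\<close> means that f is a polynomial function and w = f(A) \<psi>.\<close>
inductive polyrep :: "(real \<Rightarrow> real) \<Rightarrow> 'a \<Rightarrow> bool" where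
  one: "polyrep (\<lambda>x. 1) \<psi>"
| mul: "polyrep f w \<Longrightarrow> polyrep (\<lambda>x. x * f x) (A w)"
| lin: "polyrep f w \<Longrightarrow> polyrep g v \<Longrightarrow> polyrep (\<lambda>x. c * f x + d * g x) (c *\<^sub>R w + d *\<^sub>R v)"

lemma polyrep_moment:
  assumes "polyrep g v"
  shows "integrable \<mu> (\<lambda>x. x ^ j * g x) \<and> (\<integral>x. x ^ j * g x \<partial>\<mu>) = (A ^^ j) \<psi> \<bullet> v"
  using assms
proof (induction arbitrary: j)
  case one
  then show ?case by (simp add: int moment inner_commute)
next
  case (mul f w)
  then show ?case using mul.IH[of "Suc j"] by (simp add: adj algebra_simps)
next
  case (lin f w g v c d)
  have eq: "x ^ j * (c * f x + d * g x) = c * (x ^ j * f x) + d * (x ^ j * g x)" for x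
    by (simp add: algebra_simps)
  show ?case unfolding eq using lin.IH[of j] by (simp add: inner_add_right)
qed

text \<open>The map from polynomials in L^2(\<mu>) to vectors f(A) \<psi> is isometric. In the
  induction on f a factor x is handed over to g, as A is handed over to v by self-adjointness, hence
  the generalisation over g and v.\<close>

lemma polyrep_inner:
  assumes "polyrep f w" "polyrep g v"
  shows "integrable \<mu> (\<lambda>x. f x * g x) \<and> (\<integral>x. f x * g x \<partial>\<mu>) = w \<bullet> v"
  using assms
proof (induction arbitrary: g v)
  case one
  then show ?case using polyrep_moment[of g v 0] by simp
next
  case (mul f w)
  then show ?case using mul.IH[OF polyrep.mul[OF mul.prems]] by (simp add: adj algebra_simps)
next
  case (lin f1 w1 f2 w2 c d)
  have eq: "(c * f1 x + d * f2 x) * g x = c * (f1 x * g x) + d * (f2 x * g x)" for x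
    by (simp add: algebra_simps)
  show ?case unfolding eq using lin.IH[OF lin.prems] by (simp add: inner_add_left)
qed

text \<open>For C nonzero, the symbol of this operator has its maximum 1 exactly at E, so its powers
  single out the spectral mass near E.\<close>

definition peak :: "real \<Rightarrow> real \<Rightarrow> 'a \<Rightarrow> 'a" where
  "peak E C w = w - (1 / C\<^sup>2) *\<^sub>R (A (A w - E *\<^sub>R w) - E *\<^sub>R (A w - E *\<^sub>R w))"

lemma polyrep_peak: "polyrep (\<lambda>x. (1 - (x - E)\<^sup>2 / C\<^sup>2) ^ n) ((peak E C ^^ n) \<psi>)"
proof (induction n)
  case (Suc n)
  define f where "f x = (1 - (x - E)\<^sup>2 / C\<^sup>2) ^ n" for x
  define w where "w = (peak E C ^^ n) \<psi>"
  have f: "polyrep f w" using Suc by (simp add: f_def[abs_def] w_def)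
  have g: "polyrep (\<lambda>x. 1 * (x * f x) + (- E) * f x) (1 *\<^sub>R A w + (- E) *\<^sub>R w)"
    by (intro polyrep.intros f)
  have h: "polyrep (\<lambda>x. 1 * (x * (1 * (x * f x) + (- E) * f x)) + (- E) * (1 * (x * f x) + (- E) * f x))
     (1 *\<^sub>R A (1 *\<^sub>R A w + (- E) *\<^sub>R w) + (- E) *\<^sub>R (1 *\<^sub>R A w + (- E) *\<^sub>R w))"
    by (intro polyrep.intros(2,3) g)
  from lin[OF f h, of 1 "- (1 / C\<^sup>2)"] 
  have k: "polyrep (\<lambda>x. 1 * f x + - (1 / C\<^sup>2) * (1 * (x * (1 * (x * f x) + (- E) * f x)) + (- E) * (1 * (x * f x) + (- E) * f x)))
     (1 *\<^sub>R w + - (1 / C\<^sup>2) *\<^sub>R (1 *\<^sub>R A (1 *\<^sub>R A w + (- E) *\<^sub>R w) + (- E) *\<^sub>R (1 *\<^sub>R A w + (- E) *\<^sub>R w)))" .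
  have "1 * f x + - (1 / C\<^sup>2) * (1 * (x * (1 * (x * f x) + (- E) * f x)) + (- E) * (1 * (x * f x) + (- E) * f x))
     = (1 - (x - E)\<^sup>2 / C\<^sup>2) ^ Suc n" for x
    unfolding f_def by (simp add: power2_eq_square algebra_simps diff_divide_distrib add_divide_distrib)
  moreover have "1 *\<^sub>R w + - (1 / C\<^sup>2) *\<^sub>R (1 *\<^sub>R A (1 *\<^sub>R A w + (- E) *\<^sub>R w) + (- E) *\<^sub>R (1 *\<^sub>R A w + (- E) *\<^sub>R w))
     = (peak E C ^^ Suc n) \<psi>"
    by (simp add: w_def[symmetric] peak_def)
  ultimately show ?case using k by simp
qed (simp add: one)

text \<open>Chebyshev's inequality for the squared symbol, whose integral is a squared norm by
  \<open>polyrep_inner\<close>. Squaring keeps the integrand nonnegative off S, where the symbol may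
  be negative.\<close>

lemma measure_le_peak:
  assumes c: "0 \<le> c" "\<And>x. x \<in> S \<Longrightarrow> c \<le> 1 - (x - E)\<^sup>2 / C\<^sup>2" and S: "S \<in> sets borel"
  shows "c ^ (2 * n) * measure \<mu> S \<le> (norm ((peak E C ^^ n) \<psi>))\<^sup>2"
proof -
  interpret finite_measure \<mu> by (rule fin)
  define f where "f x = (1 - (x - E)\<^sup>2 / C\<^sup>2) ^ n" for x
  have I: "integrable \<mu> (\<lambda>x. f x * f x)" "(\<integral>x. f x * f x \<partial>\<mu>) = (norm ((peak E C ^^ n) \<psi>))\<^sup>2"
    using polyrep_inner[OF polyrep_peak polyrep_peak, of E C n E C n]
    by (auto simp: f_def power2_norm_eq_inner)
  have "(\<integral>x. c ^ (2 * n) * indicator S x \<partial>\<mu>) \<le> (\<integral>x. f x * f x \<partial>\<mu>)"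
  proof (rule integral_mono[OF _ I(1)])
    show "integrable \<mu> (\<lambda>x. c ^ (2 * n) * indicator S x :: real)"
      using S by (intro integrable_mult_right integrable_real_indicator) (auto simp: sets emeasure_eq_measure)
    show "c ^ (2 * n) * indicator S x \<le> f x * f x" for x
    proof (cases "x \<in> S")
      case True
      then have "c ^ n \<le> f x" unfolding f_def by (intro power_mono c)
      moreover have "0 \<le> c ^ n" using c(1) by simp
      ultimately have "c ^ n * c ^ n \<le> f x * f x" by (intro mult_mono) auto
      then show ?thesis using True by (simp add: power_add mult_2)
    qed simp
  qed
  then show ?thesis using S by (simp add: I(2) sets sets_eq_imp_space_eq[OF sets])
qed

text \<open>Powers of 1 - ((A - E)/C)^2 decay faster in norm than their symbols do on a small ball
  around E, so the ball carries no mass.\<close>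
lemma measure_ball_gap:
  assumes "E \<notin> asp A"
  shows "\<exists>r>0. emeasure \<mu> (ball E r) = 0"
proof -
  interpret M: finite_measure \<mu> by (rule fin)
  interpret B: selfadjoint "\<lambda>u. A u - E *\<^sub>R u" by (rule selfadjoint_diff)
  obtain d where d: "d > 0" "\<And>u. d * norm u \<le> norm (A u - E *\<^sub>R u)"
    using assms by (auto simp: asp_def bdd_below_op_def)
  obtain K where K: "K > 0" "\<And>u. norm (A u - E *\<^sub>R u) \<le> norm u * K" using B.pos_bounded by blast
  define C where "C = max K (2 * d)"
  have C: "C > 0" "d < C" "\<And>u. norm (A u - E *\<^sub>R u) \<le> C * norm u"
  proof -
    show "norm (A u - E *\<^sub>R u) \<le> C * norm u" for u
      using K(2)[of u] mult_right_mono[of K C "norm u"] by (simp add: C_def mult.commute)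
  qed (use d(1) in \<open>auto simp: C_def\<close>)
  \<comment> \<open>\<open>a\<close> is the factor by which \<open>peak\<close> shrinks squared
    norms, \<open>b\<close> a lower bound of its symbol on the ball of half radius. The mass of that
    ball is at most a multiple of (a / b^2)^n, and a < b^2 because halving the radius turns x into x
    / 4.\<close>
  define a where "a = 1 - d\<^sup>2 / C\<^sup>2"
  define b where "b = 1 - (d/2)\<^sup>2 / C\<^sup>2"
  have "d\<^sup>2 < C\<^sup>2" using C(2) d(1) by (intro power_strict_mono) auto
  moreover define x where "x = d\<^sup>2 / C\<^sup>2"
  ultimately have x: "0 < x" "x < 1" using C(1) d(1) by simp_all
  have abx: "a = 1 - x" "b = 1 - x / 4" by (simp_all add: a_def b_def x_def power_divide)
  have ab: "0 \<le> a" "a < b" "0 < b" using x by (simp_all add: abx)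
  have contr: "(norm (peak E C u))\<^sup>2 \<le> a * (norm u)\<^sup>2" for u
  proof -
    define v where "v = A u - E *\<^sub>R u"
    define w where "w = A v - E *\<^sub>R v"
    have uw: "u \<bullet> w = (norm v)\<^sup>2"
      using B.adj[of u v] by (simp add: w_def power2_norm_eq_inner v_def)
    have "(norm w)\<^sup>2 \<le> (C * norm v)\<^sup>2" unfolding w_def by (intro power_mono C) simp
    then have w: "(norm w)\<^sup>2 / (C\<^sup>2 * C\<^sup>2) \<le> (norm v)\<^sup>2 / C\<^sup>2"
      using C(1) by (simp add: field_simps power2_eq_square)
    have "(d * norm u)\<^sup>2 \<le> (norm v)\<^sup>2" unfolding v_def using d by (intro power_mono) auto
    then have v: "d\<^sup>2 / C\<^sup>2 * (norm u)\<^sup>2 \<le> (norm v)\<^sup>2 / C\<^sup>2"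
      using C(1) by (simp add: field_simps power_mult_distrib)
    have "peak E C u = u - (1 / C\<^sup>2) *\<^sub>R w" unfolding peak_def w_def v_def ..
    then have "(norm (peak E C u))\<^sup>2 = (norm u)\<^sup>2 - 2 / C\<^sup>2 * (norm v)\<^sup>2 + (norm w)\<^sup>2 / (C\<^sup>2 * C\<^sup>2)"
      using uw by (simp add: norm_diff_scaleR_sq power2_eq_square[of "1 / C\<^sup>2"])
    then show ?thesis using w v by (simp add: a_def algebra_simps)
  qed
  have P: "(norm ((peak E C ^^ n) \<psi>))\<^sup>2 \<le> a ^ n * (norm \<psi>)\<^sup>2" for n
  proof (induction n)
    case (Suc n)
    then show ?case using contr[of "(peak E C ^^ n) \<psi>"] mult_left_mono[OF Suc ab(1)] by simp
  qed simp
  have le: "measure \<mu> (ball E (d/2)) \<le> (a / b\<^sup>2) ^ n * (norm \<psi>)\<^sup>2" for n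
  proof -
    have "b ^ (2 * n) * measure \<mu> (ball E (d/2)) \<le> (norm ((peak E C ^^ n) \<psi>))\<^sup>2"
    proof (rule measure_le_peak)
      fix x assume "x \<in> ball E (d/2)"
      then have "\<bar>x - E\<bar> \<le> \<bar>d/2\<bar>" using d(1) by (simp add: dist_real_def abs_minus_commute)
      then have "(x - E)\<^sup>2 \<le> (d/2)\<^sup>2" by (simp only: abs_le_square_iff)
      then show "b \<le> 1 - (x - E)\<^sup>2 / C\<^sup>2"
        unfolding b_def by (intro diff_left_mono divide_right_mono) auto
    qed (use ab in auto)
    then have "b ^ (2 * n) * measure \<mu> (ball E (d/2)) \<le> a ^ n * (norm \<psi>)\<^sup>2" using P[of n] by simp
    then have "(b\<^sup>2) ^ n * measure \<mu> (ball E (d/2)) \<le> a ^ n * (norm \<psi>)\<^sup>2"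
      by (simp only: power_mult)
    then show ?thesis using ab(3) by (simp add: pos_le_divide_eq power_divide mult.commute)
  qed
  have "a < b\<^sup>2"
  proof -
    have "b\<^sup>2 = a + x / 2 + x\<^sup>2 / 16"
      by (simp add: abx power2_eq_square field_simps)
    moreover have "x\<^sup>2 \<ge> 0" by simp
    ultimately show ?thesis using x(1) by linarith
  qed
  then have "(\<lambda>n. (a / b\<^sup>2) ^ n * (norm \<psi>)\<^sup>2) \<longlonglongrightarrow> 0"
    using ab by (intro tendsto_mult_left_zero LIMSEQ_realpow_zero) (auto simp: field_simps)
  then have "measure \<mu> (ball E (d/2)) \<le> 0"
    by (rule LIMSEQ_le_const) (use le in auto)
  then have "emeasure \<mu> (ball E (d/2)) = 0"
    using measure_nonneg[of \<mu> "ball E (d/2)"] by (simp add: M.emeasure_eq_measure)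
  then show ?thesis using d(1) by (intro exI[of _ "d/2"]) auto
qed

text \<open>The complement is a union of possibly uncountably many null balls; the Lindelof property
  leaves countably many.\<close>

lemma measure_outside_asp: "emeasure \<mu> (- asp A) = 0"
proof -
  obtain r where r: "\<And>E. E \<notin> asp A \<Longrightarrow> r E > 0 \<and> emeasure \<mu> (ball E (r E)) = 0"
    using measure_ball_gap by metis
  obtain F' where F': "F' \<subseteq> (\<lambda>E. ball E (r E)) ` (- asp A)" "countable F'"
     "\<Union>F' = \<Union>((\<lambda>E. ball E (r E)) ` (- asp A))"
    using Lindelof[of "(\<lambda>E. ball E (r E)) ` (- asp A)"] by auto
  have "(\<Union>F') \<in> null_sets \<mu>"
  proof -
    have "(\<Union>X\<in>F'. X) \<in> null_sets \<mu>"
      by (rule null_sets_UN') (use F'(1,2) r in \<open>auto simp: null_sets_def sets\<close>)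
    then show ?thesis by simp
  qed
  then have "emeasure \<mu> (\<Union>F') = 0" by auto
  moreover have "- asp A \<subseteq> \<Union>F'"
    unfolding F'(3) using r by (auto intro!: bexI centre_in_ball[THEN iffD2])
  moreover have "\<Union>F' \<in> sets \<mu>" unfolding F'(3) sets by (intro borel_open) auto
  ultimately show ?thesis by (metis emeasure_mono le_zero_eq)
qed

text \<open>Here the same powers converge strongly, and their limit is a fixed vector, hence an eigenvector.\<close>
lemma measure_point:
  assumes noeig: "\<And>v. A v = E *\<^sub>R v \<Longrightarrow> v = 0"
  shows "emeasure \<mu> {E} = 0"
proof -
  interpret M: finite_measure \<mu> by (rule fin)
  interpret B: selfadjoint "\<lambda>u. A u - E *\<^sub>R u" by (rule selfadjoint_diff)
  obtain C where C: "C > 0" "\<And>u. norm (A u - E *\<^sub>R u) \<le> norm u * C" using B.pos_bounded by blast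
  define T where "T = peak E C"
  have T: "T u = u - (1 / C\<^sup>2) *\<^sub>R (A (A u - E *\<^sub>R u) - E *\<^sub>R (A u - E *\<^sub>R u))" for u
    by (simp add: T_def peak_def)
  have bT: "bounded_linear T"
    unfolding T[abs_def]
    by (intro bounded_linear_sub bounded_linear_ident bounded_linear_scaleR_right
        bounded_linear_compose[OF bounded_linear_scaleR_right]
        bounded_linear_compose[OF bounded_linear_axioms] bounded_linear_axioms)
  have sT: "T u \<bullet> v = u \<bullet> T v" for u v
    using B.adj[of "A u - E *\<^sub>R u" v] B.adj[of u "A v - E *\<^sub>R v"]
    by (simp add: T inner_diff_left inner_diff_right)
  have Tu: "T u \<bullet> u = (norm u)\<^sup>2 - (norm (A u - E *\<^sub>R u))\<^sup>2 / C\<^sup>2" for u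
    using B.adj[of "A u - E *\<^sub>R u" u] by (simp add: T inner_diff_left power2_norm_eq_inner)
  have T0: "0 \<le> T u \<bullet> u" "T u \<bullet> u \<le> (norm u)\<^sup>2" for u
  proof -
    have "(norm (A u - E *\<^sub>R u))\<^sup>2 \<le> (norm u * C)\<^sup>2" by (intro power_mono C) simp
    then show "0 \<le> T u \<bullet> u" using C(1) by (simp add: Tu field_simps power_mult_distrib)
    show "T u \<bullet> u \<le> (norm u)\<^sup>2" using C(1) by (simp add: Tu)
  qed
  define W where "W n = (T ^^ n) \<psi>" for n
  define m where "m n = W n \<bullet> \<psi>" for n
  \<comment> \<open>As T is symmetric, inner products of iterates depend on the sum of the indices
    only. So |W i - W j|^2 = m (2 i) - 2 m (i + j) + m (2 j), and convergence of m makes W a Cauchy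
    sequence.\<close>
  have WW: "W i \<bullet> W j = m (i + j)" for i j
  proof (induction j arbitrary: i)
    case (Suc j)
    have "W i \<bullet> W (Suc j) = W (Suc i) \<bullet> W j" by (simp add: W_def sT)
    then show ?case using Suc[of "Suc i"] by simp
  qed (simp add: W_def m_def)
  have m0: "0 \<le> m n" for n
  proof (cases "even n")
    case True
    then obtain i where "n = i + i" by (metis evenE mult_2)
    then show ?thesis by (simp add: WW[symmetric])
  next
    case False
    then obtain i where "n = Suc i + i" by (metis oddE mult_2 Suc_eq_plus1 add_Suc)
    then show ?thesis using WW[of "Suc i" i] T0(1)[of "W i"] by (simp add: W_def)
  qed
  \<comment> \<open>Monotonicity comes from 0 <= T <= 1: for even n from <T u, u> <= |u|^2, for odd
    n from |T u|^2 <= <T u, u>.\<close>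
  have md: "m (Suc n) \<le> m n" for n
  proof (cases "even n")
    case True
    then obtain i where i: "n = i + i" by (metis evenE mult_2)
    show ?thesis using WW[of "Suc i" i] WW[of i i] T0(2)[of "W i"]
      by (simp add: i W_def power2_norm_eq_inner)
  next
    case False
    then obtain i where i: "n = Suc i + i" by (metis oddE mult_2 Suc_eq_plus1 add_Suc)
    have Tsq: "norm (T u) ^ 2 \<le> T u \<bullet> u" for u
    proof -
      define v where "v = A u - E *\<^sub>R u"
      define w where "w = A v - E *\<^sub>R v"
      have "(norm w)\<^sup>2 \<le> (norm v * C)\<^sup>2" unfolding w_def by (intro power_mono C) simp
      then have w: "(norm w)\<^sup>2 / (C\<^sup>2 * C\<^sup>2) \<le> (norm v)\<^sup>2 / C\<^sup>2"
        using C(1) by (simp add: field_simps power2_eq_square)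
      have "u \<bullet> w = (norm v)\<^sup>2"
        using B.adj[of u v] by (simp add: power2_norm_eq_inner v_def w_def)
      moreover have "T u = u - (1 / C\<^sup>2) *\<^sub>R w" unfolding T v_def w_def ..
      ultimately have "(norm (T u))\<^sup>2 = (norm u)\<^sup>2 - 2 / C\<^sup>2 * (norm v)\<^sup>2 + (norm w)\<^sup>2 / (C\<^sup>2 * C\<^sup>2)"
        by (simp add: norm_diff_scaleR_sq power2_eq_square[of "1 / C\<^sup>2"])
      then show ?thesis using w by (simp add: Tu v_def)
    qed
    show ?thesis using WW[of "Suc i" "Suc i"] WW[of "Suc i" i] Tsq[of "W i"]
      by (simp add: i W_def power2_norm_eq_inner)
  qed
  have dec: "decseq m" using md by (rule decseq_SucI)
  have "convergent m"
    using decseq_convergent[OF dec, of 0] m0 by (metis convergentI)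
  then have Cm: "Cauchy m" by (rule convergent_Cauchy)
  have "Cauchy W"
  proof (rule CauchyI)
    fix e :: real assume e: "e > 0"
    then have "e\<^sup>2 / 2 > 0" by simp
    then obtain N where N: "\<And>i j. i \<ge> N \<Longrightarrow> j \<ge> N \<Longrightarrow> \<bar>m i - m j\<bar> < e\<^sup>2 / 2"
      using CauchyD[OF Cm, of "e\<^sup>2 / 2"] by (metis real_norm_def)
    have "norm (W i - W j) < e" if ij: "i \<ge> N" "j \<ge> N" for i j
    proof -
      have "(norm (W i - W j))\<^sup>2 = (m (i + i) - m (i + j)) + (m (j + j) - m (i + j))"
        using WW[of i i] WW[of i j] WW[of j i] WW[of j j]
        by (simp add: power2_norm_eq_inner inner_diff_left inner_diff_right add.commute)
      also have "\<dots> < e\<^sup>2"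
        using N[of "i + i" "i + j"] N[of "j + j" "i + j"] ij by linarith
      finally show ?thesis using e by (simp add: power_less_imp_less_base)
    qed
    then show "\<exists>N. \<forall>i\<ge>N. \<forall>j\<ge>N. norm (W i - W j) < e" by blast
  qed
  then obtain v where v: "W \<longlonglongrightarrow> v" by (metis Cauchy_convergent_iff convergent_def)
  have "(\<lambda>n. T (W n)) \<longlonglongrightarrow> T v" by (rule bounded_linear.tendsto[OF bT v])
  moreover have "(\<lambda>n. T (W n)) \<longlonglongrightarrow> v"
    using LIMSEQ_Suc[OF v] by (simp add: W_def)
  ultimately have "T v = v" using LIMSEQ_unique by blast
  then have "norm (A v - E *\<^sub>R v) = 0"
    using Tu[of v] C(1) by (simp add: power2_norm_eq_inner)
  then have "v = 0" using noeig[of v] by simp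
  then have "(\<lambda>n. (norm (W n))\<^sup>2) \<longlonglongrightarrow> 0"
    using tendsto_power[OF tendsto_norm[OF v], of 2] by simp
  moreover have "measure \<mu> {E} \<le> (norm (W n))\<^sup>2" for n
    using measure_le_peak[of 1 "{E}" E C n] by (simp add: W_def T_def)
  ultimately have "measure \<mu> {E} \<le> 0" using LIMSEQ_le_const by blast
  then show ?thesis
    using measure_nonneg[of \<mu> "{E}"] by (simp add: M.emeasure_eq_measure)
qed

end

section \<open>Jacobi operators\<close>

text \<open>Written with shifts and multiplications so that boundedness and symmetry are inherited
  from them; \<open>coord_jac\<close> recovers \<open>jacobi\<close> for bounded a and b.\<close>

definition jac :: "(int \<Rightarrow> real) \<Rightarrow> (int \<Rightarrow> real) \<Rightarrow> ell2 \<Rightarrow> ell2" where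
  "jac a b u = shiftop (-1) (mulop (\<lambda>n. complex_of_real (a n)) u)
     + mulop (\<lambda>n. complex_of_real (b n)) u
     + mulop (\<lambda>n. complex_of_real (a n)) (shiftop 1 u)"

lemma bounded_range_of_real:
  fixes f :: "int \<Rightarrow> real"
  shows "bounded (range f) \<Longrightarrow> bounded (range (\<lambda>n. complex_of_real (f n)))"
  by (simp add: bounded_iff)

lemma bounded_linear_mulop:
  assumes "bounded (range f)" shows "bounded_linear (mulop f)"
proof -
  obtain C where C: "\<And>n. cmod (f n) \<le> C" using assms by (auto simp: bounded_iff)
  have "norm (mulop f u) \<le> norm u * C" for u
    using norm_mulop_le[of f C u] C by (simp add: mult.commute)
  then show ?thesis
    using linear_mulop[of f] by (intro bounded_linear_intro[of _ C]) (auto simp: linear_add linear_scale)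
qed

lemma bounded_linear_shiftop: "bounded_linear (shiftop k)"
  using linear_shiftop[of k] by (intro bounded_linear_intro[of _ 1]) (auto simp: linear_add linear_scale)

locale bounded_jacobi =
  fixes a b :: "int \<Rightarrow> real"
  assumes a_bounded: "bounded (range a)" and b_bounded: "bounded (range b)"
begin

lemma coord_jac: "coord (jac a b u) = jacobi a b (coord u)"
  using bounded_range_of_real[OF a_bounded] bounded_range_of_real[OF b_bounded]
  by (auto simp: jac_def jacobi_def)

sublocale selfadjoint "jac a b"
proof (intro selfadjoint.intro selfadjoint_axioms.intro)
  note bd = bounded_range_of_real[OF a_bounded] bounded_range_of_real[OF b_bounded]
  show "bounded_linear (jac a b)"
    unfolding jac_def[abs_def]
    by (intro bounded_linear_add bounded_linear_compose[OF bounded_linear_shiftop]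
        bounded_linear_compose[OF bounded_linear_mulop] bounded_linear_mulop bounded_linear_shiftop bd)
  show "jac a b u \<bullet> v = u \<bullet> jac a b v" for u v
    unfolding jac_def by (simp add: inner_add inner_shiftop inner_mulop bd)
qed

text \<open>An approximate eigenvector for b with relative defect e has defect at most r + e for b',
  and \<open>asp_near\<close> applies. A positive e is present because E need not be an
  eigenvalue.\<close>

lemma asp_near_perturbed:
  assumes b': "bounded (range b')" and r: "\<And>n. \<bar>b n - b' n\<bar> \<le> r" "e > 0"
    and E: "E \<in> asp (jac a b)"
  obtains l where "l \<in> asp (jac a b')" "\<bar>l - E\<bar> \<le> r + e"
proof -
  interpret b': bounded_jacobi a b' by (intro bounded_jacobi.intro a_bounded b')
  obtain u where u: "norm (jac a b u - E *\<^sub>R u) < e * norm u"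
    using E r(2) by (auto simp: asp_def bdd_below_op_def not_le)
  have "norm (jac a b' u - jac a b u) \<le> r * norm u"
  proof (rule norm_ell2_dominated)
    show "cmod (coord (jac a b' u - jac a b u) n) \<le> r * cmod (coord u n)" for n
    proof -
      have "coord (jac a b' u - jac a b u) n = complex_of_real (b' n - b n) * coord u n"
        by (simp add: coord_jac b'.coord_jac jacobi_def algebra_simps)
      then show ?thesis using r(1)[of n]
        by (simp only: norm_mult norm_of_real) (intro mult_right_mono, auto)
    qed
    show "0 \<le> r" using r(1)[of 0] by linarith
  qed
  then have "norm (jac a b' u - E *\<^sub>R u) \<le> (r + e) * norm u"
    using u norm_triangle_ineq[of "jac a b' u - jac a b u" "jac a b u - E *\<^sub>R u"]
    by (simp add: algebra_simps)
  moreover have "u \<noteq> 0" using u by auto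
  ultimately show ?thesis using b'.asp_near that by blast
qed

end

section \<open>Compactness of the approximate point spectrum\<close>

lemma (in selfadjoint) asp_bounded_by:
  assumes K: "\<And>u. norm (A u) \<le> K * norm u" and l: "l \<in> asp A"
  shows "\<bar>l\<bar> \<le> K"
proof (rule ccontr)
  assume "\<not> \<bar>l\<bar> \<le> K"
  moreover have "(\<bar>l\<bar> - K) * norm u \<le> norm (A u - l *\<^sub>R u)" for u
    using norm_triangle_ineq2[of "l *\<^sub>R u" "A u"] K[of u]
    by (simp add: left_diff_distrib norm_minus_commute)
  ultimately show False
    using l bdd_below_opI[of "\<bar>l\<bar> - K" "\<lambda>u. A u - l *\<^sub>R u"] by (auto simp: asp_def)
qed

lemma (in selfadjoint) compact_asp: "compact (asp A)"
proof -
  obtain K where K: "\<And>u. norm (A u) \<le> norm u * K" using bounded by blast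
  have "bounded (asp A)"
    unfolding bounded_iff
    by (intro exI[of _ K] ballI, unfold real_norm_def, rule asp_bounded_by)
       (use K in \<open>auto simp: mult.commute\<close>)
  moreover have "open (- asp A)"
    unfolding open_dist
  proof
    fix E assume "E \<in> - asp A"
    then obtain c where c: "c > 0" "\<And>u. c * norm u \<le> norm (A u - E *\<^sub>R u)"
      by (auto simp: asp_def bdd_below_op_def)
    have "E' \<in> - asp A" if "dist E' E < c / 2" for E'
    proof -
      have "c / 2 * norm u \<le> norm (A u - E' *\<^sub>R u)" for u
      proof -
        have "A u - E *\<^sub>R u = (A u - E' *\<^sub>R u) + (E' - E) *\<^sub>R u" by (simp add: algebra_simps)
        then have "norm (A u - E *\<^sub>R u) \<le> norm (A u - E' *\<^sub>R u) + \<bar>E' - E\<bar> * norm u"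
          by (metis norm_triangle_ineq norm_scaleR)
        moreover have "\<bar>E' - E\<bar> * norm u \<le> c / 2 * norm u"
          using that by (intro mult_right_mono) (auto simp: dist_real_def)
        ultimately show ?thesis using c(2)[of u] by linarith
      qed
      then show ?thesis using c(1) bdd_below_opI[of "c / 2" "\<lambda>u. A u - E' *\<^sub>R u"] by (auto simp: asp_def)
    qed
    then show "\<exists>e>0. \<forall>y. dist y E < e \<longrightarrow> y \<in> - asp A"
      using c(1) by (intro exI[of _ "c / 2"]) auto
  qed
  ultimately show ?thesis by (simp add: compact_eq_bounded_closed closed_def)
qed

section \<open>Spectrum and spectral measures of Jacobi operators\<close>

context bounded_jacobi
begin

definition jacz :: "complex \<Rightarrow> ell2 \<Rightarrow> ell2" where
  "jacz z u = jac a b u - mulop (\<lambda>_. z) u"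

lemma coord_jacz: "coord (jacz z u) = (\<lambda>n. jacobi a b (coord u) n - z * coord u n)"
  by (auto simp: jacz_def coord_jac)

lemma bij_jacobi_iff: "bij_betw (\<lambda>u n. jacobi a b u n - z * u n) l2Z l2Z \<longleftrightarrow> bij (jacz z)"
proof -
  define F where "F u = (\<lambda>n. jacobi a b u n - z * u n)" for u
  have F: "F (coord u) = coord (jacz z u)" for u by (simp add: F_def coord_jacz)
  have r: "l2Z = range coord" by (simp add: type_definition.Rep_range[OF type_definition_ell2])
  have "inj_on F l2Z \<longleftrightarrow> inj (jacz z)"
    unfolding r by (auto simp: inj_on_def F coord_inject)
  moreover have "F ` l2Z = coord ` range (jacz z)"
    unfolding r by (auto simp: F image_image)
  then have "F ` l2Z = l2Z \<longleftrightarrow> range (jacz z) = UNIV"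
    unfolding r by (metis coord_inject inj_image_eq_iff injI)
  ultimately show ?thesis unfolding bij_betw_def F_def[abs_def] by simp
qed

lemma jacz_real: "jacz (complex_of_real E) u = jac a b u - E *\<^sub>R u"
  by (rule ell2_eqI) (simp add: coord_jacz coord_jac scaleR_conv_of_real)

text \<open>For nonreal z the product (J - z)(J - cnj z) is coercive with constant (Im z)^2, hence
  bijective, and with it its commuting factors.\<close>

lemma jacz_cnj:
  "jacz z (jacz (cnj z) u) = jac a b (jac a b u - Re z *\<^sub>R u) - Re z *\<^sub>R (jac a b u - Re z *\<^sub>R u)
     + (Im z)\<^sup>2 *\<^sub>R u"
proof (rule ell2_eqI)
  fix n
  have m: "z * cnj z = (complex_of_real (Re z))\<^sup>2 + (complex_of_real (Im z))\<^sup>2"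
    by (simp add: complex_mult_cnj)
  have m': "z * (cnj z * x) = ((complex_of_real (Re z))\<^sup>2 + (complex_of_real (Im z))\<^sup>2) * x" for x
    by (simp add: m[symmetric])
  have lin: "jacobi a b (\<lambda>n. f n - c * g n) n = jacobi a b f n - c * jacobi a b g n" for f g c
    by (simp add: jacobi_def algebra_simps)
  have "coord (jacz z (jacz (cnj z) u)) n =
     jacobi a b (jacobi a b (coord u)) n - (z + cnj z) * jacobi a b (coord u) n + z * (cnj z * coord u n)"
    by (simp add: coord_jacz lin algebra_simps)
  also have "\<dots> = jacobi a b (jacobi a b (coord u)) n - 2 * complex_of_real (Re z) * jacobi a b (coord u) n
      + ((complex_of_real (Re z))\<^sup>2 + (complex_of_real (Im z))\<^sup>2) * coord u n"
    unfolding m' by (simp add: complex_add_cnj)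
  also have "\<dots> = coord (jac a b (jac a b u - Re z *\<^sub>R u) - Re z *\<^sub>R (jac a b u - Re z *\<^sub>R u)
     + (Im z)\<^sup>2 *\<^sub>R u) n"
    by (simp add: coord_jac lin scaleR_conv_of_real) (simp add: algebra_simps power2_eq_square)
  finally show "coord (jacz z (jacz (cnj z) u)) n = \<dots>" .
qed

lemma bij_jacz_nonreal:
  assumes "Im z \<noteq> 0" shows "bij (jacz z)"
proof -
  interpret B: selfadjoint "\<lambda>u. jac a b u - Re z *\<^sub>R u" by (rule selfadjoint_diff)
  define S where "S u = jac a b (jac a b u - Re z *\<^sub>R u) - Re z *\<^sub>R (jac a b u - Re z *\<^sub>R u)
     + (Im z)\<^sup>2 *\<^sub>R u" for u
  have S: "jacz z (jacz (cnj z) u) = S u" "jacz (cnj z) (jacz z u) = S u" for u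
    using jacz_cnj[of z u] jacz_cnj[of "cnj z" u] by (simp_all add: S_def)
  have coer: "(Im z)\<^sup>2 * (norm u)\<^sup>2 \<le> S u \<bullet> u" for u
    using B.adj[of "jac a b u - Re z *\<^sub>R u" u]
    by (simp add: S_def inner_add_left power2_norm_eq_inner)
  have bl: "bounded_linear S"
    unfolding S_def[abs_def]
    by (intro bounded_linear_sub bounded_linear_add bounded_linear_scaleR_right
        bounded_linear_compose[OF bounded_linear_scaleR_right]
        bounded_linear_compose[OF bounded_linear_axioms] bounded_linear_axioms)
  have "surj S" by (rule coercive_surj[OF bl _ coer]) (use assms in simp)
  then have "surj (jacz z)" using S(1) by (metis surj_def)
  moreover have "inj (jacz z)"
  proof (rule injI)
    fix u v assume "jacz z u = jacz z v"
    then have "S u = S v" using S(2) by metis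
    then have "S (u - v) = 0" using linear_diff[OF bounded_linear.linear[OF bl]] by simp
    then have "(Im z)\<^sup>2 * (norm (u - v))\<^sup>2 \<le> 0" using coer[of "u - v"] by simp
    then show "u = v" using assms by (simp add: mult_le_0_iff)
  qed
  ultimately show ?thesis by (simp add: bij_def)
qed

text \<open>If T = J - E is bounded below by c, then <T^2 u, u> = |T u|^2 >= c^2 |u|^2 makes T^2
  coercive, hence T surjective. The converse is the uniform boundedness argument of
  \<open>surj_selfadjoint_bdd_below\<close>.\<close>

lemma bij_jacz_real_iff: "bij (jacz (complex_of_real E)) \<longleftrightarrow> E \<notin> asp (jac a b)"
proof -
  define T where "T = (\<lambda>u. jac a b u - E *\<^sub>R u)"
  interpret T: selfadjoint T unfolding T_def by (rule selfadjoint_diff)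
  have eq: "jacz (complex_of_real E) = T" by (simp add: fun_eq_iff jacz_real T_def)
  have asp: "E \<notin> asp (jac a b) \<longleftrightarrow> bdd_below_op T" by (simp add: asp_def T_def)
  have "bij T" if bb: "bdd_below_op T"
  proof -
    obtain c where c: "c > 0" "\<And>u. c * norm u \<le> norm (T u)" using bb by (auto simp: bdd_below_op_def)
    have "inj T"
    proof (rule injI)
      fix u v assume "T u = T v"
      then have "c * norm (u - v) \<le> 0" using c(2)[of "u - v"] by (simp add: T.diff)
      then show "u = v" using c(1) by (simp add: mult_le_0_iff)
    qed
    moreover have "surj (\<lambda>u. T (T u))"
    proof (rule coercive_surj)
      show "bounded_linear (\<lambda>u. T (T u))"
        by (intro bounded_linear_compose[OF T.bounded_linear_axioms] T.bounded_linear_axioms)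
      show "c\<^sup>2 * (norm u)\<^sup>2 \<le> T (T u) \<bullet> u" for u
      proof -
        have "(c * norm u)\<^sup>2 \<le> (norm (T u))\<^sup>2" using c by (intro power_mono) auto
        then show ?thesis unfolding T.adj[of "T u" u] power2_norm_eq_inner power_mult_distrib .
      qed
    qed (use c in simp)
    then have "surj T" unfolding surj_def by blast
    ultimately show ?thesis by (simp add: bij_def)
  qed
  moreover have "bdd_below_op T" if "bij T"
    using surj_selfadjoint_bdd_below[OF T.selfadjoint_axioms] that by (simp add: bij_def)
  ultimately show ?thesis unfolding eq asp by (rule iffI[rotated])
qed

lemma jacobi_spectrum_eq: "jacobi_spectrum a b = complex_of_real ` asp (jac a b)"
proof (intro set_eqI iffI)
  fix z assume "z \<in> jacobi_spectrum a b"
  then have nb: "\<not> bij (jacz z)" by (simp add: jacobi_spectrum_def bij_jacobi_iff)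
  then have "Im z = 0" using bij_jacz_nonreal by blast
  then have z: "z = complex_of_real (Re z)" by (simp add: complex_eq_iff)
  then have "Re z \<in> asp (jac a b)" using nb bij_jacz_real_iff[of "Re z"] by simp
  then show "z \<in> complex_of_real ` asp (jac a b)" using z by blast
next
  fix z assume "z \<in> complex_of_real ` asp (jac a b)"
  then show "z \<in> jacobi_spectrum a b"
    by (auto simp: jacobi_spectrum_def bij_jacobi_iff bij_jacz_real_iff)
qed

lemma coord_jac_pow: "coord ((jac a b ^^ k) u) = (jacobi a b ^^ k) (coord u)"
  by (induction k) (auto simp: coord_jac)

lemma inner_eq_Re_l2_inner: "u \<bullet> v = Re (l2_inner (coord u) (coord v))"
  unfolding inner_ell2_def l2_inner_def
  by (subst infsum_Re[symmetric, OF summable_cinner_ell2]) (simp add: inner_complex_def)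

lemma spectral_moments_jac:
  assumes "\<psi> \<in> l2Z" "is_spectral_measure a b \<psi> \<mu>"
  shows "spectral_moments (jac a b) (Abs_ell2 \<psi>) \<mu>"
proof (intro spectral_moments.intro spectral_moments_axioms.intro selfadjoint_axioms)
  fix k
  have "(\<integral>x. x ^ k \<partial>\<mu>) = Re (complex_of_real (\<integral>x. x ^ k \<partial>\<mu>))" by simp
  also have "\<dots> = Re (l2_inner \<psi> ((jacobi a b ^^ k) \<psi>))"
    using assms(2) by (simp only: is_spectral_measure_def)
  finally show "(\<integral>x. x ^ k \<partial>\<mu>) = Abs_ell2 \<psi> \<bullet> (jac a b ^^ k) (Abs_ell2 \<psi>)"
    using assms(1) by (simp add: inner_eq_Re_l2_inner coord_jac_pow)
qed (use assms(2) in \<open>auto simp: is_spectral_measure_def\<close>)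

text \<open>The spectrum itself is the null set that carries every spectral measure.\<close>

lemma purely_singular_continuousI:
  assumes null: "emeasure lborel (asp (jac a b)) = 0"
    and noeig: "\<And>E v. jac a b v = E *\<^sub>R v \<Longrightarrow> v = 0"
  shows "purely_singular_continuous a b"
  unfolding purely_singular_continuous_def
proof (intro ballI allI impI conjI)
  fix \<psi> \<mu> assume *: "\<psi> \<in> l2Z" "is_spectral_measure a b \<psi> \<mu>"
  interpret spectral_moments "jac a b" "Abs_ell2 \<psi>" \<mu> by (rule spectral_moments_jac[OF *])
  have "asp (jac a b) \<in> sets lborel" using compact_asp by (simp add: borel_compact)
  then show "\<exists>N\<in>sets lborel. emeasure lborel N = 0 \<and> emeasure \<mu> (UNIV - N) = 0"
    using null measure_outside_asp by (auto simp: Compl_eq_Diff_UNIV intro!: bexI[of _ "asp (jac a b)"])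
  show "emeasure \<mu> {x} = 0" for x by (rule measure_point[OF noeig])
qed

end

section \<open>Transfer matrices\<close>

definition mat2 :: "real \<Rightarrow> real \<Rightarrow> real \<Rightarrow> real \<Rightarrow> real^2^2" where
  "mat2 x y z w = (\<chi> i j. if i = 1 then (if j = 1 then x else y) else (if j = 1 then z else w))"

lemma mat2_nth [simp]:
  "mat2 x y z w $ 1 $ 1 = x" "mat2 x y z w $ 1 $ 2 = y"
  "mat2 x y z w $ 2 $ 1 = z" "mat2 x y z w $ 2 $ 2 = w"
  by (simp_all add: mat2_def)

lemma mat2_eqI:
  fixes A B :: "real^2^2"
  assumes "A $ 1 $ 1 = B $ 1 $ 1" "A $ 1 $ 2 = B $ 1 $ 2" "A $ 2 $ 1 = B $ 2 $ 1" "A $ 2 $ 2 = B $ 2 $ 2"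
  shows "A = B"
  using assms by (simp add: vec_eq_iff forall_2)

lemma mult2_nth: "(A ** B) $ i $ j = A $ i $ 1 * B $ 1 $ j + A $ i $ 2 * B $ 2 $ j"
  for A B :: "real^2^2"
  by (simp add: matrix_matrix_mult_def sum_2)

lemma trace_2: "trace (A :: real^2^2) = A $ 1 $ 1 + A $ 2 $ 2"
  by (simp add: trace_def sum_2)

lemma mat1_2_nth:
  "(mat 1 :: real^2^2) $ 1 $ 1 = 1" "(mat 1 :: real^2^2) $ 1 $ 2 = 0"
  "(mat 1 :: real^2^2) $ 2 $ 1 = 0" "(mat 1 :: real^2^2) $ 2 $ 2 = 1"
  by (simp_all add: mat_def)

text \<open>Cayley-Hamilton turns the powers of an elliptic matrix into the recursion of the
  Chebyshev quotients sin (k \<theta>) / sin \<theta>. The factor sin \<theta> on the left avoids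
  the division, and the real difference \<open>real k - 1\<close> makes k = 0 come out
  right.\<close>

lemma matrix_power_rotation:
  fixes T :: "real^2^2"
  assumes "det T = 1" "trace T = 2 * cos \<theta>"
    and M: "M 0 = mat 1" "\<And>k. M (Suc k) = T ** M k"
  shows "sin \<theta> *\<^sub>R M k = sin (real k * \<theta>) *\<^sub>R T - sin ((real k - 1) * \<theta>) *\<^sub>R mat 1"
proof (induction k)
  case 0
  then show ?case by (simp add: M)
next
  case (Suc k)
  have CH: "T ** T = (2 * cos \<theta>) *\<^sub>R T - mat 1"
    using assms(1,2)
    by (intro mat2_eqI; simp add: mult2_nth mat1_2_nth det_2 trace_2) algebra+
  have rec: "sin (real (Suc k) * \<theta>) = 2 * cos \<theta> * sin (real k * \<theta>) - sin ((real k - 1) * \<theta>)"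
    by (simp add: sin_add sin_diff algebra_simps)
  have lin: "T ** (c *\<^sub>R X - d *\<^sub>R mat 1) = c *\<^sub>R (T ** X) - d *\<^sub>R T" for c d and X :: "real^2^2"
    by (intro mat2_eqI; simp add: mult2_nth mat1_2_nth algebra_simps)
  have "sin \<theta> *\<^sub>R M (Suc k) = T ** (sin \<theta> *\<^sub>R M k - 0 *\<^sub>R mat 1)"
    unfolding lin by (simp add: M)
  also have "\<dots> = sin (real k * \<theta>) *\<^sub>R (T ** T) - sin ((real k - 1) * \<theta>) *\<^sub>R T"
    using Suc lin by simp
  also have "\<dots> = sin (real (Suc k) * \<theta>) *\<^sub>R T - sin (real k * \<theta>) *\<^sub>R mat 1"
    unfolding CH rec by (simp add: scaleR_diff_left scaleR_diff_right mult.commute)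
  finally show ?case by simp
qed

text \<open>The state is (u n, a (n - 1) u (n - 1)) rather than (u n, u (n - 1)); the factor a gives
  every single step determinant 1.\<close>

definition tstep :: "(int \<Rightarrow> real) \<Rightarrow> (int \<Rightarrow> real) \<Rightarrow> real \<Rightarrow> int \<Rightarrow> real^2^2" where
  "tstep a b E n = mat2 ((E - b n) / a n) (- 1 / a n) (a n) 0"

primrec tmat :: "(int \<Rightarrow> real) \<Rightarrow> (int \<Rightarrow> real) \<Rightarrow> real \<Rightarrow> int \<Rightarrow> nat \<Rightarrow> real^2^2" where
  "tmat a b E n 0 = mat 1"
| "tmat a b E n (Suc k) = tstep a b E (n + int k) ** tmat a b E n k"

lemma tmat_add: "tmat a b E n (j + k) = tmat a b E (n + int j) k ** tmat a b E n j"
  by (induction k) (auto simp: matrix_mul_assoc algebra_simps)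

lemma tmat_Suc2: "tmat a b E n (Suc k) = tmat a b E (n + 1) k ** tstep a b E n"
  using tmat_add[of a b E n 1 k] by simp

lemma tmat_cong:
  assumes "\<And>i. i < k \<Longrightarrow> tstep a b E (n + int i) = tstep a' b' E' (n' + int i)"
  shows "tmat a b E n k = tmat a' b' E' n' k"
  using assms by (induction k) auto

lemma det_tmat:
  assumes "\<And>n. a n \<noteq> 0" shows "det (tmat a b E n k) = 1"
proof (induction k)
  case (Suc k)
  have "det (tstep a b E (n + int k)) = 1" using assms by (simp add: tstep_def det_2)
  then show ?case using Suc by (simp add: det_mul)
qed (simp add: det_I)

text \<open>Moving the base point by one conjugates the matrix over a period by the one-step matrix
  A, whose inverse is A'.\<close>

lemma trace_tmat_shift:
  assumes nz: "\<And>n. a n \<noteq> 0"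
    and per: "\<And>n. a (n + int p) = a n" "\<And>n. b (n + int p) = b n"
  shows "trace (tmat a b E n p) = trace (tmat a b E 0 p)"
proof -
  have step: "trace (tmat a b E (n + 1) p) = trace (tmat a b E n p)" for n
  proof -
    define A where "A = tstep a b E n"
    define A' where "A' = mat2 0 (1 / a n) (- a n) ((E - b n) / a n)"
    have inv: "A' ** A = mat 1" "A ** A' = mat 1"
      using nz[of n] by (auto intro!: mat2_eqI simp: A_def A'_def tstep_def mult2_nth mat1_2_nth)
    have "tmat a b E (n + 1) p ** A = A ** tmat a b E n p"
      using tmat_Suc2[of a b E n p] by (simp add: A_def tstep_def per)
    then have "A' ** (tmat a b E (n + 1) p ** A) = tmat a b E n p"
      by (simp add: matrix_mul_assoc inv)
    moreover have "trace (A' ** (tmat a b E (n + 1) p ** A)) = trace (tmat a b E (n + 1) p)"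
      using trace_mul_sym[of A' "tmat a b E (n + 1) p ** A"]
      by (simp add: matrix_mul_assoc[symmetric] inv)
    ultimately show ?thesis by simp
  qed
  show ?thesis
  proof (induction n rule: int_induct[where k = 0])
    case (step2 i)
    then show ?case using step[of "i - 1"] by simp
  qed (use step in auto)
qed

text \<open>The strictly smaller degree of \<open>P22\<close> makes the trace over a period a
  nonconstant polynomial in E; the exact degree of \<open>P11\<close> bounds the number of
  eigenvalues of a box.\<close>

lemma tmat_poly:
  assumes nz: "\<And>n. a n \<noteq> 0"
  shows "\<exists>P11 P12 P21 P22 :: real poly.
    (\<forall>E. tmat a b E n k = mat2 (poly P11 E) (poly P12 E) (poly P21 E) (poly P22 E)) \<and>
    degree P11 = k \<and> P11 \<noteq> 0 \<and> degree P12 \<le> k \<and> degree P21 \<le> k \<and> degree P22 \<le> k \<and>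
    (k > 0 \<longrightarrow> degree P22 < k)"
proof (induction k)
  case 0
  show ?case
    by (rule exI[of _ 1], rule exI[of _ 0], rule exI[of _ 0], rule exI[of _ 1])
       (auto intro!: mat2_eqI simp: mat1_2_nth)
next
  case (Suc k)
  then obtain P11 P12 P21 P22 where P:
    "\<And>E. tmat a b E n k = mat2 (poly P11 E) (poly P12 E) (poly P21 E) (poly P22 E)"
    "degree P11 = k" "P11 \<noteq> 0" "degree P12 \<le> k" "degree P21 \<le> k" "degree P22 \<le> k"
    by blast
  define m where "m = n + int k"
  have am: "a m \<noteq> 0" by (rule nz)
  define L where "L = [:- b m / a m, 1 / a m:]"
  have L: "degree L = 1" "L \<noteq> 0" using am by (auto simp: L_def)
  have d1: "degree (L * P11) = Suc k" using L P(2,3) by (simp add: degree_mult_eq)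
  have d2: "degree (L * P12) \<le> Suc k"
    using degree_mult_le[of L P12] L(1) P(4) by linarith
  have d3: "degree (smult (1 / a m) P21) < Suc k" using P(5) degree_smult_le[of "1 / a m" P21] by linarith
  have "degree (L * P11 - smult (1 / a m) P21) = Suc k"
    using degree_add_eq_left[of "- smult (1 / a m) P21" "L * P11"] d1 d3 by simp
  moreover have "degree (L * P12 - smult (1 / a m) P22) \<le> Suc k"
    using d2 P(6) degree_smult_le[of "1 / a m" P22] by (intro degree_diff_le) linarith+
  moreover have "degree (smult (a m) P11) \<le> Suc k" "degree (smult (a m) P12) < Suc k"
    using P(2,4) degree_smult_le[of "a m" P11] degree_smult_le[of "a m" P12] by linarith+
  moreover have "L * P11 - smult (1 / a m) P21 \<noteq> 0" using calculation(1) by auto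
  moreover have "tmat a b E n (Suc k) = mat2 (poly (L * P11 - smult (1 / a m) P21) E)
      (poly (L * P12 - smult (1 / a m) P22) E) (poly (smult (a m) P11) E) (poly (smult (a m) P12) E)" for E
    using am
    by (auto intro!: mat2_eqI simp: m_def[symmetric] P(1) tstep_def mult2_nth L_def field_simps)
  ultimately show ?case
    by (intro exI[of _ "L * P11 - smult (1 / a m) P21"] exI[of _ "L * P12 - smult (1 / a m) P22"]
        exI[of _ "smult (a m) P11"] exI[of _ "smult (a m) P12"]) auto
qed

locale positive_jacobi = bounded_jacobi +
  fixes \<alpha> :: real
  assumes \<alpha>: "\<alpha> > 0" "\<And>n. \<alpha> \<le> a n"
begin

lemma a_pos: "a n > 0" using \<alpha>(1) \<alpha>(2)[of n] by linarith
lemma a_nz: "a n \<noteq> 0" using a_pos[of n] by simp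

lemma tstep_bound:
  "\<exists>L\<ge>1. \<forall>E n x y. \<bar>E\<bar> \<le> K \<longrightarrow>
     cmod (complex_of_real ((E - b n) / a n) * x - complex_of_real (1 / a n) * y) + cmod (complex_of_real (a n) * x)
       \<le> L * (cmod x + cmod y)"
proof -
  obtain A B where A: "\<And>n. \<bar>a n\<bar> \<le> A" and B: "\<And>n. \<bar>b n\<bar> \<le> B"
    using a_bounded b_bounded by (auto simp: bounded_iff)
  have AB: "0 \<le> A" "0 \<le> B" using A[of 0] B[of 0] by linarith+
  define L where "L = (\<bar>K\<bar> + B) / \<alpha> + A + 1 / \<alpha> + 1"
  have "cmod (complex_of_real ((E - b n) / a n) * x - complex_of_real (1 / a n) * y) + cmod (complex_of_real (a n) * x)
       \<le> L * (cmod x + cmod y)" if "\<bar>E\<bar> \<le> K" for E n x y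
  proof -
    have ai: "1 / a n \<le> 1 / \<alpha>" using \<alpha>(1) \<alpha>(2)[of n] by (intro frac_le) auto
    have "\<bar>E - b n\<bar> / a n \<le> (\<bar>K\<bar> + B) / \<alpha>"
      using that B[of n] \<alpha>(1) \<alpha>(2)[of n] by (intro frac_le) auto
    then have 1: "\<bar>E - b n\<bar> / a n * cmod x \<le> (\<bar>K\<bar> + B) / \<alpha> * cmod x"
      by (intro mult_right_mono) auto
    have 2: "1 / a n * cmod y \<le> 1 / \<alpha> * cmod y" using ai by (intro mult_right_mono) auto
    have 3: "a n * cmod x \<le> A * cmod x" using A[of n] by (intro mult_right_mono) auto
    have "cmod (complex_of_real E - complex_of_real (b n)) = \<bar>E - b n\<bar>"
      unfolding of_real_diff[symmetric] norm_of_real ..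
    then have "cmod (complex_of_real ((E - b n) / a n) * x - complex_of_real (1 / a n) * y)
        \<le> \<bar>E - b n\<bar> / a n * cmod x + 1 / a n * cmod y"
      using norm_triangle_ineq4[of "complex_of_real ((E - b n) / a n) * x" "complex_of_real (1 / a n) * y"]
        a_pos[of n] by (simp add: norm_mult norm_divide)
    moreover have "cmod (complex_of_real (a n) * x) = a n * cmod x"
      using a_pos[of n] by (simp add: norm_mult)
    ultimately have "cmod (complex_of_real ((E - b n) / a n) * x - complex_of_real (1 / a n) * y) + cmod (complex_of_real (a n) * x)
        \<le> ((\<bar>K\<bar> + B) / \<alpha> + A) * cmod x + 1 / \<alpha> * cmod y"
      using 1 2 3 by (simp add: distrib_right)
    also have "\<dots> \<le> L * cmod x + L * cmod y"
      using AB \<alpha>(1) by (intro add_mono mult_right_mono) (auto simp: L_def)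
    finally show ?thesis by (simp add: distrib_left)
  qed
  moreover have "L \<ge> 1" using AB \<alpha>(1) by (simp add: L_def)
  ultimately show ?thesis by blast
qed

text \<open>The vectors (u n, a (n - 1) u (n - 1)) evolve by \<^const>\<open>tmat\<close>, up to errors
  controlled by (J - E) u.\<close>
lemma tmat_inhomogeneous:
  "\<exists>L\<ge>1. \<forall>E n k. \<bar>E\<bar> \<le> K \<longrightarrow>
     \<bar>tmat a b E n k $ 1 $ 1\<bar> + \<bar>tmat a b E n k $ 2 $ 1\<bar> \<le> L ^ k \<and>
     \<bar>tmat a b E n k $ 1 $ 2\<bar> + \<bar>tmat a b E n k $ 2 $ 2\<bar> \<le> L ^ k \<and>
     (\<forall>u :: int \<Rightarrow> complex. cmod (u (n + int k) - (tmat a b E n k $ 1 $ 1 * u n + tmat a b E n k $ 1 $ 2 * (a (n - 1) * u (n - 1)))) +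
       cmod (a (n + int k - 1) * u (n + int k - 1) - (tmat a b E n k $ 2 $ 1 * u n + tmat a b E n k $ 2 $ 2 * (a (n - 1) * u (n - 1))))
       \<le> L ^ k / \<alpha> * (\<Sum>i<k. cmod (jacobi a b u (n + int i) - E * u (n + int i))))"
proof -
  obtain L where L: "L \<ge> 1" and step: "\<And>E n x y. \<bar>E\<bar> \<le> K \<Longrightarrow>
     cmod (complex_of_real ((E - b n) / a n) * x - complex_of_real (1 / a n) * y) + cmod (complex_of_real (a n) * x)
       \<le> L * (cmod x + cmod y)"
    using tstep_bound[of K] by blast
  have T: "tmat a b E n (Suc k) $ 1 $ j = (E - b (n + int k)) / a (n + int k) * tmat a b E n k $ 1 $ j - 1 / a (n + int k) * tmat a b E n k $ 2 $ j"
    "tmat a b E n (Suc k) $ 2 $ j = a (n + int k) * tmat a b E n k $ 1 $ j" for E n k j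
    by (simp_all add: mult2_nth tstep_def)
  have col: "\<bar>tmat a b E n k $ 1 $ j\<bar> + \<bar>tmat a b E n k $ 2 $ j\<bar> \<le> L ^ k" if E: "\<bar>E\<bar> \<le> K" for E n k j
  proof (induction k)
    case 0
    show ?case using exhaust_2[of j] by (auto simp: mat1_2_nth)
  next
    case (Suc k)
    have "\<bar>tmat a b E n (Suc k) $ 1 $ j\<bar> + \<bar>tmat a b E n (Suc k) $ 2 $ j\<bar> \<le>
       L * (\<bar>tmat a b E n k $ 1 $ j\<bar> + \<bar>tmat a b E n k $ 2 $ j\<bar>)"
      using step[OF E, of "n + int k" "complex_of_real (tmat a b E n k $ 1 $ j)" "complex_of_real (tmat a b E n k $ 2 $ j)"]
      unfolding T of_real_mult[symmetric] of_real_diff[symmetric] norm_of_real .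
    also have "\<dots> \<le> L * L ^ k" using Suc L by (intro mult_left_mono) auto
    finally show ?case by simp
  qed
  have err: "cmod (u (n + int k) - (tmat a b E n k $ 1 $ 1 * u n + tmat a b E n k $ 1 $ 2 * (a (n - 1) * u (n - 1)))) +
       cmod (a (n + int k - 1) * u (n + int k - 1) - (tmat a b E n k $ 2 $ 1 * u n + tmat a b E n k $ 2 $ 2 * (a (n - 1) * u (n - 1))))
       \<le> L ^ k / \<alpha> * (\<Sum>i<k. cmod (jacobi a b u (n + int i) - E * u (n + int i)))"
    if E: "\<bar>E\<bar> \<le> K" for E n k and u :: "int \<Rightarrow> complex"
  proof (induction k)
    case 0
    show ?case by (simp add: mat1_2_nth)
  next
    case (Suc k)
    define m where "m = n + int k"
    define x where "x = u m - (tmat a b E n k $ 1 $ 1 * u n + tmat a b E n k $ 1 $ 2 * (a (n - 1) * u (n - 1)))"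
    define y where "y = a (m - 1) * u (m - 1) - (tmat a b E n k $ 2 $ 1 * u n + tmat a b E n k $ 2 $ 2 * (a (n - 1) * u (n - 1)))"
    define g where "g = jacobi a b u m - E * u m"
    define S where "S = (\<Sum>i<k. cmod (jacobi a b u (n + int i) - E * u (n + int i)))"
    have S: "S \<ge> 0" unfolding S_def by (simp add: sum_nonneg)
    have IH: "cmod x + cmod y \<le> L ^ k / \<alpha> * S"
      using Suc by (simp add: x_def y_def m_def S_def)
    have am: "complex_of_real (a m) \<noteq> 0" using a_nz[of m] by simp
    have n1: "n + int (Suc k) = m + 1" by (simp add: m_def)
    have um: "u (m + 1) = complex_of_real ((E - b m) / a m) * u m - complex_of_real (1 / a m) * (a (m - 1) * u (m - 1)) + g / a m"
      using am by (simp add: g_def jacobi_def field_simps)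
    have X: "u (n + int (Suc k)) - (tmat a b E n (Suc k) $ 1 $ 1 * u n + tmat a b E n (Suc k) $ 1 $ 2 * (a (n - 1) * u (n - 1)))
      = (complex_of_real ((E - b m) / a m) * x - complex_of_real (1 / a m) * y) + g / a m"
      unfolding n1 um T m_def[symmetric] x_def y_def by (simp add: algebra_simps)
    have Y: "a (n + int (Suc k) - 1) * u (n + int (Suc k) - 1) - (tmat a b E n (Suc k) $ 2 $ 1 * u n + tmat a b E n (Suc k) $ 2 $ 2 * (a (n - 1) * u (n - 1)))
      = complex_of_real (a m) * x"
      unfolding n1 T m_def[symmetric] x_def by (simp add: algebra_simps)
    have ga: "cmod (g / a m) \<le> cmod g / \<alpha>"
      using \<alpha> a_pos[of m] unfolding norm_divide norm_of_real by (intro frac_le) auto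
    have "cmod ((complex_of_real ((E - b m) / a m) * x - complex_of_real (1 / a m) * y) + g / a m) + cmod (complex_of_real (a m) * x)
      \<le> L * (cmod x + cmod y) + cmod g / \<alpha>"
      using norm_triangle_ineq[of "complex_of_real ((E - b m) / a m) * x - complex_of_real (1 / a m) * y" "g / a m"]
        step[OF E, of m x y] ga by linarith
    also have "\<dots> \<le> L * (L ^ k / \<alpha> * S) + L ^ Suc k / \<alpha> * cmod g"
    proof (intro add_mono mult_left_mono IH)
      have "1 \<le> L ^ Suc k" using L by (rule one_le_power)
      then have "1 * (cmod g / \<alpha>) \<le> L ^ Suc k * (cmod g / \<alpha>)"
        using \<alpha>(1) by (intro mult_right_mono) auto
      then show "cmod g / \<alpha> \<le> L ^ Suc k / \<alpha> * cmod g" by simp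
    qed (use L in simp)
    also have "\<dots> = L ^ Suc k / \<alpha> * (S + cmod g)" by (simp add: distrib_left)
    finally show ?case unfolding X Y by (simp add: S_def g_def m_def)
  qed
  show ?thesis using L col err by (intro exI[of _ L]) blast
qed

text \<open>A matrix M of determinant 1 satisfies M + M^-1 = (trace M) 1. By periodicity the same M
  leads from n - p to n and from n to n + p, so u (n - p) is read off from M^-1. One constant C
  serves all bounded energies, all sites and all u.\<close>

lemma floquet:
  assumes per: "\<And>n. a (n + int p) = a n" "\<And>n. b (n + int p) = b n"
  shows "\<exists>C\<ge>0. \<forall>E n. \<forall>u :: int \<Rightarrow> complex. \<bar>E\<bar> \<le> K \<longrightarrow>
    cmod (u (n + int p) + u (n - int p) - trace (tmat a b E 0 p) * u n)
      \<le> C * (\<Sum>i\<in>{- int p..int p}. cmod (jacobi a b u (n + i) - E * u (n + i)))"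
proof -
  obtain L where L: "L \<ge> 1" and T: "\<And>E n k. \<bar>E\<bar> \<le> K \<Longrightarrow>
     \<bar>tmat a b E n k $ 1 $ 1\<bar> + \<bar>tmat a b E n k $ 2 $ 1\<bar> \<le> L ^ k \<and>
     \<bar>tmat a b E n k $ 1 $ 2\<bar> + \<bar>tmat a b E n k $ 2 $ 2\<bar> \<le> L ^ k \<and>
     (\<forall>u :: int \<Rightarrow> complex. cmod (u (n + int k) - (tmat a b E n k $ 1 $ 1 * u n + tmat a b E n k $ 1 $ 2 * (a (n - 1) * u (n - 1)))) +
       cmod (a (n + int k - 1) * u (n + int k - 1) - (tmat a b E n k $ 2 $ 1 * u n + tmat a b E n k $ 2 $ 2 * (a (n - 1) * u (n - 1))))
       \<le> L ^ k / \<alpha> * (\<Sum>i<k. cmod (jacobi a b u (n + int i) - E * u (n + int i))))"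
    using tmat_inhomogeneous[of K] by blast
  define C where "C = L ^ p / \<alpha> + L ^ p * (L ^ p / \<alpha>)"
  have Lp: "L ^ p \<ge> 0" "L ^ p / \<alpha> \<ge> 0" using L \<alpha>(1) by auto
  have "cmod (u (n + int p) + u (n - int p) - trace (tmat a b E 0 p) * u n)
      \<le> C * (\<Sum>i\<in>{- int p..int p}. cmod (jacobi a b u (n + i) - E * u (n + i)))"
    if E: "\<bar>E\<bar> \<le> K" for E n and u :: "int \<Rightarrow> complex"
  proof -
    define g where "g i = cmod (jacobi a b u i - E * u i)" for i
    define S where "S = (\<Sum>i\<in>{- int p..int p}. g (n + i))"
    define M where "M = tmat a b E n p"
    have M': "tmat a b E (n - int p) p = M"
      unfolding M_def
    proof (rule tmat_cong)
      fix i show "tstep a b E (n - int p + int i) = tstep a b E (n + int i)"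
        using per(1)[of "n - int p + int i"] per(2)[of "n - int p + int i"]
        by (simp add: tstep_def algebra_simps)
    qed
    have tr: "trace (tmat a b E 0 p) = M $ 1 $ 1 + M $ 2 $ 2"
      using trace_tmat_shift[of a p b E n] a_nz per by (simp add: M_def trace_2)
    have dt: "M $ 1 $ 1 * M $ 2 $ 2 - M $ 1 $ 2 * M $ 2 $ 1 = 1"
      using det_tmat[of a b E n p] a_nz by (simp add: M_def det_2)
    have S1: "(\<Sum>i<p. g (n + int i)) \<le> S"
    proof -
      have "(\<Sum>i<p. g (n + int i)) = (\<Sum>j\<in>int ` {..<p}. g (n + j))"
        by (subst sum.reindex) auto
      also have "\<dots> \<le> S" unfolding S_def by (intro sum_mono2) (auto simp: g_def)
      finally show ?thesis .
    qed
    have S2: "(\<Sum>i<p. g (n - int p + int i)) \<le> S"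
    proof -
      have "(\<Sum>i<p. g (n - int p + int i)) = (\<Sum>j\<in>(\<lambda>i. int i - int p) ` {..<p}. g (n + j))"
        by (subst sum.reindex) (auto simp: inj_on_def algebra_simps)
      also have "\<dots> \<le> S" unfolding S_def by (intro sum_mono2) (auto simp: g_def)
      finally show ?thesis .
    qed
    define y where "y = a (n - 1) * u (n - 1)"
    define x' where "x' = u (n - int p)"
    define y' where "y' = a (n - int p - 1) * u (n - int p - 1)"
    define e1 where "e1 = u (n + int p) - (M $ 1 $ 1 * u n + M $ 1 $ 2 * y)"
    define f1 where "f1 = u n - (M $ 1 $ 1 * x' + M $ 1 $ 2 * y')"
    define f2 where "f2 = y - (M $ 2 $ 1 * x' + M $ 2 $ 2 * y')"
    have "cmod e1 \<le> L ^ p / \<alpha> * (\<Sum>i<p. g (n + int i))"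
      using conjunct2[OF conjunct2[OF T[OF E, of n p]], rule_format, of u]
        le_add_same_cancel1[THEN iffD2, OF norm_ge_zero]
      unfolding e1_def M_def g_def y_def by (rule order_trans[rotated])
    then have e1: "cmod e1 \<le> L ^ p / \<alpha> * S"
      using mult_left_mono[OF S1 Lp(2)] by linarith
    have "cmod f1 + cmod f2 \<le> L ^ p / \<alpha> * (\<Sum>i<p. g (n - int p + int i))"
      using conjunct2[OF conjunct2[OF T[OF E, of "n - int p" p]], rule_format, of u]
      unfolding M' f1_def f2_def g_def y_def x'_def y'_def by (simp add: algebra_simps)
    then have f: "cmod f1 + cmod f2 \<le> L ^ p / \<alpha> * S"
      using mult_left_mono[OF S2 Lp(2)] by linarith
    have M2: "\<bar>M $ 2 $ 2\<bar> \<le> L ^ p" "\<bar>M $ 1 $ 2\<bar> \<le> L ^ p"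
      using T[OF E, of n p] by (auto simp: M_def)
    have dt': "complex_of_real (M $ 1 $ 1) * M $ 2 $ 2 - complex_of_real (M $ 1 $ 2) * M $ 2 $ 1 = 1"
      unfolding of_real_mult[symmetric] of_real_diff[symmetric] dt by simp
    have "u (n + int p) + x' - trace (tmat a b E 0 p) * u n = e1 - (M $ 2 $ 2 * f1 - M $ 1 $ 2 * f2)
       + (1 - (complex_of_real (M $ 1 $ 1) * M $ 2 $ 2 - complex_of_real (M $ 1 $ 2) * M $ 2 $ 1)) * x'"
      unfolding tr e1_def f1_def f2_def by (simp add: algebra_simps)
    then have "u (n + int p) + x' - trace (tmat a b E 0 p) * u n = e1 - (M $ 2 $ 2 * f1 - M $ 1 $ 2 * f2)"
      unfolding dt' by simp
    then have "cmod (u (n + int p) + x' - trace (tmat a b E 0 p) * u n)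
       \<le> cmod e1 + (\<bar>M $ 2 $ 2\<bar> * cmod f1 + \<bar>M $ 1 $ 2\<bar> * cmod f2)"
      using norm_triangle_ineq4[of e1 "M $ 2 $ 2 * f1 - M $ 1 $ 2 * f2"]
        norm_triangle_ineq4[of "M $ 2 $ 2 * f1" "M $ 1 $ 2 * f2"] by (simp add: norm_mult)
    also have "\<dots> \<le> L ^ p / \<alpha> * S + (L ^ p * cmod f1 + L ^ p * cmod f2)"
      by (intro add_mono e1 mult_right_mono M2) auto
    also have "\<dots> \<le> L ^ p / \<alpha> * S + L ^ p * (L ^ p / \<alpha> * S)"
      using mult_left_mono[OF f Lp(1)] by (simp add: distrib_left)
    also have "\<dots> = C * S" by (simp add: C_def algebra_simps)
    finally show ?thesis by (simp add: x'_def S_def g_def)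
  qed
  moreover have "C \<ge> 0" unfolding C_def by (intro add_nonneg_nonneg mult_nonneg_nonneg Lp)
  ultimately show ?thesis by blast
qed

text \<open>The two shifts in the Floquet relation together have norm at most 2, so a trace D with
  |D| > 2 leaves the lower bound |D| - 2, up to the constant of \<open>floquet\<close>.\<close>

lemma hyperbolic_not_asp:
  assumes per: "\<And>n. a (n + int p) = a n" "\<And>n. b (n + int p) = b n"
    and tr: "\<bar>trace (tmat a b E 0 p)\<bar> > 2"
  shows "E \<notin> asp (jac a b)"
proof -
  define D where "D = trace (tmat a b E 0 p)"
  obtain C where C: "C \<ge> 0" "\<And>n. \<And>u :: int \<Rightarrow> complex. cmod (u (n + int p) + u (n - int p) - D * u n)
      \<le> C * (\<Sum>i\<in>{- int p..int p}. cmod (jacobi a b u (n + i) - E * u (n + i)))"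
    using floquet[OF per, of "\<bar>E\<bar>"] unfolding D_def by blast
  have Du: "(\<bar>D\<bar> - 2) * norm u \<le> (C * (2 * of_int (int p) + 1)) * norm (jac a b u - E *\<^sub>R u)" for u
  proof -
    define v where "v = shiftop (int p) u + shiftop (- int p) u - D *\<^sub>R u"
    have "norm v \<le> C * (2 * of_int (int p) + 1) * norm (jac a b u - E *\<^sub>R u)"
      by (rule norm_sum_shifts_bound[OF C(1)])
         (use C(2)[of "coord u"] in \<open>auto simp: v_def coord_jac scaleR_conv_of_real\<close>)
    moreover have "norm (D *\<^sub>R u) \<le> norm (shiftop (int p) u + shiftop (- int p) u) + norm v"
      unfolding v_def using norm_triangle_ineq4[of "shiftop (int p) u + shiftop (- int p) u" "shiftop (int p) u + shiftop (- int p) u - D *\<^sub>R u"] by simp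
    moreover have "norm (shiftop (int p) u + shiftop (- int p) u) \<le> 2 * norm u"
      using norm_triangle_ineq[of "shiftop (int p) u" "shiftop (- int p) u"] by simp
    ultimately show ?thesis by (simp add: algebra_simps)
  qed
  define B where "B = C * (2 * of_int (int p) + 1) + 1"
  have B: "B > 0" using C(1) by (simp add: B_def add_nonneg_pos)
  have "(\<bar>D\<bar> - 2) / B * norm u \<le> norm (jac a b u - E *\<^sub>R u)" for u
  proof -
    have "(\<bar>D\<bar> - 2) * norm u \<le> B * norm (jac a b u - E *\<^sub>R u)"
      using Du[of u] unfolding B_def distrib_right by (simp add: add_increasing2)
    then show ?thesis using B by (simp add: field_simps)
  qed
  then show ?thesis
    using tr B bdd_below_opI[of "(\<bar>D\<bar> - 2) / B" "\<lambda>u. jac a b u - E *\<^sub>R u"]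
    by (simp add: asp_def D_def)
qed

end

section \<open>Opening a gap at a prescribed energy\<close>

lemma periodic_dvd:
  fixes f :: "int \<Rightarrow> 'a"
  assumes per: "\<And>n. f (n + int p) = f n" and dv: "p dvd q"
  shows "f (n + int q) = f n"
proof -
  obtain m where m: "q = p * m" using dv by (elim dvdE)
  have "f (n + int (p * m)) = f n"
  proof (induction m)
    case (Suc m)
    then show ?case using per[of "n + int (p * m)"] by (simp add: algebra_simps)
  qed simp
  then show ?thesis by (simp add: m)
qed

text \<open>For small angles the linear gain s sin \<phi> beats the quadratic loss 2 - 2 cos \<phi>.
  With \<phi> = 2 \<psi> the excess at s = c is 2 sin \<psi> (c cos \<psi> - 2 sin \<psi>), positive
  when tan \<psi> < c / 2; the choice is tan \<psi> = c / 4.\<close>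

lemma exists_large_angle:
  fixes c :: real
  assumes "c > 0"
  shows "\<exists>\<phi>. 0 < \<phi> \<and> \<phi> < pi \<and> (\<forall>s. c \<le> s \<longrightarrow> 2 * cos \<phi> + s * sin \<phi> > 2)"
proof -
  define \<psi> where "\<psi> = arctan (c / 4)"
  have \<psi>: "0 < \<psi>" "\<psi> < pi / 2" using assms arctan_ubound[of "c / 4"] by (auto simp: \<psi>_def zero_less_arctan_iff)
  then have pos: "0 < sin \<psi>" "0 < cos \<psi>"
    by (auto intro!: sin_gt_zero cos_gt_zero_pi)
  have "tan \<psi> = c / 4" by (simp add: \<psi>_def tan_arctan)
  then have sc: "sin \<psi> = c / 4 * cos \<psi>" using pos(2) by (simp add: tan_def field_simps)
  have "2 * cos (2 * \<psi>) + s * sin (2 * \<psi>) > 2" if "c \<le> s" for s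
  proof -
    have "2 * cos (2 * \<psi>) + c * sin (2 * \<psi>) - 2 = 2 * sin \<psi> * (c * cos \<psi> - 2 * sin \<psi>)"
      unfolding cos_double_sin sin_double by (simp add: power2_eq_square algebra_simps)
    also have "\<dots> > 0"
      using pos assms by (intro mult_pos_pos) (auto simp: sc)
    finally have "2 * cos (2 * \<psi>) + c * sin (2 * \<psi>) > 2" by simp
    moreover have "c * sin (2 * \<psi>) \<le> s * sin (2 * \<psi>)"
      using that \<psi> by (intro mult_right_mono sin_ge_zero) auto
    ultimately show ?thesis by linarith
  qed
  then show ?thesis using \<psi> by (intro exI[of _ "2 * \<psi>"]) auto
qed

text \<open>Once k times the length of an interval of angles exceeds 2 \<pi>, every angle is
  attained by the k-th multiple.\<close>
lemma attained_multiple: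
  fixes \<theta> :: "real \<Rightarrow> real"
  assumes cont: "continuous_on I \<theta>" and conn: "connected I"
    and xy: "x \<in> I" "y \<in> I" "\<theta> x < \<theta> y"
  shows "\<exists>k z. k > (0::nat) \<and> z \<in> I \<and> cos (real k * \<theta> z) = cos \<phi> \<and> sin (real k * \<theta> z) = sin \<phi>"
proof -
  obtain k :: nat where k: "2 * pi / (\<theta> y - \<theta> x) < real k" using reals_Archimedean2 by blast
  have "0 < 2 * pi / (\<theta> y - \<theta> x)" using xy(3) by simp
  then have k0: "k > 0" using k by (metis less_trans of_nat_0_less_iff)
  have kd: "2 * pi < real k * \<theta> y - real k * \<theta> x"
    using k xy(3) by (simp add: field_simps)
  \<comment> \<open>The number of full turns that puts \<phi> + 2 \<pi> j between k \<theta> x and k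
    \<theta> x + 2 \<pi>, hence below k \<theta> y.\<close>
  define j where "j = \<lceil>(real k * \<theta> x - \<phi>) / (2 * pi)\<rceil>"
  have "(real k * \<theta> x - \<phi>) / (2 * pi) \<le> of_int j" "of_int j < (real k * \<theta> x - \<phi>) / (2 * pi) + 1"
    unfolding j_def by linarith+
  then have j: "real k * \<theta> x \<le> \<phi> + 2 * pi * of_int j" "\<phi> + 2 * pi * of_int j < real k * \<theta> x + 2 * pi"
    using pi_gt_zero by (simp_all add: field_simps)
  define v where "v = (\<phi> + 2 * pi * of_int j) / real k"
  have "\<theta> x \<le> v" "v \<le> \<theta> y"
    using j kd k0 by (simp_all add: v_def field_simps)
  moreover have "connected (\<theta> ` I)" by (rule connected_continuous_image[OF cont conn])
  ultimately have "v \<in> \<theta> ` I"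
    using connectedD_interval[of "\<theta> ` I" "\<theta> x" "\<theta> y" v] xy(1,2) by blast
  then obtain z where z: "z \<in> I" "\<theta> z = v" by blast
  have "real k * \<theta> z = \<phi> + 2 * pi * of_int j" using k0 by (simp add: z v_def)
  then have "cos (real k * \<theta> z) = cos \<phi>" "sin (real k * \<theta> z) = sin \<phi>"
    using cos.plus_of_int[of \<phi> j] sin.plus_of_int[of \<phi> j] by (simp_all add: mult.commute)
  then show ?thesis using k0 z(1) by blast
qed

context positive_jacobi
begin

text \<open>If nearby energies E' are elliptic, their rotation angle is not constant. Changing a single site
  of k periods by t makes the trace 2 cos (k \<theta>) + t T12 sin (k \<theta>) / sin \<theta>, which exceeds 2
  when k \<theta> is a suitable small angle. The energy E' is moved to E by a constant shift of b.\<close>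
lemma open_gap:
  assumes p: "p > 0" and per: "\<And>n. a (n + int p) = a n" "\<And>n. b (n + int p) = b n"
    and d: "d > 0"
  shows "\<exists>P V. P > 0 \<and> p dvd P \<and> (\<forall>n. V (n + int P) = V n) \<and> (\<forall>n. \<bar>V n - b n\<bar> \<le> d) \<and>
    E \<notin> asp (jac a V)"
proof -
  have sh: "tstep a (\<lambda>n. b n + (E - E')) E = tstep a b E'" for E'
    by (auto simp: tstep_def fun_eq_iff)
  have hyp: "E \<notin> asp (jac a V)"
    if V: "\<And>n. V (n + int P) = V n" "\<And>n. \<bar>V n - b n\<bar> \<le> d" and dv: "p dvd P"
      and tr: "\<bar>trace (tmat a V E 0 P)\<bar> > 2" for V P
  proof -
    obtain B where B: "\<And>n. \<bar>b n\<bar> \<le> B" using b_bounded by (auto simp: bounded_iff)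
    have "\<bar>V n\<bar> \<le> B + d" for n using B[of n] V(2)[of n] by linarith
    then have "bounded (range V)" unfolding bounded_iff by (intro exI[of _ "B + d"]) auto
    then interpret V: positive_jacobi a V \<alpha>
      by (intro positive_jacobi.intro bounded_jacobi.intro positive_jacobi_axioms.intro a_bounded \<alpha>)
    have "a (n + int P) = a n" for n
      by (rule periodic_dvd[where f = a and p = p, OF per(1) dv])
    then show ?thesis using V.hyperbolic_not_asp[of P E] V(1) tr by blast
  qed
  \<comment> \<open>Half the trace: |x| > 1 already means a gap, while |x| < 1 makes x the cosine of
    a rotation angle.\<close>
  define x where "x E' = trace (tmat a b E' 0 p) / 2" for E'
  obtain P11 P12 P21 P22 :: "real poly" where P:
    "\<And>E. tmat a b E 0 p = mat2 (poly P11 E) (poly P12 E) (poly P21 E) (poly P22 E)"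
    "degree P11 = p" "degree P22 < p"
    using tmat_poly[of a b 0 p] a_nz p by blast
  define Q where "Q = smult (1/2) (P11 + P22)"
  have xQ: "x E' = poly Q E'" for E' by (simp add: x_def Q_def P(1) trace_2)
  have degQ: "degree Q = p" using P(2,3) by (simp add: Q_def degree_add_eq_left)
  have xinf: "finite {E'. x E' = c}" for c
  proof -
    have "Q - [:c:] \<noteq> 0" using degQ p by auto
    from poly_roots_finite[OF this] show ?thesis by (simp add: xQ)
  qed
  have xcont: "continuous_on S x" for S unfolding xQ[abs_def] by (intro continuous_intros)
  consider (big) E' where "\<bar>E - E'\<bar> \<le> d" "\<bar>x E'\<bar> > 1" | (small) "\<And>E'. \<bar>E - E'\<bar> \<le> d \<Longrightarrow> \<bar>x E'\<bar> \<le> 1"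
    by fastforce
  then show ?thesis
  proof cases
    case big
    define V where "V n = b n + (E - E')" for n
    have "tmat a V E 0 p = tmat a b E' 0 p"
      by (rule tmat_cong) (simp add: V_def tstep_def)
    then have "\<bar>trace (tmat a V E 0 p)\<bar> > 2" using big(2) by (simp add: x_def)
    then have "E \<notin> asp (jac a V)"
      using big(1) by (intro hyp[of V p]) (auto simp: V_def per)
    then show ?thesis using p big(1)
      by (intro exI[of _ p] exI[of _ V]) (auto simp: V_def per)
  next
    case small
    \<comment> \<open>The nonconstant polynomial x takes the values 1 and -1 only finitely often, so
      some energy near E is strictly elliptic.\<close>
    have "infinite {E - d / 2 <..< E + d / 2}" using d by simp
    then have "\<not> {E - d / 2 <..< E + d / 2} \<subseteq> {E'. x E' = 1} \<union> {E'. x E' = -1}"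
      using xinf[of 1] xinf[of "-1"] finite_subset by blast
    then obtain E0 where E0: "E0 \<in> {E - d / 2 <..< E + d / 2}" "x E0 \<noteq> 1" "x E0 \<noteq> -1"
      by blast
    have E0d: "\<bar>E - E0\<bar> < d / 2" using E0(1) by (auto simp: abs_if)
    have E0': "x E0 \<in> {-1<..<1}" using small[of E0] d E0d E0(2,3) by auto
    have "isCont x E0" using xcont[of UNIV] by (simp add: continuous_on_eq_continuous_at)
    then have "\<forall>\<^sub>F E' in at E0. x E' \<in> {-1<..<1}"
      using E0' unfolding isCont_def by (rule topological_tendstoD[OF _ open_greaterThanLessThan])
    then obtain r where r: "r > 0" "\<And>E'. E' \<noteq> E0 \<Longrightarrow> dist E' E0 < r \<Longrightarrow> x E' \<in> {-1<..<1}"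
      by (auto simp: eventually_at)
    \<comment> \<open>The budget d is spent as d / 2 on the distance from E to E0, d / 4 on that
      from E0 to E', and d / 4 on the single-site change t.\<close>
    define h where "h = min (r / 2) (d / 4)"
    have h: "h > 0" "h < r" "h \<le> d / 4" using r(1) d by (auto simp: h_def)
    define I where "I = {E0 - h..E0 + h}"
    have xI: "\<bar>x E'\<bar> < 1" "\<bar>E - E'\<bar> \<le> d" if "E' \<in> I" for E'
    proof -
      have "x E' \<in> {-1<..<1}"
        using r(2)[of E'] E0' that h by (cases "E' = E0") (auto simp: I_def dist_real_def)
      then show "\<bar>x E'\<bar> < 1" by auto
      show "\<bar>E - E'\<bar> \<le> d" using E0d that h(3) d unfolding I_def atLeastAtMost_iff by linarith
    qed
    define \<theta> where "\<theta> E' = arccos (x E')" for E'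
    have \<theta>: "cos (\<theta> E') = x E'" "sin (\<theta> E') > 0" if "E' \<in> I" for E'
    proof -
      have *: "-1 < x E'" "x E' < 1" using xI[OF that] by auto
      then show "cos (\<theta> E') = x E'" by (simp add: \<theta>_def)
      have "0 < \<theta> E'" "\<theta> E' < pi" using arccos_lt_bounded[OF *] by (auto simp: \<theta>_def)
      then show "sin (\<theta> E') > 0" by (rule sin_gt_zero)
    qed
    have \<theta>cont: "continuous_on I \<theta>"
      unfolding \<theta>_def
    proof (rule continuous_on_arccos)
      show "\<forall>E'\<in>I. - 1 \<le> x E' \<and> x E' \<le> 1" using xI(1) by (auto simp: abs_less_iff less_imp_le)
    qed (rule xcont)
    define s where "s E' = poly P12 E' / sin (\<theta> E')" for E'
    \<comment> \<open>If the upper right entry vanished, determinant 1 would force the diagonal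
      entries to have product 1, hence a sum of modulus at least 2, against ellipticity.\<close>
    have s_nz: "s E' \<noteq> 0" if "E' \<in> I" for E'
    proof
      assume "s E' = 0"
      then have "poly P12 E' = 0" using \<theta>(2)[OF that] by (simp add: s_def)
      then have dt: "poly P11 E' * poly P22 E' = 1"
        using det_tmat[of a b E' 0 p] a_nz by (simp add: P(1) det_2)
      have "(poly P11 E' + poly P22 E')\<^sup>2 = (poly P11 E' - poly P22 E')\<^sup>2 + 4"
        using dt by (simp add: power2_eq_square algebra_simps)
      moreover have "2 * x E' = poly P11 E' + poly P22 E'" by (simp add: x_def P(1) trace_2)
      ultimately have "(2 * x E')\<^sup>2 \<ge> 2\<^sup>2" by (simp only:) simp
      then have "\<bar>2 * x E'\<bar> \<ge> 2" using abs_le_square_iff[of 2 "2 * x E'"] by simp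
      then show False using xI(1)[OF that] by (simp add: abs_mult)
    qed
    have scont: "continuous_on I (\<lambda>E'. \<bar>s E'\<bar>)"
      unfolding s_def using \<theta>(2) by (intro continuous_intros \<theta>cont) force
    have "compact I" "I \<noteq> {}" using h by (auto simp: I_def)
    from continuous_attains_inf[OF this scont] obtain Em where
      Em: "Em \<in> I" "\<And>E'. E' \<in> I \<Longrightarrow> \<bar>s Em\<bar> \<le> \<bar>s E'\<bar>" by blast
    \<comment> \<open>The minimum of |s| over I lets one angle \<phi> serve all of I; it has to be
      fixed before k and E' are found.\<close>
    define c where "c = d / 4 * \<bar>s Em\<bar>"
    have "c > 0" using s_nz[OF Em(1)] d by (simp add: c_def)
    then obtain \<phi> where \<phi>: "\<And>s. c \<le> s \<Longrightarrow> 2 * cos \<phi> + s * sin \<phi> > 2"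
      using exists_large_angle by blast
    have "\<exists>E1\<in>I. \<exists>E2\<in>I. \<theta> E1 < \<theta> E2"
    proof (rule ccontr)
      assume neg: "\<not> ?thesis"
      have E0I: "E0 \<in> I" using h(1) by (simp add: I_def)
      have eq: "\<theta> E1 = \<theta> E0" if "E1 \<in> I" for E1
        using that E0I neg by (meson linorder_neqE_linordered_idom)
      have "x E1 = x E0" if "E1 \<in> I" for E1
        using eq[OF that] \<theta>(1)[OF that] \<theta>(1)[OF E0I] by simp
      then have "I \<subseteq> {E'. x E' = x E0}" by blast
      then have "finite I" using xinf by (rule finite_subset)
      moreover have "infinite I" unfolding I_def using h(1) by (intro infinite_Icc) simp
      ultimately show False by blast
    qed
    then obtain E1 E2 where E12: "E1 \<in> I" "E2 \<in> I" "\<theta> E1 < \<theta> E2" by blast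
    obtain k E' where k: "k > 0" and E': "E' \<in> I" and
      ang: "cos (real k * \<theta> E') = cos \<phi>" "sin (real k * \<theta> E') = sin \<phi>"
      using attained_multiple[OF \<theta>cont _ E12, of \<phi>] by (auto simp: I_def)
    \<comment> \<open>The sign makes t times s E' equal to d / 4 times |s E'|, whichever sign the
      upper right entry has.\<close>
    define t where "t = sgn (s E') * (d / 4)"
    define P where "P = k * p"
    define V where "V n = b n + (E - E') + (if n mod int P = 0 then t else 0)" for n
    have P0: "P > 0" using k p by (simp add: P_def)
    have VP: "V (n + int P) = V n" for n
    proof -
      have "b (n + int (k * p)) = b n"
        by (rule periodic_dvd[where f = b and p = p, OF per(2)]) simp
      then show ?thesis unfolding V_def P_def by simp
    qed
    have EE': "\<bar>E - E'\<bar> \<le> 3 * d / 4"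
      using E' E0d h(3) unfolding I_def atLeastAtMost_iff by linarith
    define T where "T = tmat a b E' 0 p"
    define M where "M j = tmat a b E' 0 (j * p)" for j
    have bm: "b (int (j * p) + n) = b n" "a (int (j * p) + n) = a n" for j n
      using periodic_dvd[where f = b and p = p and q = "j * p" and n = n, OF per(2)]
        periodic_dvd[where f = a and p = p and q = "j * p" and n = n, OF per(1)]
      by (simp_all add: add.commute)
    have MS: "M (Suc j) = T ** M j" for j
    proof -
      have "tmat a b E' (0 + int (j * p)) p = T"
        unfolding T_def
      proof (rule tmat_cong)
        show "tstep a b E' (0 + int (j * p) + int i) = tstep a b E' (0 + int i)" for i
          using bm[where j = j and n = "int i"] by (simp add: tstep_def)
      qed
      then show ?thesis
        using tmat_add[of a b E' 0 "j * p" p] by (simp add: M_def add.commute)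
    qed
    have Mk: "sin (\<theta> E') *\<^sub>R M k = sin (real k * \<theta> E') *\<^sub>R T - sin ((real k - 1) * \<theta> E') *\<^sub>R mat 1"
    proof (rule matrix_power_rotation)
      show "det T = 1" unfolding T_def by (rule det_tmat[OF a_nz])
      show "trace T = 2 * cos (\<theta> E')" using \<theta>(1)[OF E'] by (simp add: x_def T_def)
    qed (simp_all add: MS, simp add: M_def)
    have sn: "sin (\<theta> E') > 0" by (rule \<theta>(2)[OF E'])
    have T12: "T $ 1 $ 2 = s E' * sin (\<theta> E')" using sn by (simp add: T_def P(1) s_def)
    have "sin (\<theta> E') * M k $ 1 $ 2 = sin \<phi> * (s E' * sin (\<theta> E'))"
      using arg_cong[OF Mk, of "\<lambda>X. X $ 1 $ 2"] by (simp add: ang mat1_2_nth T12)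
    then have M12: "M k $ 1 $ 2 = s E' * sin \<phi>" using sn by simp
    have "sin (\<theta> E') * trace (M k) = sin (real k * \<theta> E') * (2 * cos (\<theta> E')) - 2 * sin ((real k - 1) * \<theta> E')"
    proof -
      have trT: "T $ 1 $ 1 + T $ 2 $ 2 = 2 * cos (\<theta> E')"
        using \<theta>(1)[OF E'] by (simp add: x_def T_def trace_2)
      have "sin (\<theta> E') * trace (M k) = sin (\<theta> E') * M k $ 1 $ 1 + sin (\<theta> E') * M k $ 2 $ 2"
        by (simp add: trace_2 distrib_left)
      also have "sin (\<theta> E') * M k $ 1 $ 1 = sin (real k * \<theta> E') * T $ 1 $ 1 - sin ((real k - 1) * \<theta> E')"
        using arg_cong[OF Mk, of "\<lambda>X. X $ 1 $ 1"] by (simp add: mat1_2_nth)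
      also have "sin (\<theta> E') * M k $ 2 $ 2 = sin (real k * \<theta> E') * T $ 2 $ 2 - sin ((real k - 1) * \<theta> E')"
        using arg_cong[OF Mk, of "\<lambda>X. X $ 2 $ 2"] by (simp add: mat1_2_nth)
      finally show ?thesis unfolding trT[symmetric] by (simp add: distrib_left)
    qed
    also have "\<dots> = sin (\<theta> E') * (2 * cos (real k * \<theta> E'))"
      by (simp add: sin_diff algebra_simps)
    finally have trM: "trace (M k) = 2 * cos \<phi>" using sn ang(1) by simp
    \<comment> \<open>Site 0 is the only altered one within the period and acts first, so the change
      appears as a shear on the far right.\<close>
    have "tmat a V E 0 P = tmat a b E' 1 (P - 1) ** (tstep a b E' 0 ** mat2 1 0 t 1)"
    proof -
      have "tmat a V E 0 P = tmat a V E 1 (P - 1) ** tstep a V E 0"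
        using tmat_Suc2[of a V E 0 "P - 1"] P0 by simp
      also have "tmat a V E 1 (P - 1) = tmat a b E' 1 (P - 1)"
      proof (rule tmat_cong)
        fix i assume "i < P - 1"
        then have "(1 + int i) mod int P \<noteq> 0" by simp
        then show "tstep a V E (1 + int i) = tstep a b E' (1 + int i)"
          by (simp add: tstep_def V_def)
      qed
      also have "tstep a V E 0 = tstep a b E' 0 ** mat2 1 0 t 1"
        using a_nz[of 0] by (intro mat2_eqI) (simp_all add: tstep_def V_def mult2_nth field_simps)
      finally show ?thesis .
    qed
    also have "\<dots> = tmat a b E' 0 P ** mat2 1 0 t 1"
      using tmat_Suc2[of a b E' 0 "P - 1"] P0 by (simp add: matrix_mul_assoc)
    finally have "tmat a V E 0 P = M k ** mat2 1 0 t 1" by (simp add: M_def P_def)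
    then have "trace (tmat a V E 0 P) = trace (M k) + t * M k $ 1 $ 2"
      by (simp add: trace_2 mult2_nth)
    also have "\<dots> = 2 * cos \<phi> + d / 4 * \<bar>s E'\<bar> * sin \<phi>"
      by (simp add: trM M12 t_def abs_sgn)
    also have "\<dots> > 2"
    proof (rule \<phi>)
      show "c \<le> d / 4 * \<bar>s E'\<bar>" unfolding c_def using Em(2)[OF E'] d by (intro mult_left_mono) auto
    qed
    finally have tr: "\<bar>trace (tmat a V E 0 P)\<bar> > 2" by simp
    have Vb: "\<bar>V n - b n\<bar> \<le> d" for n
    proof -
      have "\<bar>t\<bar> \<le> d / 4" using d by (simp add: t_def abs_mult sgn_if)
      then show ?thesis using EE' unfolding V_def by (split if_split) linarith
    qed
    show ?thesis
      using hyp[of V P, OF VP Vb _ tr] P0 VP Vb by (intro exI[of _ P] exI[of _ V]) (simp add: P_def)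
  qed
qed

end

section \<open>Thin spectra by concatenation\<close>

context positive_jacobi
begin

text \<open>Cutting the bonds at the sites congruent to c splits the operator into translates
  of a single finite box, whose eigenvalues are the zeros of the upper left entry of the
  transfer matrix across the box.\<close>
lemma box_not_asp:
  fixes P :: nat and c :: int
  defines "a0 \<equiv> (\<lambda>n. if int P dvd n - c then 0 else a n)"
  assumes P: "P > 0" and per: "\<And>n. a (n + int P) = a n" "\<And>n. b (n + int P) = b n"
    and nz: "tmat a b l (c + 1) P $ 1 $ 1 \<noteq> 0"
  shows "l \<notin> asp (jac a0 b)"
proof -
  obtain A where A: "\<And>n. \<bar>a n\<bar> \<le> A" using a_bounded by (auto simp: bounded_iff)
  have "bounded (range a0)"
    unfolding bounded_iff using A abs_ge_zero[of "a 0"] order_trans[OF abs_ge_zero A[of 0]]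
    by (intro exI[of _ A]) (auto simp: a0_def)
  then interpret J0: bounded_jacobi a0 b by (intro bounded_jacobi.intro b_bounded)
  obtain L where L: "L \<ge> 1" and T0: "\<And>E n k. \<bar>E\<bar> \<le> \<bar>l\<bar> \<Longrightarrow>
     \<bar>tmat a b E n k $ 1 $ 1\<bar> + \<bar>tmat a b E n k $ 2 $ 1\<bar> \<le> L ^ k \<and>
     \<bar>tmat a b E n k $ 1 $ 2\<bar> + \<bar>tmat a b E n k $ 2 $ 2\<bar> \<le> L ^ k \<and>
     (\<forall>u :: int \<Rightarrow> complex. cmod (u (n + int k) - (tmat a b E n k $ 1 $ 1 * u n + tmat a b E n k $ 1 $ 2 * (a (n - 1) * u (n - 1)))) +
       cmod (a (n + int k - 1) * u (n + int k - 1) - (tmat a b E n k $ 2 $ 1 * u n + tmat a b E n k $ 2 $ 2 * (a (n - 1) * u (n - 1))))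
       \<le> L ^ k / \<alpha> * (\<Sum>i<k. cmod (jacobi a b u (n + int i) - E * u (n + int i))))"
    using tmat_inhomogeneous[of "\<bar>l\<bar>"] by blast
  note T = T0[OF order_refl]
  define t where "t = \<bar>tmat a b l (c + 1) P $ 1 $ 1\<bar>"
  have t: "t > 0" using nz by (simp add: t_def)
  define C where "C = L ^ P * (L ^ P / \<alpha> / t) + L ^ P / \<alpha>"
  have LP: "L ^ P \<ge> 0" "L ^ P / \<alpha> \<ge> 0" using L \<alpha>(1) by auto
  have C0: "C \<ge> 0" using LP t unfolding C_def by (intro add_nonneg_nonneg mult_nonneg_nonneg divide_nonneg_pos[of "L ^ P / \<alpha>" t]) auto
  have main: "cmod (v n) \<le> C * (\<Sum>i\<in>{- int P..int P}. cmod (jacobi a0 b v (n + i) - l * v (n + i)))"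
    for v :: "int \<Rightarrow> complex" and n
  proof -
    define g where "g i = cmod (jacobi a0 b v i - l * v i)" for i
    define S where "S = (\<Sum>i\<in>{- int P..int P}. g (n + i))"
    \<comment> \<open>The position of n within its box, which starts at s, directly after a cut
      bond.\<close>
    define k where "k = nat ((n - c - 1) mod int P)"
    define s where "s = n - int k"
    have k: "k < P" using P by (simp add: k_def nat_less_iff)
    have kint: "int k = (n - c - 1) mod int P" using P by (simp add: k_def)
    have sdvd: "int P dvd s - (c + 1)"
    proof -
      have "s - (c + 1) = (n - c - 1) - (n - c - 1) mod int P" by (simp add: s_def kint)
      then show ?thesis by (simp only: dvd_minus_mod)
    qed
    then obtain j where "s - (c + 1) = int P * j" by (elim dvdE)
    then have j: "s = c + 1 + int P * j" by simp
    \<comment> \<open>Truncation of v to its box. Inside the box the uncut operator acts on w as the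
      cut operator acts on v: setting the outer neighbours to 0 has the same effect as cutting the
      bonds to them.\<close>
    define w where "w i = (if s \<le> i \<and> i < s + int P then v i else 0)" for i
    have dv: "int P dvd (s + int i) - c \<longleftrightarrow> i = P - 1" if "i < P" for i
    proof -
      have eq: "(s + int i) - c = int P * j + int (Suc i)" by (simp add: j)
      have "int P dvd (s + int i) - c \<longleftrightarrow> int P dvd int (Suc i)"
        unfolding eq by (rule dvd_add_right_iff) simp
      also have "\<dots> \<longleftrightarrow> P dvd Suc i" by (rule of_nat_dvd_iff)
      also have "\<dots> \<longleftrightarrow> i = P - 1" using that P dvd_imp_le[of P "Suc i"] by auto
      finally show ?thesis .
    qed
    have dv0: "int P dvd (s - 1) - c" using sdvd by (simp add: algebra_simps)
    have gw: "cmod (jacobi a b w (s + int i) - l * w (s + int i)) = g (s + int i)" if i: "i < P" for i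
    proof -
      have r: "a (s + int i) * w (s + int i + 1) = a0 (s + int i) * v (s + int i + 1)"
        using i P dv[OF i] by (cases "i = P - 1") (auto simp: w_def a0_def)
      have lft: "a (s + int i - 1) * w (s + int i - 1) = a0 (s + int i - 1) * v (s + int i - 1)"
      proof (cases i)
        case 0
        then show ?thesis using dv0 by (simp add: w_def a0_def)
      next
        case (Suc i')
        then show ?thesis using dv[of i'] i by (auto simp: w_def a0_def algebra_simps)
      qed
      have "w (s + int i) = v (s + int i)" using i by (simp add: w_def)
      then show ?thesis unfolding jacobi_def g_def lft r by simp
    qed
    have sumg: "(\<Sum>i<k'. cmod (jacobi a b w (s + int i) - l * w (s + int i))) \<le> S" if "k' \<le> P" for k'
    proof -
      have "(\<Sum>i<k'. cmod (jacobi a b w (s + int i) - l * w (s + int i))) = (\<Sum>i<k'. g (s + int i))"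
        using that by (intro sum.cong) (auto simp: gw)
      also have "\<dots> = (\<Sum>i\<in>(\<lambda>i. int i - int k) ` {..<k'}. g (n + i))"
        by (subst sum.reindex) (auto simp: inj_on_def s_def algebra_simps)
      also have "\<dots> \<le> S" unfolding S_def using that k by (intro sum_mono2) (auto simp: g_def)
      finally show ?thesis .
    qed
    have w1: "w (s - 1) = 0" by (simp add: w_def)
    have ws: "w s = v s" using P by (simp add: w_def)
    have est: "cmod (w (s + int k') - tmat a b l s k' $ 1 $ 1 * v s) \<le> L ^ P / \<alpha> * S" if k': "k' \<le> P" for k'
    proof -
      have "cmod (w (s + int k') - (tmat a b l s k' $ 1 $ 1 * w s + tmat a b l s k' $ 1 $ 2 * (a (s - 1) * w (s - 1))))
         \<le> L ^ k' / \<alpha> * (\<Sum>i<k'. cmod (jacobi a b w (s + int i) - l * w (s + int i)))"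
        using conjunct2[OF conjunct2[OF T[of s k']], rule_format, of w]
          le_add_same_cancel1[THEN iffD2, OF norm_ge_zero] by (rule order_trans[rotated])
      also have "\<dots> \<le> L ^ P / \<alpha> * S"
        using L \<alpha>(1) k' by (intro mult_mono sumg divide_right_mono power_increasing) (auto intro: sum_nonneg)
      finally show ?thesis by (simp add: w1 ws)
    qed
    have "tmat a b l s P = tmat a b l (c + 1) P"
    proof (rule tmat_cong)
      fix i
      have "f (x + int P * j) = f x" if f: "\<And>n. f (n + int P) = f n" for f :: "int \<Rightarrow> real" and x
      proof (induction j rule: int_induct[where k = 0])
        case (step1 i)
        then show ?case using f[of "x + int P * i"] by (simp add: algebra_simps)
      next
        case (step2 i)
        then show ?case using f[of "x + int P * (i - 1)"] by (simp add: algebra_simps)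
      qed simp
      from this[of a "c + 1 + int i"] this[of b "c + 1 + int i"]
      show "tstep a b l (s + int i) = tstep a b l (c + 1 + int i)"
        by (simp add: tstep_def j per algebra_simps)
    qed
    \<comment> \<open>Both w (s - 1) and w (s + P) vanish, so the upper left entry times v s is
      bounded by the defect alone.\<close>
    then have "t * cmod (v s) \<le> L ^ P / \<alpha> * S"
      using est[of P] by (simp add: w_def norm_mult t_def)
    then have "cmod (v s) * t \<le> L ^ P / \<alpha> * S" by (subst mult.commute)
    then have "cmod (v s) \<le> L ^ P / \<alpha> * S / t" by (rule pos_le_divide_eq[OF t, THEN iffD2])
    then have vs: "cmod (v s) \<le> L ^ P / \<alpha> / t * S" by simp
    have "v n = w (s + int k)" using k by (simp add: w_def s_def)
    then have "cmod (v n) \<le> \<bar>tmat a b l s k $ 1 $ 1\<bar> * cmod (v s) + L ^ P / \<alpha> * S"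
      using est[of k] k norm_triangle_ineq[of "tmat a b l s k $ 1 $ 1 * v s" "w (s + int k) - tmat a b l s k $ 1 $ 1 * v s"]
      by (simp add: norm_mult)
    also have "\<bar>tmat a b l s k $ 1 $ 1\<bar> \<le> L ^ k" using T[of s k] by linarith
    then have "\<bar>tmat a b l s k $ 1 $ 1\<bar> \<le> L ^ P"
      using power_increasing[of k P L] L k by linarith
    then have "\<bar>tmat a b l s k $ 1 $ 1\<bar> * cmod (v s) \<le> L ^ P * (L ^ P / \<alpha> / t * S)"
      using vs LP by (intro mult_mono) auto
    finally have "cmod (v n) \<le> C * S" by (simp add: C_def algebra_simps)
    then show ?thesis by (simp add: S_def g_def)
  qed
  define B where "B = C * (2 * of_int (int P) + 1) + 1"
  have B: "B > 0" using C0 by (simp add: B_def add_nonneg_pos)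
  have "1 / B * norm u \<le> norm (jac a0 b u - l *\<^sub>R u)" for u
  proof -
    have "norm u \<le> C * (2 * of_int (int P) + 1) * norm (jac a0 b u - l *\<^sub>R u)"
      by (rule norm_sum_shifts_bound[OF C0])
         (use main[of "coord u"] in \<open>auto simp: J0.coord_jac scaleR_conv_of_real\<close>)
    then have "norm u \<le> B * norm (jac a0 b u - l *\<^sub>R u)"
      unfolding B_def distrib_right by (simp add: add_increasing2)
    then show ?thesis using B by (simp add: field_simps)
  qed
  then show ?thesis
    using B bdd_below_opI[of "1 / B" "\<lambda>u. jac a0 b u - l *\<^sub>R u"] by (simp add: asp_def)
qed

lemma box_asp_finite:
  fixes P :: nat and c :: int
  defines "a0 \<equiv> (\<lambda>n. if int P dvd n - c then 0 else a n)"
  assumes P: "P > 0" and per: "\<And>n. a (n + int P) = a n" "\<And>n. b (n + int P) = b n"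
  shows "finite (asp (jac a0 b)) \<and> card (asp (jac a0 b)) \<le> P"
proof -
  obtain P11 P12 P21 P22 :: "real poly" where Q:
    "\<And>E. tmat a b E (c + 1) P = mat2 (poly P11 E) (poly P12 E) (poly P21 E) (poly P22 E)"
    "degree P11 = P" "P11 \<noteq> 0"
    using tmat_poly[of a b "c + 1" P] a_nz by blast
  have "asp (jac a0 b) \<subseteq> {E. poly P11 E = 0}"
    using box_not_asp[OF P per, of _ c] Q(1) unfolding a0_def by auto
  moreover have "finite {E. poly P11 E = 0}" by (rule poly_roots_finite[OF Q(3)])
  moreover have "card {E. poly P11 E = 0} \<le> P" using card_poly_roots_bound[OF Q(3)] Q(2) by simp
  ultimately show ?thesis using card_mono finite_subset order_trans by metis
qed

end

section \<open>Exponential localisation near the cuts\<close>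

lemma exp_difference_bound:
  fixes \<gamma> :: real
  assumes "\<bar>x - y\<bar> \<le> \<gamma>"
  shows "\<bar>exp (- x) - exp (- y)\<bar> \<le> (exp \<gamma> - 1) * exp (- y)"
proof -
  have "exp (- x) - exp (- y) = exp (- y) * (exp (y - x) - 1)"
    by (simp add: exp_diff exp_minus field_simps)
  moreover have "\<bar>exp (y - x) - 1\<bar> \<le> exp \<gamma> - 1"
  proof -
    have "exp (y - x) \<le> exp \<gamma>" "exp (- \<gamma>) \<le> exp (y - x)" using assms by auto
    moreover have "exp \<gamma> + exp (- \<gamma>) \<ge> 2"
      using exp_ge_add_one_self[of \<gamma>] exp_ge_add_one_self[of "-\<gamma>"] by linarith
    ultimately show ?thesis by linarith
  qed
  ultimately show ?thesis by (simp add: abs_mult mult.commute mult_left_mono)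
qed

text \<open>If V has a gap at E and b agrees with V wherever D < R, then
  the weight exp (- \<gamma> D) - exp (- \<gamma> R) shows that approximate eigenvectors of b at E are
  exponentially small near the zeros of D, so that the bonds there may be cut.\<close>
lemma decoupled_near:
  fixes D :: "int \<Rightarrow> int"
  assumes bd: "bounded (range a)" "bounded (range b)" "bounded (range V)"
    and A: "A > 0" "\<And>n. \<bar>a n\<bar> \<le> A"
    and d0: "d0 > 0" "\<And>u. d0 * norm u \<le> norm (jac a V u - E *\<^sub>R u)"
    and D: "\<And>n. 0 \<le> D n" "\<And>n. \<bar>D (n + 1) - D n\<bar> \<le> 1" "\<And>n. D n < R \<Longrightarrow> b n = V n"
    and a0: "\<And>n. a0 n = (if D n = 0 then 0 else a n)"
    and \<gamma>: "\<gamma> = ln (1 + d0 / (4 * A))"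
    and R: "exp (- \<gamma> * of_int R) \<le> exp (- \<gamma>) / 2" "R \<ge> 0"
    and E: "E \<in> asp (jac a b)"
  obtains l where "l \<in> asp (jac a0 b)" "\<bar>l - E\<bar> \<le> (4 * A * exp \<gamma> + 1) * exp (- \<gamma> * of_int R)"
proof -
  interpret J: bounded_jacobi a b using bd by (intro bounded_jacobi.intro)
  interpret JV: bounded_jacobi a V using bd by (intro bounded_jacobi.intro)
  have bd0: "bounded (range a0)"
    unfolding bounded_iff using A by (intro exI[of _ A]) (auto simp: a0)
  interpret J0: bounded_jacobi a0 b using bd bd0 by (intro bounded_jacobi.intro)
  have g0: "\<gamma> > 0" using d0(1) A(1) unfolding \<gamma> by (intro ln_gt_zero) simp
  \<comment> \<open>The rate \<gamma> is such that A (exp \<gamma> - 1) = d0 / 4: the commutator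
    terms with the two neighbours then cost d0 / 2, half of the gap, and can be absorbed.\<close>
  have eg: "exp \<gamma> = 1 + d0 / (4 * A)" using d0(1) A(1) by (simp add: \<gamma> add_pos_pos)
  define \<epsilon> where "\<epsilon> = exp (- \<gamma> * of_int R)"
  define F where "F n = exp (- (\<gamma> * of_int (D n)))" for n
  \<comment> \<open>Subtracting \<epsilon> makes the weight vanish where D >= R, so that only sites
    with b = V are seen; the price is an error \<epsilon> |u|.\<close>
  define \<phi> where "\<phi> n = max (F n - \<epsilon>) 0" for n
  have e0: "\<epsilon> > 0" "\<epsilon> \<le> 1" using R(2) g0 by (auto simp: \<epsilon>_def)
  have F1: "F n \<le> 1" for n using D(1)[of n] g0 by (simp add: F_def)
  have \<phi>01: "0 \<le> \<phi> n" "\<phi> n \<le> 1" for n using F1[of n] e0 by (auto simp: \<phi>_def)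
  have F\<phi>: "F n \<le> \<phi> n + \<epsilon>" for n by (simp add: \<phi>_def)
  have \<phi>V: "\<phi> n = 0 \<or> b n = V n" for n
  proof (cases "D n < R")
    case False
    then have "F n \<le> \<epsilon>" using g0 by (simp add: F_def \<epsilon>_def)
    then show ?thesis by (simp add: \<phi>_def)
  qed (use D(3) in simp)
  have \<phi>d: "\<bar>\<phi> m - \<phi> n\<bar> \<le> (exp \<gamma> - 1) * (\<phi> n + \<epsilon>)" if "\<bar>D m - D n\<bar> \<le> 1" for m n
  proof -
    have "\<bar>of_int (D m) - of_int (D n)\<bar> \<le> (1::real)" using that by linarith
    then have "\<gamma> * \<bar>of_int (D m) - of_int (D n)\<bar> \<le> \<gamma>" using g0 by simp
    then have "\<bar>\<gamma> * of_int (D m) - \<gamma> * of_int (D n)\<bar> \<le> \<gamma>"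
      using g0 by (simp add: abs_mult flip: right_diff_distrib)
    then have "\<bar>F m - F n\<bar> \<le> (exp \<gamma> - 1) * F n" unfolding F_def by (rule exp_difference_bound)
    also have "\<dots> \<le> (exp \<gamma> - 1) * (\<phi> n + \<epsilon>)" using g0 by (intro mult_left_mono F\<phi>) simp
    finally show ?thesis unfolding \<phi>_def by linarith
  qed
  have bf: "bounded (range (\<lambda>n. complex_of_real (\<phi> n)))"
    unfolding bounded_iff using \<phi>01 by (intro exI[of _ 1]) auto
  have be: "bounded (range (\<lambda>n. complex_of_real (\<phi> n + \<epsilon>)))"
    unfolding bounded_iff using \<phi>01 e0
  proof (intro exI[of _ 2] ballI, elim imageE, hypsubst)
    show "cmod (complex_of_real (\<phi> n + \<epsilon>)) \<le> 2" for n
      unfolding norm_of_real using \<phi>01[of n] e0 by linarith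
  qed
  have small: "norm (mulop (\<lambda>n. complex_of_real (\<phi> n)) u) \<le> 2 / d0 * norm (jac a b u - E *\<^sub>R u) + \<epsilon> * norm u" for u
  proof -
    define g where "g = jac a b u - E *\<^sub>R u"
    define w where "w = mulop (\<lambda>n. complex_of_real (\<phi> n)) u"
    define x where "x = mulop (\<lambda>n. complex_of_real (\<phi> n + \<epsilon>)) u"
    have cw: "coord w n = \<phi> n * coord u n" for n using bf by (simp add: w_def)
    have cx: "coord x n = complex_of_real (\<phi> n + \<epsilon>) * coord u n" for n using be by (simp add: x_def)
    have "x = w + \<epsilon> *\<^sub>R u" by (rule ell2_eqI) (simp add: cw cx scaleR_conv_of_real algebra_simps)
    then have nx: "norm x \<le> norm w + \<epsilon> * norm u" using norm_triangle_ineq[of w "\<epsilon> *\<^sub>R u"] e0 by simp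
    define h1 where "h1 = Abs_ell2 (\<lambda>n. complex_of_real (a n * (\<phi> (n + 1) - \<phi> n)) * coord u (n + 1))"
    define h2 where "h2 = Abs_ell2 (\<lambda>n. complex_of_real (a (n - 1) * (\<phi> (n - 1) - \<phi> n)) * coord u (n - 1))"
    define q where "q = A * (exp \<gamma> - 1)"
    have q: "q = d0 / 4" using A(1) by (simp add: q_def eg)
    have bound: "cmod (complex_of_real (a k * (\<phi> m - \<phi> n)) * coord u m) \<le> q * cmod (coord x m)"
      if mn: "\<bar>D n - D m\<bar> \<le> 1" for k m n
    proof -
      have "\<bar>a k\<bar> * \<bar>\<phi> m - \<phi> n\<bar> \<le> A * ((exp \<gamma> - 1) * (\<phi> m + \<epsilon>))"
        using \<phi>d[OF mn] A by (intro mult_mono) (auto simp: abs_minus_commute)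
      then have "\<bar>a k\<bar> * \<bar>\<phi> m - \<phi> n\<bar> * cmod (coord u m) \<le> A * ((exp \<gamma> - 1) * (\<phi> m + \<epsilon>)) * cmod (coord u m)"
        by (rule mult_right_mono) simp
      moreover have "cmod (coord x m) = (\<phi> m + \<epsilon>) * cmod (coord u m)"
        using \<phi>01(1)[of m] e0 unfolding cx norm_mult norm_of_real by simp
      ultimately show ?thesis by (simp only: norm_mult norm_of_real abs_mult q_def mult.assoc)
    qed
    have b1: "cmod (complex_of_real (a n * (\<phi> (n + 1) - \<phi> n)) * coord u (n + 1)) \<le> q * cmod (coord (shiftop 1 x) n)" for n
      using bound[of n "n + 1" n] D(2)[of n] by simp
    have b2: "cmod (complex_of_real (a (n - 1) * (\<phi> (n - 1) - \<phi> n)) * coord u (n - 1)) \<le> q * cmod (coord (shiftop (-1) x) n)" for n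
      using bound[of n "n - 1" "n - 1"] D(2)[of "n - 1"] by simp
    have c1: "coord h1 n = complex_of_real (a n * (\<phi> (n + 1) - \<phi> n)) * coord u (n + 1)" for n
      unfolding h1_def by (subst coord_Abs, rule l2Z_dominated[OF coord_l2Z b1], rule refl)
    have c2: "coord h2 n = complex_of_real (a (n - 1) * (\<phi> (n - 1) - \<phi> n)) * coord u (n - 1)" for n
      unfolding h2_def by (subst coord_Abs, rule l2Z_dominated[OF coord_l2Z b2], rule refl)
    have q0: "0 \<le> q" using q d0(1) by simp
    have n1: "norm h1 \<le> q * norm x"
      using norm_ell2_dominated[of h1 q "shiftop 1 x"] b1 q0 by (simp add: c1)
    have n2: "norm h2 \<le> q * norm x"
      using norm_ell2_dominated[of h2 q "shiftop (-1) x"] b2 q0 by (simp add: c2)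
    \<comment> \<open>The weight is moved past J: on its support b may be replaced by V, and h1, h2
      are the commutator terms.\<close>
    have "jac a V w - E *\<^sub>R w = mulop (\<lambda>n. complex_of_real (\<phi> n)) g + (h1 + h2)"
    proof (rule ell2_eqI)
      fix n
      have "complex_of_real (V n) * \<phi> n = complex_of_real (b n) * \<phi> n" using \<phi>V[of n] by auto
      then have Vw: "complex_of_real (V n) * (\<phi> n * coord u n) = complex_of_real (b n) * (\<phi> n * coord u n)"
        by (metis mult.assoc)
      show "coord (jac a V w - E *\<^sub>R w) n = coord (mulop (\<lambda>n. complex_of_real (\<phi> n)) g + (h1 + h2)) n"
        using bf Vw by (simp add: JV.coord_jac J.coord_jac jacobi_def g_def cw c1 c2 scaleR_conv_of_real algebra_simps)
    qed
    then have "norm (jac a V w - E *\<^sub>R w) \<le> norm (mulop (\<lambda>n. complex_of_real (\<phi> n)) g) + (norm h1 + norm h2)"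
      by (metis norm_triangle_le norm_triangle_ineq add_left_mono order_refl)
    also have "norm (mulop (\<lambda>n. complex_of_real (\<phi> n)) g) \<le> 1 * norm g"
      using \<phi>01 by (intro norm_mulop_le) auto
    finally have "d0 * norm w \<le> norm g + 2 * (q * norm x)"
      using d0(2)[of w] n1 n2 by linarith
    also have "\<dots> \<le> norm g + d0 / 2 * (norm w + \<epsilon> * norm u)"
      using mult_left_mono[OF nx, of "d0 / 2"] d0(1) by (simp add: q)
    finally have "d0 / 2 * norm w \<le> norm g + d0 / 2 * (\<epsilon> * norm u)" by (simp add: algebra_simps)
    then show ?thesis using d0(1) by (simp add: w_def g_def field_simps)
  qed
  have cut: "norm (jac a0 b u - jac a b u) \<le> 4 * A * exp \<gamma> * norm (mulop (\<lambda>n. complex_of_real (\<phi> n)) u)" for u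
  proof -
    define w where "w = mulop (\<lambda>n. complex_of_real (\<phi> n)) u"
    have cw: "coord w n = \<phi> n * coord u n" for n using bf by (simp add: w_def)
    define s where "s = 2 * A * exp \<gamma>"
    have s: "s \<ge> 0" using A(1) by (simp add: s_def)
    \<comment> \<open>Both ends of a cut bond have D <= 1, where the assumption on R gives \<phi> >=
      exp (- \<gamma>) / 2; there u is controlled by w = \<phi> u.\<close>
    have key: "cmod (coord u n) * A \<le> s * cmod (coord w n)" if "D n \<le> 1" for n
    proof -
      have "\<gamma> * of_int (D n) \<le> \<gamma>" using that g0 by simp
      then have "exp (- \<gamma>) \<le> F n" by (simp add: F_def)
      then have "exp (- \<gamma>) / 2 \<le> \<phi> n" using R(1) unfolding \<phi>_def \<epsilon>_def by linarith
      then have "1 \<le> 2 * exp \<gamma> * \<phi> n" by (simp add: exp_minus field_simps)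
      then have "A * cmod (coord u n) * 1 \<le> A * cmod (coord u n) * (2 * exp \<gamma> * \<phi> n)"
        using A(1) by (intro mult_left_mono) auto
      then show ?thesis using \<phi>01(1)[of n] by (simp add: s_def cw norm_mult mult_ac)
    qed
    define h1 where "h1 n = (if D n = 0 then - complex_of_real (a n) * coord u (n + 1) else 0)" for n
    define h2 where "h2 n = (if D (n - 1) = 0 then - complex_of_real (a (n - 1)) * coord u (n - 1) else 0)" for n
    have b1: "cmod (h1 n) \<le> s * cmod (coord (shiftop 1 w) n)" for n
    proof (cases "D n = 0")
      case True
      then have "D (n + 1) \<le> 1" using D(2)[of n] by simp
      have "\<bar>a n\<bar> * cmod (coord u (n + 1)) \<le> A * cmod (coord u (n + 1))"
        using A(2) by (intro mult_right_mono) auto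
      then show ?thesis using key[OF \<open>D (n + 1) \<le> 1\<close>] True by (simp add: h1_def norm_mult mult.commute)
    qed (use s in \<open>simp add: h1_def\<close>)
    have b2: "cmod (h2 n) \<le> s * cmod (coord (shiftop (-1) w) n)" for n
    proof (cases "D (n - 1) = 0")
      case True
      have "\<bar>a (n - 1)\<bar> * cmod (coord u (n - 1)) \<le> A * cmod (coord u (n - 1))"
        using A(2) by (intro mult_right_mono) auto
      then show ?thesis using key[of "n - 1"] True by (simp add: h2_def norm_mult mult.commute)
    qed (use s in \<open>simp add: h2_def\<close>)
    have c1: "coord (Abs_ell2 h1) n = h1 n" for n
      by (subst coord_Abs, rule l2Z_dominated[OF coord_l2Z b1], rule refl)
    have c2: "coord (Abs_ell2 h2) n = h2 n" for n
      by (subst coord_Abs, rule l2Z_dominated[OF coord_l2Z b2], rule refl)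
    have n1: "norm (Abs_ell2 h1) \<le> s * norm w"
      using norm_ell2_dominated[of "Abs_ell2 h1" s "shiftop 1 w"] b1 s by (simp add: c1)
    have n2: "norm (Abs_ell2 h2) \<le> s * norm w"
      using norm_ell2_dominated[of "Abs_ell2 h2" s "shiftop (-1) w"] b2 s by (simp add: c2)
    have eqh: "jac a0 b u - jac a b u = Abs_ell2 h1 + Abs_ell2 h2"
      by (rule ell2_eqI) (simp add: J0.coord_jac J.coord_jac jacobi_def c1 c2 h1_def h2_def a0)
    have "norm (jac a0 b u - jac a b u) \<le> s * norm w + s * norm w"
      unfolding eqh using n1 n2 norm_triangle_ineq[of "Abs_ell2 h1" "Abs_ell2 h2"] by linarith
    then show ?thesis by (simp add: s_def w_def)
  qed
  define Q where "Q = 4 * A * exp \<gamma>"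
  have Q: "Q > 0" using A(1) by (simp add: Q_def)
  \<comment> \<open>With a defect below \<eta> |u|, all terms that stem from (J - E) u add up to at
    most \<epsilon> |u|.\<close>
  define \<eta> where "\<eta> = \<epsilon> / (1 + Q * 2 / d0)"
  have den: "1 + Q * 2 / d0 > 0" using Q d0(1) by (simp add: add_pos_pos)
  then have "\<eta> > 0" using e0 by (simp add: \<eta>_def)
  then obtain u where u: "norm (jac a b u - E *\<^sub>R u) < \<eta> * norm u"
    using E by (auto simp: asp_def bdd_below_op_def not_le)
  have "u \<noteq> 0" using u by auto
  define z where "z = norm (jac a b u - E *\<^sub>R u)"
  have "norm (jac a0 b u - E *\<^sub>R u) \<le> norm (jac a0 b u - jac a b u) + z"
    using norm_triangle_ineq[of "jac a0 b u - jac a b u" "jac a b u - E *\<^sub>R u"] by (simp add: z_def)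
  moreover have "norm (jac a0 b u - jac a b u) \<le> Q * (2 / d0 * z + \<epsilon> * norm u)"
    using cut[of u] mult_left_mono[OF small[of u], of Q] Q unfolding Q_def[symmetric] z_def by linarith
  moreover have "Q * (2 / d0 * z + \<epsilon> * norm u) + z = (1 + Q * 2 / d0) * z + Q * \<epsilon> * norm u"
    by (simp add: algebra_simps)
  moreover have "(1 + Q * 2 / d0) * z \<le> (1 + Q * 2 / d0) * (\<eta> * norm u)"
    using u den unfolding z_def by (intro mult_left_mono) auto
  moreover have "(1 + Q * 2 / d0) * (\<eta> * norm u) = \<epsilon> * norm u" using den by (simp add: \<eta>_def)
  moreover have "\<epsilon> * norm u + Q * \<epsilon> * norm u = (Q + 1) * \<epsilon> * norm u" by (simp add: algebra_simps)
  ultimately have "norm (jac a0 b u - E *\<^sub>R u) \<le> (Q + 1) * \<epsilon> * norm u" by linarith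
  then show ?thesis
    using J0.asp_near[OF \<open>u \<noteq> 0\<close>, of E "(Q + 1) * \<epsilon>"] that unfolding Q_def \<epsilon>_def by blast
qed

lemma (in bounded_jacobi) norm_jac_le:
  assumes "\<And>n. \<bar>a n\<bar> \<le> A" "\<And>n. \<bar>b n\<bar> \<le> B"
  shows "norm (jac a b u) \<le> (2 * A + B) * norm u"
proof -
  have "norm (jac a b u) \<le> norm (shiftop (-1) (mulop (\<lambda>n. complex_of_real (a n)) u))
     + norm (mulop (\<lambda>n. complex_of_real (b n)) u) + norm (mulop (\<lambda>n. complex_of_real (a n)) (shiftop 1 u))"
    unfolding jac_def by (intro norm_triangle_le add_mono norm_triangle_ineq order_refl)
  moreover have "norm (mulop (\<lambda>n. complex_of_real (a n)) v) \<le> A * norm v" for v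
    using assms by (intro norm_mulop_le) simp
  from this[of u] this[of "shiftop 1 u"]
  have "norm (mulop (\<lambda>n. complex_of_real (a n)) u) \<le> A * norm u"
    "norm (mulop (\<lambda>n. complex_of_real (a n)) (shiftop 1 u)) \<le> A * norm u" by simp_all
  moreover have "norm (mulop (\<lambda>n. complex_of_real (b n)) u) \<le> B * norm u"
    using assms by (intro norm_mulop_le) simp
  ultimately show ?thesis
    unfolding norm_shiftop distrib_right mult_2 by linarith
qed

section \<open>Concatenation of blocks and covers of the spectrum\<close>

definition covered :: "real set \<Rightarrow> nat \<Rightarrow> real \<Rightarrow> bool" where
  "covered S M r \<longleftrightarrow> (\<exists>C. finite C \<and> card C \<le> M \<and> S \<subseteq> (\<Union>c\<in>C. cball c r))"

text \<open>For P > 0 this is the distance from n to the set c + P Z of cut sites; it plays the role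
  of D in \<open>decoupled_near\<close>.\<close>

definition circle_dist :: "nat \<Rightarrow> int \<Rightarrow> int \<Rightarrow> int" where
  "circle_dist P c n = min ((n - c) mod int P) (int P - (n - c) mod int P)"

lemma circle_dist:
  assumes "P > 0"
  shows "0 \<le> circle_dist P c n" "\<bar>circle_dist P c (n + 1) - circle_dist P c n\<bar> \<le> 1"
    "circle_dist P c n = 0 \<longleftrightarrow> int P dvd n - c"
proof -
  define r where "r = (n - c) mod int P"
  have r: "0 \<le> r" "r < int P" using assms by (auto simp: r_def)
  show "0 \<le> circle_dist P c n" using r by (simp add: circle_dist_def r_def)
  have "(n + 1 - c) mod int P = (r + 1) mod int P"
    unfolding r_def by (metis add.commute add_diff_eq mod_add_right_eq)
  also have "\<dots> = (if r + 1 = int P then 0 else r + 1)" using r by auto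
  finally have r': "(n + 1 - c) mod int P = (if r + 1 = int P then 0 else r + 1)" .
  show "\<bar>circle_dist P c (n + 1) - circle_dist P c n\<bar> \<le> 1"
    unfolding circle_dist_def r' r_def[symmetric] using r by auto
  show "circle_dist P c n = 0 \<longleftrightarrow> int P dvd n - c"
    using r unfolding circle_dist_def r_def[symmetric] by (auto simp: dvd_eq_mod_eq_0 r_def[symmetric])
qed

lemma block_index:
  fixes m l j :: nat and n k s :: int
  assumes n: "n = int (m * l) * k + int (j * l) + s" and s: "0 \<le> s" "s < int l" and j: "j < m"
  shows "nat ((n mod int (m * l)) div int l) = j"
proof -
  have "Suc j * l \<le> m * l" using j by (intro mult_right_mono) auto
  then have "int (j * l) + int l \<le> int (m * l)" by (simp flip: of_nat_add of_nat_mult)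
  then have "int (j * l) + s < int (m * l)" using s by linarith
  moreover have "0 \<le> int (j * l) + s" using s by simp
  ultimately have "(int (j * l) + s) mod int (m * l) = int (j * l) + s"
    by (intro mod_pos_pos_trivial)
  moreover have "n mod int (m * l) = (int (j * l) + s) mod int (m * l)"
    unfolding n by (simp add: add.assoc)
  moreover have "(int (j * l) + s) div int l = int j"
    using s by (simp add: div_pos_pos_trivial)
  ultimately show ?thesis by simp
qed

context positive_jacobi
begin

text \<open>A lower bound c at E leaves c / 2 within distance c / 2 of E, so by compactness finitely
  many potentials take care of [-K, K]; the product of their periods is a common one.\<close>

lemma finite_gap_family:
  assumes p: "p > 0" and per: "\<And>n. a (n + int p) = a n" "\<And>n. b (n + int p) = b n"
    and d: "d > 0"
  obtains q m :: nat and V :: "nat \<Rightarrow> int \<Rightarrow> real" and d0 :: real where "q > 0" "p dvd q" "m > 0" "d0 > 0"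
    "\<And>j n. j < m \<Longrightarrow> V j (n + int q) = V j n"
    "\<And>j n. j < m \<Longrightarrow> \<bar>V j n - b n\<bar> \<le> d"
    "\<And>E. \<bar>E\<bar> \<le> K \<Longrightarrow> \<exists>j<m. \<forall>u. d0 * norm u \<le> norm (jac a (V j) u - E *\<^sub>R u)"
proof -
  have "\<forall>E. \<exists>P W c. P > 0 \<and> p dvd P \<and> (\<forall>n. W (n + int P) = W n) \<and> (\<forall>n. \<bar>W n - b n\<bar> \<le> d) \<and>
     c > 0 \<and> (\<forall>u. c * norm u \<le> norm (jac a W u - E *\<^sub>R u))"
  proof
    fix E
    from open_gap[OF p per d, of E] obtain P W where "P > 0" "p dvd P" "\<forall>n. W (n + int P) = W n"
      "\<forall>n. \<bar>W n - b n\<bar> \<le> d" "E \<notin> asp (jac a W)" by blast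
    then show "\<exists>P W c. P > 0 \<and> p dvd P \<and> (\<forall>n. W (n + int P) = W n) \<and> (\<forall>n. \<bar>W n - b n\<bar> \<le> d) \<and>
     c > 0 \<and> (\<forall>u. c * norm u \<le> norm (jac a W u - E *\<^sub>R u))"
      unfolding asp_def bdd_below_op_def by blast
  qed
  then obtain P W c where PW: "\<And>E. P E > (0::nat)" "\<And>E. p dvd P E" "\<And>E n. W E (n + int (P E)) = W E n"
     "\<And>E n. \<bar>W E n - b n\<bar> \<le> d" "\<And>E. c E > 0" "\<And>E u. c E * norm u \<le> norm (jac a (W E) u - E *\<^sub>R u)"
    by metis
  obtain F where F: "F \<subseteq> {-K..K}" "finite F" "{-K..K} \<subseteq> (\<Union>E\<in>F. ball E (c E / 2))"
  proof (rule compactE_image[of "{-K..K}" "{-K..K}" "\<lambda>E. ball E (c E / 2)"])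
    show "{-K..K} \<subseteq> (\<Union>E\<in>{-K..K}. ball E (c E / 2))" using PW(5) by force
  qed auto
  \<comment> \<open>The extra energy 0 keeps the family nonempty even when K < 0.\<close>
  define F' where "F' = insert 0 F"
  have F': "finite F'" "F' \<noteq> {}" using F(2) by (auto simp: F'_def)
  obtain es where es: "set es = F'" using finite_list[OF F'(1)] by blast
  define q where "q = (\<Prod>E\<in>F'. P E)"
  define d0 where "d0 = Min (c ` F') / 2"
  have "Min (c ` F') \<in> c ` F'" using F' by (intro Min_in) auto
  then have d0: "d0 > 0" using PW(5) by (auto simp: d0_def)
  have d0le: "d0 \<le> c E / 2" if "E \<in> F'" for E using F'(1) that by (simp add: d0_def)
  have dv: "P E dvd q" if "E \<in> F'" for E using F'(1) that unfolding q_def by (rule dvd_prodI)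
  show ?thesis
  proof (rule that[of q "length es" d0 "\<lambda>j. W (es ! j)"])
    show "q > 0" using PW(1) by (simp add: q_def prod_pos)
    show "p dvd q" using dv[of 0] PW(2)[of 0] dvd_trans by (auto simp: F'_def)
    show "length es > 0" using es F'(2) by auto
    show "d0 > 0" by (rule d0)
    show "W (es ! j) (n + int q) = W (es ! j) n" if "j < length es" for j n
      using that es by (intro periodic_dvd[where f = "W (es ! j)" and p = "P (es ! j)", OF PW(3)] dv) auto
    show "\<bar>W (es ! j) n - b n\<bar> \<le> d" for j n by (rule PW(4))
    show "\<exists>j<length es. \<forall>u. d0 * norm u \<le> norm (jac a (W (es ! j)) u - E *\<^sub>R u)" if E: "\<bar>E\<bar> \<le> K" for E
    proof -
      have "E \<in> {-K..K}" using E by auto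
      then obtain E' where E': "E' \<in> F" "dist E' E < c E' / 2" using F(3) by auto
      then obtain j where j: "j < length es" "es ! j = E'"
        using es by (metis F'_def in_set_conv_nth insertCI)
      have "d0 * norm u \<le> norm (jac a (W E') u - E *\<^sub>R u)" for u
      proof -
        have "norm (jac a (W E') u - E' *\<^sub>R u) \<le> norm (jac a (W E') u - E *\<^sub>R u) + norm ((E - E') *\<^sub>R u)"
          using norm_triangle_ineq[of "jac a (W E') u - E *\<^sub>R u" "(E - E') *\<^sub>R u"] by (simp add: algebra_simps)
        moreover have "\<bar>E - E'\<bar> * norm u \<le> c E' / 2 * norm u"
          using E'(2) by (intro mult_right_mono) (auto simp: dist_real_def abs_minus_commute)
        moreover have "d0 * norm u \<le> c E' / 2 * norm u"
          using d0le[of E'] E'(1) by (intro mult_right_mono) (auto simp: F'_def)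
        ultimately show ?thesis using PW(6)[of E' u] by simp
      qed
      then show ?thesis using j by blast
    qed
  qed
qed

text \<open>With m, q and the decay rate fixed, only N varies: ln M grows like ln N, whereas ln (1 /
  r) grows like N. The bounds are stated for 3 r because a cover of radius r widens to 3 r when W is
  perturbed.\<close>

lemma thin_spectrum:
  assumes p: "p > 0" and per: "\<And>n. a (n + int p) = a n" "\<And>n. b (n + int p) = b n"
    and d: "d > 0" and e: "e > 0"
  obtains P W M r where "P > 0" "p dvd P" "\<And>n. W (n + int P) = W n" "\<And>n. \<bar>W n - b n\<bar> \<le> d"
    "M > 0" "r > 0" "3 * r < e" "ln (real M) \<le> e * ln (1 / (3 * r))" "covered (asp (jac a W)) M r"
proof -
  obtain A B where A: "\<And>n. \<bar>a n\<bar> \<le> A" and B: "\<And>n. \<bar>b n\<bar> \<le> B"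
    using a_bounded b_bounded by (auto simp: bounded_iff)
  have "A > 0" using a_pos[of 0] A[of 0] by linarith
  note A = this A
  \<comment> \<open>A norm bound valid for every potential within d of b, so that [-K, K] contains
    the spectrum of W before W is known.\<close>
  define K where "K = 2 * A + (B + d)"
  obtain q m :: nat and V :: "nat \<Rightarrow> int \<Rightarrow> real" and d0 :: real where q: "q > 0" "p dvd q" and m: "m > 0" and d0: "d0 > 0"
    and V: "\<And>j n. j < m \<Longrightarrow> V j (n + int q) = V j n" "\<And>j n. j < m \<Longrightarrow> \<bar>V j n - b n\<bar> \<le> d"
    and gap: "\<And>E. \<bar>E\<bar> \<le> K \<Longrightarrow> \<exists>j<m. \<forall>u. d0 * norm u \<le> norm (jac a (V j) u - E *\<^sub>R u)"
    by (rule finite_gap_family[OF p per d, of K]) (rule that)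
  define \<gamma> where "\<gamma> = ln (1 + d0 / (4 * A))"
  have g0: "\<gamma> > 0" using d0 A(1) unfolding \<gamma>_def by (intro ln_gt_zero) simp
  define Q where "Q = 4 * A * exp \<gamma> + 1"
  have Q: "Q > 0" using A(1) by (simp add: Q_def add_pos_pos)
  define k where "k = \<gamma> * real q"
  have k: "k > 0" using g0 q by (simp add: k_def)
  define c2 where "c2 = real (2 * m * m * q)"
  have c2: "c2 > 0" using m q by (simp add: c2_def)
  have ek: "e * k > 0" using e k by simp
  \<comment> \<open>The conditions on N give, in turn, the smallness assumed in
    \<open>decoupled_near\<close>, the bound 3 r < e, and the bound on ln M.\<close>
  have "filterlim (\<lambda>N::nat. k * real N) at_top at_top" using k by real_asymp
  then have ev1: "\<forall>\<^sub>F N::nat in at_top. k * real N > \<gamma> + ln 2"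
    and ev2: "\<forall>\<^sub>F N::nat in at_top. k * real N > ln (3 * Q / e)"
    by (simp_all add: filterlim_at_top_dense)
  have "filterlim (\<lambda>N::nat. (e * k) * real N - ln (real N)) at_top at_top" using ek by real_asymp
  then have ev3: "\<forall>\<^sub>F N::nat in at_top. (e * k) * real N - ln (real N) > e * ln (3 * Q) + ln c2"
    by (simp add: filterlim_at_top_dense)
  obtain N :: nat where N: "N > 0" "k * real N > \<gamma> + ln 2" "k * real N > ln (3 * Q / e)"
    "(e * k) * real N - ln (real N) > e * ln (3 * Q) + ln c2"
    using eventually_happens[OF eventually_conj[OF eventually_gt_at_top[of 0] eventually_conj[OF ev1 eventually_conj[OF ev2 ev3]]]]
    by auto
  \<comment> \<open>The factor 2 puts the centre of each block at distance N q from both of its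
    ends.\<close>
  define l where "l = 2 * (N * q)"
  define P where "P = m * l"
  define W where "W n = V (nat ((n mod int P) div int l)) n" for n
  have l: "l > 0" using N q by (simp add: l_def)
  have P: "P > 0" using m l by (simp add: P_def)
  have qP: "q dvd P" by (simp add: P_def l_def)
  have idx: "nat ((n mod int P) div int l) < m" for n
  proof -
    have "n mod int P < int P" using P by simp
    then have "n mod int P < int m * int l" by (simp add: P_def)
    moreover have "(n mod int P) div int l * int l \<le> n mod int P"
      using l by (simp flip: minus_mod_eq_div_mult)
    ultimately have "(n mod int P) div int l * int l < int m * int l" by linarith
    then have "(n mod int P) div int l < int m" using l by simp
    then show ?thesis using m by (simp add: nat_less_iff)
  qed
  have Wper: "W (n + int P) = W n" for n
    using periodic_dvd[where f = "V (nat ((n mod int P) div int l))" and p = q, OF V(1)[OF idx] qP]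
    by (simp add: W_def)
  have Wb: "\<bar>W n - b n\<bar> \<le> d" for n unfolding W_def by (rule V(2)[OF idx])
  have WB: "\<bar>W n\<bar> \<le> B + d" for n using Wb[of n] B[of n] by linarith
  have Wbd: "bounded (range W)" unfolding bounded_iff using WB by (intro exI[of _ "B + d"]) auto
  interpret W: positive_jacobi a W \<alpha>
    by (intro positive_jacobi.intro bounded_jacobi.intro positive_jacobi_axioms.intro a_bounded Wbd \<alpha>)
  have aP: "a (n + int P) = a n" for n
    using q(2) qP dvd_trans by (intro periodic_dvd[where f = a and p = p, OF per(1)]) blast
  define r where "r = Q * exp (- k * real N)"
  define c where "c j = int (j * l + N * q)" for j
  define cut where "cut j n = (if int P dvd n - c j then 0 else a n)" for j n
  \<comment> \<open>Which V j has a gap at E depends on E; the cut is then made at the centre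
    \<open>c j\<close> of block j.\<close>
  have near: "\<exists>j<m. \<exists>x\<in>asp (jac (cut j) W). \<bar>x - E\<bar> \<le> r" if E: "E \<in> asp (jac a W)" for E
  proof -
    have "\<bar>E\<bar> \<le> K" unfolding K_def
      by (rule W.asp_bounded_by[OF W.norm_jac_le[OF A(2) WB] E])
    then obtain j where j: "j < m" and gj: "\<And>u. d0 * norm u \<le> norm (jac a (V j) u - E *\<^sub>R u)"
      using gap by blast
    define D where "D = circle_dist P (c j)"
    have agree: "W n = V j n" if "D n < int (N * q)" for n
    proof -
      define x where "x = (n - c j) mod int P"
      define y where "y = (n - c j) div int P"
      have n: "n - c j = int P * y + x" by (simp add: x_def y_def)
      have x: "0 \<le> x" "x < int P" using P by (auto simp: x_def)
      have "\<exists>k s. n = int (m * l) * k + int (j * l) + s \<and> 0 \<le> s \<and> s < int l"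
      \<comment> \<open>Either n lies in the right half of a copy of block j, or in the left half of
        the next copy, hence \<open>y + 1\<close>.\<close>
      proof (cases "x < int (N * q)")
        case True
        then show ?thesis using n x
          by (intro exI[of _ y] exI[of _ "int (N * q) + x"]) (simp add: c_def P_def l_def)
      next
        case False
        then have "int P - x < int (N * q)" using that by (simp add: D_def circle_dist_def x_def[symmetric])
        then show ?thesis using n x
          by (intro exI[of _ "y + 1"] exI[of _ "int (N * q) - (int P - x)"])
             (simp add: c_def P_def l_def algebra_simps)
      qed
      then have "nat ((n mod int P) div int l) = j"
        unfolding P_def using block_index[OF _ _ _ j] by blast
      then show ?thesis by (simp add: W_def)
    qed
    have Vbd: "bounded (range (V j))"
    proof -
      have "\<bar>V j n\<bar> \<le> B + d" for n using V(2)[OF j, of n] B[of n] by linarith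
      then show ?thesis unfolding bounded_iff by (intro exI[of _ "B + d"]) auto
    qed
    have eN: "- \<gamma> * of_int (int (N * q)) = - k * real N" by (simp add: k_def)
    have "exp (- k * real N) \<le> exp (- \<gamma> - ln 2)" using N(2) by simp
    also have "\<dots> = exp (- \<gamma>) / 2" by (simp add: exp_diff)
    finally have small: "exp (- \<gamma> * of_int (int (N * q))) \<le> exp (- \<gamma>) / 2" unfolding eN .
    obtain x where x: "x \<in> asp (jac (cut j) W)" "\<bar>x - E\<bar> \<le> (4 * A * exp \<gamma> + 1) * exp (- \<gamma> * of_int (int (N * q)))"
    proof (rule decoupled_near[OF a_bounded Wbd Vbd A d0 gj, where D = D and R = "int (N * q)" and ?a0.0 = "cut j" and \<gamma> = \<gamma>])
      show "0 \<le> D n" "\<bar>D (n + 1) - D n\<bar> \<le> 1" for n unfolding D_def by (rule circle_dist[OF P])+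
      show "W n = V j n" if "D n < int (N * q)" for n by (rule agree[OF that])
      show "cut j n = (if D n = 0 then 0 else a n)" for n
        using circle_dist(3)[OF P] by (simp add: cut_def D_def)
    qed (use small E \<gamma>_def in auto)
    then show ?thesis using j unfolding eN Q_def[symmetric] r_def by blast
  qed
  \<comment> \<open>Since the suitable cut depends on the energy, the spectra of all m cut operators
    are collected, each with at most P points.\<close>
  define Z where "Z = (\<Union>j<m. asp (jac (cut j) W))"
  have box: "finite (asp (jac (cut j) W))" "card (asp (jac (cut j) W)) \<le> P" for j
    using W.box_asp_finite[OF P aP Wper, of "c j"] unfolding cut_def[abs_def] by auto
  have Zfin: "finite Z" using box by (simp add: Z_def)
  have "card Z \<le> (\<Sum>j<m. card (asp (jac (cut j) W)))" unfolding Z_def by (rule card_UN_le) simp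
  also have "\<dots> \<le> (\<Sum>j<m. P)" by (intro sum_mono box)
  finally have Zc: "card Z \<le> m * P" by simp
  have cov: "covered (asp (jac a W)) (m * P) r"
    unfolding covered_def
  proof (intro exI[of _ Z] conjI Zfin Zc subsetI)
    fix E assume "E \<in> asp (jac a W)"
    from near[OF this] show "E \<in> (\<Union>x\<in>Z. cball x r)" by (auto simp: Z_def dist_real_def)
  qed
  have r0: "r > 0" using Q by (simp add: r_def)
  have "exp (- k * real N) < exp (- ln (3 * Q / e))" using N(3) by simp
  also have "\<dots> = e / (3 * Q)" using Q e by (simp add: exp_minus)
  finally have re: "3 * r < e" using Q by (simp add: r_def field_simps)
  have mP: "real (m * P) = c2 * real N" by (simp add: c2_def P_def l_def mult_ac)
  have "ln (real (m * P)) = ln c2 + ln (real N)"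
    unfolding mP using c2 N(1) by (simp add: ln_mult)
  also have "\<dots> \<le> e * (k * real N - ln (3 * Q))" using N(4) by (simp add: algebra_simps)
  also have "k * real N - ln (3 * Q) = ln (1 / (3 * r))"
  proof -
    have "1 / (3 * r) = exp (k * real N) / (3 * Q)" by (simp add: r_def exp_minus field_simps)
    then show ?thesis using Q by (simp add: ln_div)
  qed
  finally have "ln (real (m * P)) \<le> e * ln (1 / (3 * r))" .
  moreover have "p dvd P" using q(2) qP dvd_trans by blast
  moreover have "m * P > 0" using m P by simp
  ultimately show ?thesis using that[of P W "m * P" r] P Wper Wb r0 re cov by blast
qed

end

section \<open>Absence of eigenvalues\<close>

text \<open>Gordon's criterion; p will be a very good almost-period of b.\<close>
definition gordon :: "(int \<Rightarrow> real) \<Rightarrow> (int \<Rightarrow> real) \<Rightarrow> nat \<Rightarrow> bool" where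
  "gordon a b k \<longleftrightarrow> (\<exists>p::int. p > int k \<and>
     (\<forall>E (u :: int \<Rightarrow> complex). \<bar>E\<bar> \<le> real k \<longrightarrow> (\<forall>n. jacobi a b u n = complex_of_real E * u n) \<longrightarrow>
       cmod (u 0) + cmod (u 1) \<le> 4 * ((cmod (u (- p)) + cmod (u (- p + 1))) +
         (cmod (u p) + cmod (u (p + 1))) + (cmod (u (2 * p)) + cmod (u (2 * p + 1))))))"

text \<open>Serves both as an a priori bound on the sites compared in Gordon's argument and as
  uniqueness: a solution that vanishes at 0 and 1 vanishes everywhere.\<close>

lemma solution_growth:
  fixes u :: "int \<Rightarrow> complex"
  assumes \<alpha>: "\<alpha> > 0" "\<And>n. \<alpha> \<le> a n" and A: "\<And>n. a n \<le> A" and B: "\<And>n. \<bar>b n\<bar> \<le> B" and K: "\<bar>E\<bar> \<le> K"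
    and sol: "\<And>n. jacobi a b u n = complex_of_real E * u n"
    and L: "L = 1 + (K + B + A) / \<alpha>"
  shows "cmod (u n) + cmod (u (n + 1)) \<le> L ^ nat \<bar>n\<bar> * (cmod (u 0) + cmod (u 1))"
proof -
  define X where "X n = cmod (u n) + cmod (u (n + 1))" for n
  have nn: "0 \<le> K" "0 \<le> B" "0 \<le> A" using K B[of 0] \<alpha>(1) \<alpha>(2)[of 0] A[of 0] by linarith+
  have L0: "L \<ge> 0" using nn \<alpha>(1) by (simp add: L)
  have ineq: "\<alpha> * cmod y \<le> (K + B) * cmod x + A * cmod z"
    if eq: "complex_of_real (a j) * y = complex_of_real (E - b i) * x - complex_of_real (a l) * z" for i j l x y z
  proof -
    have "\<alpha> * cmod y \<le> a j * cmod y" by (intro mult_right_mono \<alpha>) simp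
    also have "a j * cmod y = cmod (complex_of_real (a j) * y)"
      using \<alpha>(1) \<alpha>(2)[of j] by (simp add: norm_mult)
    also have "\<dots> \<le> \<bar>E - b i\<bar> * cmod x + \<bar>a l\<bar> * cmod z"
      unfolding eq using norm_triangle_ineq4[of "complex_of_real (E - b i) * x" "complex_of_real (a l) * z"]
      by (simp only: norm_mult norm_of_real)
    also have "\<dots> \<le> (K + B) * cmod x + A * cmod z"
      using K B[of i] A[of l] \<alpha>(1) \<alpha>(2)[of l] by (intro add_mono mult_right_mono) auto
    finally show ?thesis .
  qed
  have fin: "cmod x + cmod y \<le> L * (cmod x + cmod z)"
    if "\<alpha> * cmod y \<le> (K + B) * cmod x + A * cmod z" for x y z
  proof -
    have "\<alpha> * (cmod x + cmod y) \<le> (\<alpha> + K + B) * cmod x + A * cmod z" using that by (simp add: algebra_simps)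
    also have "\<dots> \<le> (\<alpha> + K + B + A) * cmod x + (\<alpha> + K + B + A) * cmod z"
      using nn \<alpha>(1) by (intro add_mono[OF mult_right_mono mult_right_mono]) simp_all
    also have "\<dots> = \<alpha> * (L * (cmod x + cmod z))"
      using \<alpha>(1) by (simp add: L field_simps)
    finally show ?thesis using \<alpha>(1) by simp
  qed
  have up: "X (n + 1) \<le> L * X n" for n
  proof -
    have "complex_of_real (a (n + 1)) * u (n + 2) = complex_of_real (E - b (n + 1)) * u (n + 1) - complex_of_real (a n) * u n"
      using sol[of "n + 1"] by (simp add: jacobi_def algebra_simps)
    from fin[OF ineq[OF this]] show ?thesis by (simp add: X_def add.commute)
  qed
  have down: "X (n - 1) \<le> L * X n" for n
  proof -
    have "complex_of_real (a (n - 1)) * u (n - 1) = complex_of_real (E - b n) * u n - complex_of_real (a n) * u (n + 1)"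
      using sol[of n] by (simp add: jacobi_def algebra_simps)
    from fin[OF ineq[OF this]] show ?thesis by (simp add: X_def add.commute)
  qed
  have pos: "X (int k) \<le> L ^ k * X 0" for k
  proof (induction k)
    case (Suc k)
    have "X (int (Suc k)) \<le> L * X (int k)" using up[of "int k"] by (simp add: add.commute)
    also have "\<dots> \<le> L * (L ^ k * X 0)" by (intro mult_left_mono Suc L0)
    finally show ?case by simp
  qed simp
  have neg: "X (- int k) \<le> L ^ k * X 0" for k
  proof (induction k)
    case (Suc k)
    have eq: "- int (Suc k) = - int k - 1" by simp
    have "X (- int (Suc k)) \<le> L * X (- int k)" unfolding eq by (rule down)
    also have "\<dots> \<le> L * (L ^ k * X 0)" by (intro mult_left_mono Suc L0)
    finally show ?case by simp
  qed simp
  have "X n \<le> L ^ nat \<bar>n\<bar> * X 0"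
    using pos[of "nat n"] neg[of "nat (- n)"] by (cases "n \<ge> 0") (auto simp: abs_if)
  then show ?thesis by (simp add: X_def)
qed

context positive_jacobi
begin

text \<open>The Floquet relation at 0 and at p: if the trace is at least 1 in modulus, the solution
  cannot be small at both p and -p, otherwise not at both p and 2p.\<close>
lemma gordon_near_periodic:
  assumes P: "P > 0" and per: "\<And>n. a (n + int P) = a n" "\<And>n. b (n + int P) = b n"
  shows "\<exists>r>0. \<forall>b'. (\<forall>n. \<bar>b' n - b n\<bar> \<le> r) \<longrightarrow> gordon a b' k"
proof -
  obtain A B where A: "\<And>n. \<bar>a n\<bar> \<le> A" and B: "\<And>n. \<bar>b n\<bar> \<le> B"
    using a_bounded b_bounded by (auto simp: bounded_iff)
  have A': "a n \<le> A" for n using A[of n] by linarith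
  \<comment> \<open>A multiple of the period that exceeds k.\<close>
  define p where "p = P * Suc k"
  have "1 * Suc k \<le> P * Suc k" using P by (intro mult_right_mono) auto
  then have pk: "p > k" by (simp add: p_def)
  have pa: "a (n + int p) = a n" for n
    by (rule periodic_dvd[where f = a and p = P, OF per(1)]) (simp add: p_def)
  have pb: "b (n + int p) = b n" for n
    by (rule periodic_dvd[where f = b and p = P, OF per(2)]) (simp add: p_def)
  obtain C where C: "C \<ge> 0" and fl: "\<And>E n. \<And>u :: int \<Rightarrow> complex. \<bar>E\<bar> \<le> real k \<Longrightarrow>
    cmod (u (n + int p) + u (n - int p) - trace (tmat a b E 0 p) * u n)
      \<le> C * (\<Sum>i\<in>{- int p..int p}. cmod (jacobi a b u (n + i) - E * u (n + i)))"
    using floquet[OF pa pb, of "real k"] by blast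
  define L where "L = 1 + (real k + (B + 1) + A) / \<alpha>"
  have nn: "0 \<le> A" "0 \<le> B" using A[of 0] B[of 0] by linarith+
  have L1: "L \<ge> 1" using nn \<alpha>(1) by (simp add: L_def)
  \<comment> \<open>The Floquet relations at 0, 1, p and p + 1 involve sites from - p to 2 p + 1,
    hence the exponent. With r G <= 1 / 8 each error is at most X0 / 8, so a pair of relations costs
    X0 / 4, which is absorbed.\<close>
  define G where "G = C * (2 * real p + 1) * L ^ (2 * p + 1)"
  have G0: "G \<ge> 0" using C L1 by (simp add: G_def)
  define r where "r = min 1 (1 / (8 * (G + 1)))"
  have r: "r > 0" "r \<le> 1" "r * G \<le> 1 / 8"
  proof -
    show "r > 0" "r \<le> 1" using G0 by (auto simp: r_def)
    have "r * G \<le> 1 / (8 * (G + 1)) * (G + 1)" using G0 by (intro mult_mono) (auto simp: r_def)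
    also have "\<dots> = 1 / 8" using G0 by simp
    finally show "r * G \<le> 1 / 8" .
  qed
  have "gordon a b' k" if b': "\<And>n. \<bar>b' n - b n\<bar> \<le> r" for b'
    unfolding gordon_def
  proof (intro exI[of _ "int p"] conjI allI impI)
    show "int k < int p" using pk by simp
    fix E :: real and u :: "int \<Rightarrow> complex"
    assume E: "\<bar>E\<bar> \<le> real k" and sol0: "\<forall>n. jacobi a b' u n = complex_of_real E * u n"
    then have sol: "jacobi a b' u n = complex_of_real E * u n" for n by simp
    define X0 where "X0 = cmod (u 0) + cmod (u 1)"
    have X0: "X0 \<ge> 0" by (simp add: X0_def)
    have B': "\<bar>b' n\<bar> \<le> B + 1" for n using b'[of n] B[of n] r(2) by linarith
    have gr: "cmod (u j) \<le> L ^ (2 * p + 1) * X0" if "\<bar>j\<bar> \<le> int (2 * p + 1)" for j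
    proof -
      have "cmod (u j) \<le> L ^ nat \<bar>j\<bar> * X0"
        using solution_growth[where u = u and n = j, OF \<alpha> A' B' E sol L_def] norm_ge_zero[of "u (j + 1)"]
        unfolding X0_def by linarith
      also have "\<dots> \<le> L ^ (2 * p + 1) * X0"
        using that L1 X0 by (intro mult_right_mono power_increasing) auto
      finally show ?thesis .
    qed
    define T where "T = trace (tmat a b E 0 p)"
    have fl': "cmod (u (n + int p) + u (n - int p) - T * u n) \<le> X0 / 8"
      if n: "n \<in> {0, 1, int p, int p + 1}" for n
    proof -
      have g: "cmod (jacobi a b u (n + i) - E * u (n + i)) \<le> r * (L ^ (2 * p + 1) * X0)"
        if i: "i \<in> {- int p..int p}" for i
      proof -
        have "jacobi a b u (n + i) - E * u (n + i) = complex_of_real (b (n + i) - b' (n + i)) * u (n + i)"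
          unfolding sol[of "n + i", symmetric] by (simp add: jacobi_def algebra_simps)
        then have "cmod (jacobi a b u (n + i) - E * u (n + i)) = \<bar>b' (n + i) - b (n + i)\<bar> * cmod (u (n + i))"
          by (simp only: norm_mult norm_of_real abs_minus_commute)
        also have "\<dots> \<le> r * (L ^ (2 * p + 1) * X0)"
        proof (intro mult_mono b' gr)
          show "\<bar>n + i\<bar> \<le> int (2 * p + 1)" using n i by auto
        qed (use r in auto)
        finally show ?thesis .
      qed
      have "cmod (u (n + int p) + u (n - int p) - T * u n) \<le> C * (\<Sum>i\<in>{- int p..int p}. cmod (jacobi a b u (n + i) - E * u (n + i)))"
        unfolding T_def by (rule fl[OF E])
      also have "\<dots> \<le> C * (\<Sum>i\<in>{- int p..int p}. r * (L ^ (2 * p + 1) * X0))"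
        by (intro mult_left_mono sum_mono g C)
      also have "\<dots> = (r * G) * X0" by (simp add: G_def algebra_simps)
      also have "\<dots> \<le> 1 / 8 * X0" by (intro mult_right_mono r X0)
      finally show ?thesis by simp
    qed
    have tri: "\<bar>T\<bar> * cmod (u n) \<le> cmod (u (n + int p)) + cmod (u (n - int p)) + X0 / 8"
      "cmod (u (n - int p)) \<le> \<bar>T\<bar> * cmod (u n) + cmod (u (n + int p)) + X0 / 8"
      if n: "n \<in> {0, 1, int p, int p + 1}" for n
    proof -
      define z where "z = u (n + int p) + u (n - int p) - T * u n"
      have z: "cmod z \<le> X0 / 8" unfolding z_def by (rule fl'[OF n])
      have e1: "complex_of_real T * u n = u (n + int p) + u (n - int p) - z" by (simp add: z_def)
      have "cmod (complex_of_real T * u n) \<le> cmod (u (n + int p)) + cmod (u (n - int p)) + cmod z"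
        unfolding e1 using norm_triangle_ineq4[of "u (n + int p) + u (n - int p)" z]
          norm_triangle_ineq[of "u (n + int p)" "u (n - int p)"] by linarith
      then show "\<bar>T\<bar> * cmod (u n) \<le> cmod (u (n + int p)) + cmod (u (n - int p)) + X0 / 8"
        using z by (simp add: norm_mult)
      have e2: "u (n - int p) = complex_of_real T * u n - u (n + int p) + z" by (simp add: z_def)
      have "cmod (u (n - int p)) \<le> cmod (complex_of_real T * u n) + cmod (u (n + int p)) + cmod z"
        unfolding e2 using norm_triangle_ineq[of "complex_of_real T * u n - u (n + int p)" z]
          norm_triangle_ineq4[of "complex_of_real T * u n" "u (n + int p)"] by linarith
      then show "cmod (u (n - int p)) \<le> \<bar>T\<bar> * cmod (u n) + cmod (u (n + int p)) + X0 / 8"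
        using z by (simp add: norm_mult)
    qed
    define Xm where "Xm = cmod (u (- int p)) + cmod (u (- int p + 1))"
    define X1 where "X1 = cmod (u (int p)) + cmod (u (int p + 1))"
    define X2 where "X2 = cmod (u (2 * int p)) + cmod (u (2 * int p + 1))"
    have nnX: "0 \<le> Xm" "0 \<le> X1" "0 \<le> X2" by (simp_all add: Xm_def X1_def X2_def)
    have a1: "\<bar>T\<bar> * X0 \<le> X1 + Xm + X0 / 4"
      using tri(1)[of 0] tri(1)[of 1] by (simp add: X0_def X1_def Xm_def distrib_left add.commute)
    have a2: "X0 \<le> \<bar>T\<bar> * X1 + X2 + X0 / 4"
    proof -
      have i: "int p + int p = 2 * int p" "int p + 1 + int p = 2 * int p + 1" "int p + 1 - int p = 1" by simp_all
      show ?thesis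
        using tri(2)[of "int p"] tri(2)[of "int p + 1"]
        unfolding i by (simp add: X0_def X1_def X2_def distrib_left)
    qed
    have "X0 \<le> 4 * (Xm + X1 + X2)"
    proof (cases "\<bar>T\<bar> \<ge> 1")
      case True
      then have "1 * X0 \<le> \<bar>T\<bar> * X0" using X0 by (intro mult_right_mono)
      then show ?thesis using a1 nnX X0 unfolding distrib_left by linarith
    next
      case False
      then have "\<bar>T\<bar> * X1 \<le> 1 * X1" using nnX by (intro mult_right_mono) auto
      then show ?thesis using a2 nnX X0 unfolding distrib_left by linarith
    qed
    then show "cmod (u 0) + cmod (u 1) \<le> 4 * (cmod (u (- int p)) + cmod (u (- int p + 1)) +
         (cmod (u (int p)) + cmod (u (int p + 1))) + (cmod (u (2 * int p)) + cmod (u (2 * int p + 1))))"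
      by (simp add: X0_def Xm_def X1_def X2_def)
  qed
  then show ?thesis using r(1) by blast
qed

text \<open>A square-summable solution tends to 0 at infinity, while Gordon's inequality bounds its
  values at 0 and 1 by values at arbitrarily distant sites.\<close>

lemma gordon_no_eigenvector:
  assumes g: "\<And>k. gordon a b k" and v: "jac a b v = E *\<^sub>R v"
  shows "v = 0"
proof -
  define u where "u = coord v"
  have sol: "jacobi a b u n = complex_of_real E * u n" for n
    using arg_cong[OF v, of "\<lambda>w. coord w n"] by (simp add: coord_jac u_def scaleR_conv_of_real)
  have dec: "\<exists>M. \<forall>n. \<bar>n\<bar> \<ge> M \<longrightarrow> cmod (u n) < e" if e: "e > 0" for e
  proof -
    have "finite {n. e \<le> cmod (u n)}"
    proof (rule ccontr)
      assume inf: "infinite {n. e \<le> cmod (u n)}"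
      obtain N :: nat where N: "(norm v)\<^sup>2 / e\<^sup>2 < real N" using reals_Archimedean2 by blast
      obtain F where F: "finite F" "card F = N" "F \<subseteq> {n. e \<le> cmod (u n)}"
        using infinite_arbitrarily_large[OF inf] by blast
      have "real N * e\<^sup>2 = (\<Sum>n\<in>F. e\<^sup>2)" using F(2) by simp
      also have "\<dots> \<le> (\<Sum>n\<in>F. (cmod (u n))\<^sup>2)"
        using F(3) e by (intro sum_mono power_mono) auto
      also have "\<dots> \<le> (norm v)\<^sup>2" unfolding u_def by (rule sum_sq_le_norm_ell2[OF F(1)])
      finally show False using N e by (simp add: field_simps)
    qed
    then have M: "\<bar>n\<bar> \<le> Max (abs ` {n. e \<le> cmod (u n)})" if "e \<le> cmod (u n)" for n
      using that by (intro Max_ge) auto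
    have "cmod (u n) < e" if "\<bar>n\<bar> \<ge> Max (abs ` {n. e \<le> cmod (u n)}) + 1" for n
      using M[of n] that by linarith
    then show ?thesis by blast
  qed
  have "cmod (u 0) + cmod (u 1) \<le> e" if e: "e > 0" for e
  proof -
    \<comment> \<open>Six values with prefactor 4 account for the 24; the \<open>+ 2\<close> in
      \<open>k\<close> keeps - p + 1 beyond M as well.\<close>
    obtain M where M: "\<And>n. \<bar>n\<bar> \<ge> M \<Longrightarrow> cmod (u n) < e / 24" using dec[of "e / 24"] e by auto
    define k where "k = nat (\<lceil>\<bar>E\<bar>\<rceil> + \<bar>M\<bar> + 2)"
    have kE: "\<bar>E\<bar> \<le> real k" unfolding k_def by linarith
    have kM: "int k \<ge> \<bar>M\<bar> + 2" unfolding k_def by linarith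
    obtain p :: int where p: "p > int k" and gp: "cmod (u 0) + cmod (u 1) \<le> 4 * ((cmod (u (- p)) + cmod (u (- p + 1))) +
         (cmod (u p) + cmod (u (p + 1))) + (cmod (u (2 * p)) + cmod (u (2 * p + 1))))"
      using g[of k] kE sol unfolding gordon_def by blast
    have "cmod (u (- p)) < e / 24" "cmod (u (- p + 1)) < e / 24" "cmod (u p) < e / 24"
      "cmod (u (p + 1)) < e / 24" "cmod (u (2 * p)) < e / 24" "cmod (u (2 * p + 1)) < e / 24"
      using p kM by (intro M; linarith)+
    then show ?thesis using gp by (simp add: field_simps)
  qed
  then have z: "cmod (u 0) + cmod (u 1) \<le> 0" by (rule field_le_epsilon[of _ 0, simplified])
  obtain A B where A: "\<And>n. \<bar>a n\<bar> \<le> A" and B: "\<And>n. \<bar>b n\<bar> \<le> B"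
    using a_bounded b_bounded by (auto simp: bounded_iff)
  have A': "a n \<le> A" for n using A[of n] by linarith
  have "u n = 0" for n
  proof -
    have z0: "cmod (u 0) + cmod (u 1) = 0" using z norm_ge_zero[of "u 0"] norm_ge_zero[of "u 1"] by linarith
    have "cmod (u n) + cmod (u (n + 1)) \<le> 0"
      using solution_growth[where u = u and n = n, OF \<alpha> A' B order_refl sol refl] unfolding z0 by simp
    then have "cmod (u n) \<le> 0" using norm_ge_zero[of "u (n + 1)"] by linarith
    then show ?thesis by simp
  qed
  then show ?thesis by (simp add: ell2_eq_0_iff u_def)
qed

end

section \<open>The spectrum of generic limit-periodic operators\<close>

text \<open>At one scale below 1 / (k + 1) the covering exponent ln M / ln (1 / r) is at most 1 / (k
  + 1). The lower box dimension is a lower limit, so one such scale for each k is enough.\<close>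

definition thin :: "(int \<Rightarrow> real) \<Rightarrow> (int \<Rightarrow> real) \<Rightarrow> nat \<Rightarrow> bool" where
  "thin a b k \<longleftrightarrow> (\<exists>M r. M > 0 \<and> r > 0 \<and> r < 1 / (real k + 1) \<and>
     ln (real M) \<le> 1 / (real k + 1) * ln (1 / r) \<and> covered (asp (jac a b)) M r)"

text \<open>An exponent of at most 1 / 2 gives M r <= sqrt r, so the covers have total length at
  most 2 sqrt r, which tends to 0 as k grows.\<close>

lemma thin_null:
  assumes cov: "\<And>k. thin a b k" and S: "asp (jac a b) \<in> sets borel"
  shows "emeasure lborel (asp (jac a b)) = 0"
proof -
  have le: "emeasure lborel (asp (jac a b)) \<le> ennreal (2 * sqrt (1 / (real k + 1)))" if "k \<ge> 1" for k
  proof -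
    define e where "e = 1 / (real k + 1)"
    have e: "e \<le> 1 / 2" "0 < e" using that by (auto simp: e_def field_simps)
    obtain M r where M: "M > 0" "r > 0" "r < e" "ln (real M) \<le> e * ln (1 / r)" "covered (asp (jac a b)) M r"
      using cov[of k] unfolding thin_def e_def by blast
    obtain C where C: "finite C" "card C \<le> M" "asp (jac a b) \<subseteq> (\<Union>c\<in>C. cball c r)"
      using M(5) by (auto simp: covered_def)
    have "r < 1" using M(3) e by linarith
    then have lr: "ln (1 / r) \<ge> 0" using M(2) by simp
    have "ln (real M * r) = ln (real M) - ln (1 / r)" using M(1,2) by (simp add: ln_mult ln_div)
    also have "\<dots> \<le> - (1 / 2) * ln (1 / r)"
      using M(4) mult_right_mono[OF e(1) lr] by linarith
    also have "\<dots> = ln (sqrt r)" using M(2) by (simp add: ln_sqrt ln_div)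
    finally have Mr: "real M * r \<le> sqrt r" using M(1,2) by (subst (asm) ln_le_cancel_iff) auto
    have "emeasure lborel (asp (jac a b)) \<le> emeasure lborel (\<Union>c\<in>C. cball c r)"
      using C(1) by (intro emeasure_mono C(3)) auto
    also have "\<dots> \<le> (\<Sum>c\<in>C. emeasure lborel (cball c r))"
      using C(1) by (intro emeasure_subadditive_finite) auto
    also have "\<dots> = (\<Sum>c\<in>C. ennreal (2 * r))"
      using M(2) by (intro sum.cong) (auto simp: cball_eq_atLeastAtMost)
    also have "\<dots> = ennreal (real (card C) * (2 * r))"
      using M(2) by (simp add: ennreal_mult ennreal_of_nat_eq_real_of_nat)
    also have "\<dots> \<le> ennreal (2 * sqrt (1 / (real k + 1)))"
    proof (rule ennreal_leI)
      have "real (card C) * (2 * r) \<le> real M * (2 * r)" using C(2) M(2) by (intro mult_right_mono) auto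
      also have "\<dots> \<le> 2 * sqrt r" using Mr by simp
      also have "\<dots> \<le> 2 * sqrt (1 / (real k + 1))" using M(3) by (simp add: e_def real_sqrt_le_mono less_imp_le)
      finally show "real (card C) * (2 * r) \<le> 2 * sqrt (1 / (real k + 1))" .
    qed
    finally show ?thesis .
  qed
  have "(\<lambda>k::nat. 2 * sqrt (1 / (real k + 1))) \<longlonglongrightarrow> 0" by real_asymp
  then have "(\<lambda>k::nat. ennreal (2 * sqrt (1 / (real k + 1)))) \<longlonglongrightarrow> ennreal 0" by (rule tendsto_ennrealI)
  then have "emeasure lborel (asp (jac a b)) \<le> ennreal 0"
    by (rule LIMSEQ_le_const) (use le in blast)
  then show ?thesis by simp
qed

lemma covering_number_le: "covered S M r \<Longrightarrow> covering_number S r \<le> M"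
proof -
  assume "covered S M r"
  then obtain C where C: "finite C" "card C \<le> M" "S \<subseteq> (\<Union>c\<in>C. cball c r)" by (auto simp: covered_def)
  have "covering_number S r \<le> card C"
    unfolding covering_number_def by (rule cInf_lower) (use C in auto)
  then show ?thesis using C(2) by linarith
qed

lemma thin_lower_box_dim:
  assumes thin: "\<And>k. thin a b k"
  shows "lower_box_dim (asp (jac a b)) = 0"
proof (rule antisym)
  define f where "f \<epsilon> = ln (real (covering_number (asp (jac a b)) \<epsilon>)) / ln (1 / \<epsilon>)" for \<epsilon>
  \<comment> \<open>The case n = 0 relies on the convention ln 0 = 0.\<close>
  have ln_nat: "0 \<le> ln (real n)" for n by (cases "n = 0") auto
  show "0 \<le> lower_box_dim (asp (jac a b))"
    unfolding lower_box_dim_def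
  proof (rule Liminf_bounded)
    have "\<forall>\<^sub>F \<epsilon> in at_right (0::real). \<epsilon> \<in> {0<..<1}"
      by (rule eventually_at_right_real) simp
    then show "\<forall>\<^sub>F \<epsilon> in at_right 0. 0 \<le> ereal (ln (real (covering_number (asp (jac a b)) \<epsilon>)) / ln (1 / \<epsilon>))"
      by eventually_elim (auto intro!: divide_nonneg_nonneg ln_nat)
  qed
  show "lower_box_dim (asp (jac a b)) \<le> 0"
  proof (rule ccontr)
    assume "\<not> lower_box_dim (asp (jac a b)) \<le> 0"
    then have "0 < lower_box_dim (asp (jac a b))" by (simp add: not_le)
    from ereal_dense2[OF this] obtain c where c: "0 < ereal c" "ereal c < lower_box_dim (asp (jac a b))"
      by blast
    have "\<forall>\<^sub>F \<epsilon> in at_right 0. ereal c < ereal (f \<epsilon>)"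
      using less_LiminfD[OF c(2)[unfolded lower_box_dim_def]] by (simp add: f_def)
    then obtain d where d: "d > 0" "\<And>\<epsilon>. 0 < \<epsilon> \<Longrightarrow> \<epsilon> < d \<Longrightarrow> c < f \<epsilon>"
      by (auto simp: eventually_at_right_field)
    obtain k :: nat where k: "1 / (real k + 1) < min (min d c) 1"
      using d(1) c(1) reals_Archimedean[of "min (min d c) 1"] by (auto simp: inverse_eq_divide add.commute)
    obtain M r where M: "M > 0" "r > 0" "r < 1 / (real k + 1)" "ln (real M) \<le> 1 / (real k + 1) * ln (1 / r)"
      "covered (asp (jac a b)) M r"
      using thin[of k] unfolding thin_def by blast
    have "r < 1" using M(3) k by linarith
    then have lr: "ln (1 / r) > 0" using M(2) by simp
    have "ln (real (covering_number (asp (jac a b)) r)) \<le> ln (real M)"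
      using covering_number_le[OF M(5)] M(1) by (cases "covering_number (asp (jac a b)) r = 0") auto
    also have "\<dots> \<le> 1 / (real k + 1) * ln (1 / r)" by (rule M(4))
    finally have "f r \<le> 1 / (real k + 1)" using lr by (simp add: f_def field_simps)
    moreover have "c < f r" using M(2,3) k by (intro d(2)) auto
    ultimately show False using k by simp
  qed
qed

section \<open>Periodic sequences and generic sets in the space of bounded sequences\<close>

lemma periodic_seq_natE:
  assumes "periodic_seq f" obtains p where "p > 0" "\<And>n. f (n + int p) = f n"
proof -
  obtain p where p: "p > 0" "\<And>n. f (n + p) = f n" using assms by (auto simp: periodic_seq_def)
  show ?thesis by (rule that[of "nat p"]) (use p in auto)
qed

lemma periodic_seq_range:
  assumes p: "p > 0" and per: "\<And>n. f (n + int p) = f n"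
  shows "range f = f ` {0..<int p}"
proof -
  have "f n = f (n mod int p)" for n
  proof -
    have "f (m + int p * k) = f m" for m k
    proof (induction k rule: int_induct[where k = 0])
      case (step1 i)
      then show ?case using per[of "m + int p * i"] by (simp add: algebra_simps)
    next
      case (step2 i)
      then show ?case using per[of "m + int p * (i - 1)"] by (simp add: algebra_simps)
    qed simp
    from this[of "n mod int p" "n div int p"] show ?thesis by simp
  qed
  moreover have "n mod int p \<in> {0..<int p}" for n using p by simp
  ultimately have "f n \<in> f ` {0..<int p}" for n by (rule image_eqI)
  then show ?thesis by auto
qed

lemma dist_bcontfun_le:
  fixes f g :: "int \<Rightarrow>\<^sub>C real"
  assumes "\<And>n. \<bar>apply_bcontfun f n - apply_bcontfun g n\<bar> \<le> d"
  shows "dist f g \<le> d"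
  using assms by (intro dist_bound) (simp add: dist_real_def)

lemma bcontfun_abs_le:
  fixes f g :: "int \<Rightarrow>\<^sub>C real"
  shows "\<bar>apply_bcontfun f n - apply_bcontfun g n\<bar> \<le> dist f g"
  using dist_bounded[of f n g] by (simp add: dist_real_def)

text \<open>The library proves completeness only over metric domains, and int is not one.\<close>
lemma complete_bcontfun_int: "complete (UNIV :: (int \<Rightarrow>\<^sub>C real) set)"
  unfolding complete_def
proof (intro allI impI, elim conjE)
  fix f :: "nat \<Rightarrow> int \<Rightarrow>\<^sub>C real" assume f: "Cauchy f"
  have "\<exists>N. \<forall>m n x. N \<le> m \<and> N \<le> n \<and> True \<longrightarrow> dist (f m x) (f n x) < e" if e: "e > 0" for e
  proof -
    obtain N where "\<And>m n. N \<le> m \<Longrightarrow> N \<le> n \<Longrightarrow> dist (f m) (f n) < e"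
      using f e unfolding Cauchy_def by blast
    then show ?thesis
      using dist_fun_lt_imp_dist_val_lt by blast
  qed
  then obtain g where "uniform_limit UNIV f g sequentially"
    using uniformly_convergent_eq_cauchy[of "\<lambda>_. True" "\<lambda>n. apply_bcontfun (f n)"]
    unfolding uniform_limit_sequentially_iff by auto
  then show "\<exists>l\<in>UNIV. f \<longlonglongrightarrow> l"
    using uniform_limit_bcontfunE[OF _ sequentially_bot] by blast
qed

text \<open>Taking the interior makes openness automatic and shifts the work to density: near each
  periodic b an entire ball has to be found.\<close>

definition good :: "(int \<Rightarrow> real) \<Rightarrow> nat \<Rightarrow> (int \<Rightarrow>\<^sub>C real) set" where
  "good a k = interior {b. thin a (apply_bcontfun b) k \<and> gordon a (apply_bcontfun b) k}"

text \<open>The periodic W from \<open>thin_spectrum\<close> keeps its thin spectrum under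
  perturbations of size r and Gordon's inequality under those of size s, so the ball of radius
  \<open>min r s\<close> about it consists of suitable sequences.\<close>

lemma good_near_periodic:
  fixes b :: "int \<Rightarrow>\<^sub>C real"
  assumes a: "periodic_seq a" "\<And>n. a n > 0" and b: "periodic_seq (apply_bcontfun b)" and d: "d > 0"
  shows "\<exists>b'\<in>LP \<inter> good a k. dist b' b \<le> d"
proof -
  obtain p1 where p1: "p1 > 0" "\<And>n. a (n + int p1) = a n" using periodic_seq_natE[OF a(1)] by blast
  obtain p2 where p2: "p2 > 0" "\<And>n. b (n + int p2) = b n" using periodic_seq_natE[OF b] by blast
  define p where "p = p1 * p2"
  have p: "p > 0" using p1 p2 by (simp add: p_def)
  have pa: "a (n + int p) = a n" for n
    by (rule periodic_dvd[where f = a and p = p1, OF p1(2)]) (simp add: p_def)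
  have pb: "b (n + int p) = b n" for n
    by (rule periodic_dvd[where f = "apply_bcontfun b" and p = p2, OF p2(2)]) (simp add: p_def)
  have fin: "finite (range a)" unfolding periodic_seq_range[where f = a, OF p pa] by simp
  define \<alpha> where "\<alpha> = Min (range a)"
  have "\<alpha> \<in> range a" unfolding \<alpha>_def by (intro Min_in fin) auto
  then have \<alpha>: "\<alpha> > 0" "\<And>n. \<alpha> \<le> a n" using a(2) fin by (auto simp: \<alpha>_def)
  have abd: "bounded (range a)" using fin by (rule finite_imp_bounded)
  interpret J: positive_jacobi a "apply_bcontfun b" \<alpha>
    by (intro positive_jacobi.intro bounded_jacobi.intro positive_jacobi_axioms.intro abd \<alpha>) auto
  obtain P :: nat and W :: "int \<Rightarrow> real" and M :: nat and r :: real where W: "P > 0" "p dvd P" "\<And>n. W (n + int P) = W n" "\<And>n. \<bar>W n - b n\<bar> \<le> d"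
    "M > 0" "r > 0" "3 * r < 1 / (real k + 1)" "ln (real M) \<le> 1 / (real k + 1) * ln (1 / (3 * r))" "covered (asp (jac a W)) M r"
  proof (rule J.thin_spectrum[where e = "1 / (real k + 1)", OF p pa pb d])
    show "0 < 1 / (real k + 1)" by simp
  qed (rule that)
  have Wbd: "bounded (range W)"
    unfolding periodic_seq_range[where f = W, OF W(1,3)] by (intro finite_imp_bounded) simp
  interpret W: positive_jacobi a W \<alpha>
    by (intro positive_jacobi.intro bounded_jacobi.intro positive_jacobi_axioms.intro abd \<alpha> Wbd)
  have PA: "a (n + int P) = a n" for n by (rule periodic_dvd[where f = a and p = p, OF pa W(2)])
  obtain s where s: "s > 0" "\<And>b'. (\<And>n. \<bar>b' n - W n\<bar> \<le> s) \<Longrightarrow> gordon a b' k"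
    using W.gordon_near_periodic[OF W(1) PA W(3), of k] by blast
  have "W \<in> bcontfun" unfolding bcontfun_def using Wbd by simp
  then obtain w where w: "apply_bcontfun w = W" using Bcontfun_inverse by blast
  have "periodic_seq (apply_bcontfun w)"
    unfolding w periodic_seq_def using W(1,3) by (intro exI[of _ "int P"] conjI allI) simp_all
  then have "w \<in> LP" unfolding LP_def by (intro closure_subset[THEN subsetD]) simp
  moreover have "w \<in> good a k"
    unfolding good_def mem_interior
  proof (intro exI[of _ "min r s"] conjI subsetI)
    show "min r s > 0" using W(6) s(1) by simp
    fix x assume "x \<in> ball w (min r s)"
    then have "dist x w \<le> r" "dist x w \<le> s" by (auto simp: dist_commute)
    then have x: "\<bar>x n - W n\<bar> \<le> r" "\<bar>x n - W n\<bar> \<le> s" for n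
      using bcontfun_abs_le[of x n w] by (auto simp: w)
    interpret X: bounded_jacobi a "apply_bcontfun x" by (intro bounded_jacobi.intro abd) auto
    \<comment> \<open>Of the radius 3 r, one r comes from the cover for W, one from the
      perturbation, and one is the slack e of \<open>asp_near_perturbed\<close>.\<close>
    have "covered (asp (jac a x)) M (3 * r)"
    proof -
      obtain C where C: "finite C" "card C \<le> M" "asp (jac a W) \<subseteq> (\<Union>c\<in>C. cball c r)"
        using W(9) by (auto simp: covered_def)
      have "asp (jac a x) \<subseteq> (\<Union>c\<in>C. cball c (3 * r))"
      proof
        fix E assume "E \<in> asp (jac a x)"
        then obtain l where l: "l \<in> asp (jac a W)" "\<bar>l - E\<bar> \<le> r + r"
          using X.asp_near_perturbed[OF Wbd x(1) W(6)] by blast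
        then obtain c where "c \<in> C" "dist c l \<le> r" using C(3) by auto
        then show "E \<in> (\<Union>c\<in>C. cball c (3 * r))" using l(2) by (auto simp: dist_real_def intro!: bexI[of _ c])
      qed
      then show ?thesis using C by (auto simp: covered_def)
    qed
    then have "thin a x k" unfolding thin_def using W(5-8) by (intro exI[of _ M] exI[of _ "3 * r"]) auto
    then show "x \<in> {b. thin a (apply_bcontfun b) k \<and> gordon a (apply_bcontfun b) k}"
      using s(2)[OF x(2)] by simp
  qed
  moreover have "dist w b \<le> d" by (rule dist_bcontfun_le) (use W(4) in \<open>simp add: w\<close>)
  ultimately show ?thesis by blast
qed

theorem theorem1p4:
  fixes a :: "int \<Rightarrow> real"
  assumes "periodic_seq a" and "\<And>n. a n > 0"
  shows "\<exists>D. D \<subseteq> LP \<and> LP \<subseteq> closure D \<and>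
           (\<forall>b\<in>D.
              (\<exists>S. jacobi_spectrum a (apply_bcontfun b) = complex_of_real ` S \<and>
                   cantor_set S \<and> lower_box_dim S = 0) \<and>
              purely_singular_continuous a (apply_bcontfun b))"
proof (intro exI[of _ "\<Inter>k. LP \<inter> good a k"] conjI ballI)
  show "(\<Inter>k. LP \<inter> good a k) \<subseteq> LP" by blast
  \<comment> \<open>Baire's theorem is applied within LP itself, a closed subset of a complete
    space.\<close>
  have "closed LP" by (simp add: LP_def)
  moreover have "completely_metrizable_space (euclidean :: (int \<Rightarrow>\<^sub>C real) topology)"
    using Met_TC.completely_metrizable_space_mtopology[where 'a = "int \<Rightarrow>\<^sub>C real"] complete_bcontfun_int
    by simp
  ultimately have cm: "completely_metrizable_space (top_of_set LP)"
    using completely_metrizable_space_closedin closed_closedin by blast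
  have "(top_of_set LP) closure_of (\<Inter>(range (\<lambda>k. LP \<inter> good a k))) = topspace (top_of_set LP)"
  proof (rule Baire_category)
    fix T assume "T \<in> range (\<lambda>k. LP \<inter> good a k)"
    then obtain k where T: "T = LP \<inter> good a k" by blast
    \<comment> \<open>As LP is the closure of the periodic sequences, only these have to be
      approximated.\<close>
    have "LP \<subseteq> closure (LP \<inter> good a k)"
      unfolding LP_def
    proof (rule closure_minimal)
      show "{b. periodic_seq (apply_bcontfun b)} \<subseteq> closure (closure {b. periodic_seq (apply_bcontfun b)} \<inter> good a k)"
      proof
        fix b :: "int \<Rightarrow>\<^sub>C real" assume "b \<in> {b. periodic_seq (apply_bcontfun b)}"
        then have "\<exists>b'\<in>LP \<inter> good a k. dist b' b \<le> e / 2" if "e > 0" for e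
          using good_near_periodic[OF assms, of b "e / 2" k] that by simp
        then have "\<exists>b'\<in>LP \<inter> good a k. dist b' b < e" if "e > 0" for e
        proof -
          have "e / 2 < e" using that by simp
          then show ?thesis
            using \<open>\<And>e. e > 0 \<Longrightarrow> \<exists>b'\<in>LP \<inter> good a k. dist b' b \<le> e / 2\<close>[OF that] by (meson order_le_less_trans)
        qed
        then show "b \<in> closure (closure {b. periodic_seq (apply_bcontfun b)} \<inter> good a k)"
          by (simp add: closure_approachable LP_def)
      qed
    qed simp
    then show "openin (top_of_set LP) T \<and> (top_of_set LP) closure_of T = topspace (top_of_set LP)"
      unfolding T by (auto simp: good_def closure_of_subtopology intro!: openin_open_Int)
  qed (use cm in auto)
  then show "LP \<subseteq> closure (\<Inter>k. LP \<inter> good a k)"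
    by (auto simp: closure_of_subtopology)
next
  fix b assume b: "b \<in> (\<Inter>k. LP \<inter> good a k)"
  obtain p where p: "p > 0" "\<And>n. a (n + int p) = a n" using periodic_seq_natE[OF assms(1)] by blast
  have fin: "finite (range a)" unfolding periodic_seq_range[where f = a, OF p] by simp
  define \<alpha> where "\<alpha> = Min (range a)"
  have "\<alpha> \<in> range a" unfolding \<alpha>_def by (intro Min_in fin) auto
  then have \<alpha>: "\<alpha> > 0" "\<And>n. \<alpha> \<le> a n" using assms(2) fin by (auto simp: \<alpha>_def)
  interpret J: positive_jacobi a "apply_bcontfun b" \<alpha>
    by (intro positive_jacobi.intro bounded_jacobi.intro positive_jacobi_axioms.intro
        finite_imp_bounded[OF fin] \<alpha>) auto
  have "b \<in> {b. thin a (apply_bcontfun b) k \<and> gordon a (apply_bcontfun b) k}" for k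
    using b interior_subset unfolding good_def by blast
  then have thin: "\<And>k. thin a b k" and gordon: "\<And>k. gordon a b k" by auto
  define S where "S = asp (jac a b)"
  have noeig: "v = 0" if "jac a b v = E *\<^sub>R v" for E v
    by (rule J.gordon_no_eigenvector[OF gordon that])
  have cS: "compact S" unfolding S_def by (rule J.compact_asp)
  have null: "emeasure lborel S = 0"
    unfolding S_def by (rule thin_null[OF thin]) (use cS in \<open>simp add: S_def borel_compact\<close>)
  have "negligible S"
    using null cS by (simp add: negligible_iff_emeasure0 borel_compact)
  then have "interior S = {}"
    using open_not_negligible negligible_subset interior_subset open_interior by metis
  moreover have "\<forall>x\<in>S. x islimpt S"
    using J.isolated_eigenvector noeig unfolding S_def by blast
  ultimately have "cantor_set S" using cS by (simp add: cantor_set_def)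
  moreover have "jacobi_spectrum a b = complex_of_real ` S" unfolding S_def by (rule J.jacobi_spectrum_eq)
  moreover have "lower_box_dim S = 0" unfolding S_def by (rule thin_lower_box_dim[OF thin])
  ultimately show "\<exists>S. jacobi_spectrum a b = complex_of_real ` S \<and> cantor_set S \<and> lower_box_dim S = 0" by blast
  show "purely_singular_continuous a b"
    by (rule J.purely_singular_continuousI) (use null noeig in \<open>auto simp: S_def\<close>)
qed

end
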